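(* Let $G=([n],E)$ be a graph without twin pairs and let $B\in\mathcal{B}(G)$. The Lasserre hierarchy $(f_{G,B}^{(r)})_{r\ge 1}$ has finite convergence to $\frac{1}{\alpha(G)}$ (that is, $f_{G,B}^{(r)}=\frac{1}{\alpha(G)}$ for some $r\ge 1$) if and only if $B_{lm}>1$ for every critical edge $\{l,m\}$ of $G$.
   Context: Graphs are finite, simple and undirected; $[n]=\{1,\dots,n\}$. $\alpha(G)$ is the maximum cardinality of a stable set of $G$ (a set of vertices no two distinct elements of which are adjacent). An edge $e$ of $G$ is critical if $\alpha(G\setminus e)=\alpha(G)+1$, where $G\setminus e$ is obtained from $G$ by deleting the edge $e$ (keeping all vertices). A pair of vertices $(i,j)$ is a twin pair of $G$ if $\{i,j\}\in E$ and $N_G(i)\setminus\{j\}=N_G(j)\setminus\{i\}$, where $N_G(v)$ is the set of neighbours of $v$. $\mathcal{B}(G)$ is the set of real symmetric $n\times n$ matrices $B$ with $B_{ii}=1$ for all $i\in[n]$, $B_{ij}\ge 1$ for $\{i,j\}\in E$, and $B_{ij}=0$ for distinct $i,j$ with $\{i,j\}\notin E$. For $B\in\mathcal{B}(G)$ one has $\min\{x^TBx: x\in\Delta_n\}=\frac{1}{\alpha(G)}$, where $\Delta_n=\{x\in\mathbb{R}^n:\sum_{i=1}^n x_i=1,\ x_i\ge 0 \text{ for } i\in[n]\}$. Let $\mathbb{R}[x]=\mathbb{R}[x_1,\dots,x_n]$, let $\Sigma$ be the cone of sums of squares of polynomials, and for an integer $r\ge 1$ let $$\mathcal{M}(x_1,\dots,x_n)_r=\Big\{\sigma_0+\sum_{i=1}^n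 x_i\sigma_i:\ \sigma_0,\dots,\sigma_n\in\Sigma,\ \deg\sigma_0\le r,\ \deg(x_i\sigma_i)\le r \text{ for } i\in[n]\Big\}.$$ Let $I_{\Delta_n}$ be the ideal of $\mathbb{R}[x]$ generated by $\sum_{i=1}^n x_i-1$. The Lasserre relaxation of order $r$ is $$f_{G,B}^{(r)}=\sup\{\lambda\in\mathbb{R}:\ x^TBx-\lambda\in\mathcal{M}(x_1,\dots,x_n)_r+I_{\Delta_n}\}$$ (with $\sup\emptyset=-\infty$). *)

theory Defs
  imports "HOL-Analysis.Analysis" "HOL-Library.Poly_Mapping"
begin

text \<open>
  The vertex set \<open>[n]\<close> is the universe of a finite type \<open>'n\<close>, so that \<open>n = CARD('n)\<close>;
  a graph is given by its set of edges, which are unordered pairs of vertices.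
\<close>

definition simple_graph :: "'n set set \<Rightarrow> bool" where
  "simple_graph E \<longleftrightarrow> (\<forall>e\<in>E. card e = 2)"

definition stable :: "'n set set \<Rightarrow> 'n set \<Rightarrow> bool" where
  "stable E S \<longleftrightarrow> (\<forall>i\<in>S. \<forall>j\<in>S. i \<noteq> j \<longrightarrow> {i, j} \<notin> E)"

definition stability_number :: "('n::finite) set set \<Rightarrow> nat" where
  "stability_number E = Max (card ` {S. stable E S})"

definition critical_edge :: "('n::finite) set set \<Rightarrow> 'n set \<Rightarrow> bool" where
  "critical_edge E e \<longleftrightarrow> e \<in> E \<and> stability_number (E - {e}) = stability_number E + 1"

definition neighbours :: "'n set set \<Rightarrow> 'n \<Rightarrow> 'n set" where
  "neighbours E i = {j. {i, j} \<in> E}"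

definition twin_pair :: "'n set set \<Rightarrow> 'n \<Rightarrow> 'n \<Rightarrow> bool" where
  "twin_pair E i j \<longleftrightarrow> {i, j} \<in> E \<and> neighbours E i - {j} = neighbours E j - {i}"

definition graph_matrices :: "'n set set \<Rightarrow> (real ^ 'n ^ 'n) set" where
  "graph_matrices E =
     {B. transpose B = B \<and> (\<forall>i. B $ i $ i = 1) \<and>
         (\<forall>i j. {i, j} \<in> E \<longrightarrow> B $ i $ j \<ge> 1) \<and>
         (\<forall>i j. i \<noteq> j \<and> {i, j} \<notin> E \<longrightarrow> B $ i $ j = 0)}"

text \<open>
  Real polynomials in variables indexed by \<open>'n\<close>: finitely supported functions from exponent
  vectors to coefficients, multiplied by convolution.
\<close>

type_synonym 'n mpoly = "('n \<Rightarrow>\<^sub>0 nat) \<Rightarrow>\<^sub>0 real"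

definition Const :: "real \<Rightarrow> 'n mpoly" where
  "Const c = Poly_Mapping.single 0 c"

definition Var :: "'n \<Rightarrow> 'n mpoly" where
  "Var i = Poly_Mapping.single (Poly_Mapping.single i 1) 1"

text \<open>
  The zero polynomial gets degree \<open>0\<close>; as only bounds by a natural number are
  used below, this agrees with the convention that its degree is minus infinity.
\<close>

definition total_degree :: "('n::finite) mpoly \<Rightarrow> nat" where
  "total_degree p =
     Max (insert 0 ((\<lambda>m. \<Sum>i\<in>UNIV. Poly_Mapping.lookup m i) ` Poly_Mapping.keys p))"

definition sos :: "'n mpoly set" where
  "sos = {\<Sum>k<N. (q k)\<^sup>2 | (N::nat) q. True}"

definition truncated_quadratic_module :: "nat \<Rightarrow> ('n::finite) mpoly set" where
  "truncated_quadratic_module r =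
     {\<sigma>\<^sub>0 + (\<Sum>i\<in>UNIV. Var i * \<sigma> i) | \<sigma>\<^sub>0 \<sigma>.
        \<sigma>\<^sub>0 \<in> sos \<and> (\<forall>i. \<sigma> i \<in> sos) \<and>
        total_degree \<sigma>\<^sub>0 \<le> r \<and> (\<forall>i. total_degree (Var i * \<sigma> i) \<le> r)}"

text \<open>
  An ideal of a commutative ring is a submodule of the ring regarded as a module over itself,
  so the ideal generated by a set is its span for the ring multiplication.
\<close>

definition simplex_ideal :: "('n::finite) mpoly set" where
  "simplex_ideal = module.span (*) {(\<Sum>i\<in>UNIV. Var i) - 1}"

lemma simplex_ideal_eq:
  "simplex_ideal = {q * ((\<Sum>i\<in>UNIV. Var i) - 1) | q :: ('n::finite) mpoly. True}"
proof -
  interpret module "(*) :: 'n mpoly \<Rightarrow> 'n mpoly \<Rightarrow> 'n mpoly"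
    by standard (simp_all add: algebra_simps)
  show ?thesis
    unfolding simplex_ideal_def by (auto simp: span_singleton)
qed

definition quadratic_form :: "real ^ 'n ^ 'n \<Rightarrow> ('n::finite) mpoly" where
  "quadratic_form B = (\<Sum>i\<in>UNIV. \<Sum>j\<in>UNIV. Const (B $ i $ j) * Var i * Var j)"

text \<open>
  The supremum is taken in the extended reals, where the supremum of the empty set is
  minus infinity.
\<close>

definition lasserre :: "real ^ 'n ^ 'n \<Rightarrow> nat \<Rightarrow> ereal" where
  "lasserre B r =
     Sup {ereal c | c. \<exists>p\<in>truncated_quadratic_module r. \<exists>h\<in>simplex_ideal.
            quadratic_form B - Const c = p + (h :: ('n::finite) mpoly)}"

end

theory Submission
  imports Defs "HOL-Computational_Algebra.Polynomial"
begin

text \<open>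
  Write \<open>f x = x \<bullet> (B *v x)\<close>, let \<open>\<alpha>\<close> be the stability number, let \<open>M\<close> be the set of polynomials
  \<open>\<sigma>\<^sub>0 + \<Sum>i. x\<^sub>i \<sigma>\<^sub>i\<close> with sums of squares \<open>\<sigma>\<^sub>0, \<sigma>\<^sub>i\<close>, and count two polynomials as equal when they
  agree on the hyperplane \<open>\<Sum>i. x\<^sub>i = 1\<close>; this is equality modulo the ideal of the simplex.

  Suppose that every critical edge has weight above 1. When mass is moved along an edge inside
  the support of a point, \<open>f\<close> changes as a concave function, so \<open>f \<ge> 1/\<alpha>\<close> on the simplex, and equality at a
  point whose support is not stable would produce a critical edge of weight 1. Hence the only minimizers
  are the barycentres \<open>z\<^sub>S\<close> of the maximum stable sets \<open>S\<close> (\<open>motzkin_straus\<close>). At such a point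
  the derivative of \<open>f\<close> in every direction that leaves the face of \<open>S\<close> is positive, because a vertex outside \<open>S\<close> has two
  neighbours in \<open>S\<close> or is joined to \<open>S\<close> by a single, critical edge. Completing squares turns this
  into an explicit inequality modulo \<open>M\<close>, namely
  \<open>f - 1/\<alpha> \<ge> \<bar>x - z\<^sub>S\<bar>\<^sup>2 (1 - C \<Sum>i\<notin>S. x\<^sub>i)\<close> (\<open>local_certificate\<close>).

  These local inequalities are glued. The polynomial \<open>p\<^sub>S = \<Prod>i\<in>S. \<alpha> x\<^sub>i\<close> lies between 0 and 1 on the
  simplex, is 1 only at \<open>z\<^sub>S\<close>, and vanishes at the other minimizers, so \<open>u = \<Sum>S. p\<^sub>S\<^bsup>2k+2\<^esup>\<close> is 1 at
  the minimizers and, for large \<open>k\<close>, small away from them. The identity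
  \<open>1 = u ((3 - u)/2)\<^sup>2 + (1 - u)\<^sup>2 (4 - u)/4\<close> splits \<open>f - 1/\<alpha>\<close> into a part to which the local
  inequalities apply and a part with the square factor \<open>(1 - u)\<^sup>2\<close>, whose cofactor only has to be positive
  on the simplex, up to a small error. The errors are multiples of squares that vanish at all minimizers
  (\<open>slack\<close>), and a small multiple of \<open>slack\<close> can be split off from \<open>f - 1/\<alpha>\<close> beforehand
  (\<open>form_in_quad_module\<close>).

  The gluing rests on Putinar's theorem for the simplex (\<open>positive_imp_quad_module\<close>): polynomials
  that are positive on the simplex lie in \<open>M\<close>. Up to arbitrarily small constants, \<open>M\<close> is closed
  under multiplication by coordinates. Expanding \<open>1 = (\<Sum>i. x\<^sub>i)\<^sup>N\<close> into monomials, and bounding the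
  polynomial from below by its value at the grid point that belongs to each monomial, leaves only an
  error given by a variance, which is at most a multiple of \<open>1/N\<close>.

  Conversely, let \<open>{l, m}\<close> be a critical edge of weight 1. Then \<open>f\<close> equals \<open>1/\<alpha>\<close> along a segment whose
  points \<open>u t\<close> share their mass at \<open>l\<close> and \<open>m\<close> in proportion \<open>t : 1 - t\<close>, and on the whole line
  through it. In a certificate for \<open>f - 1/\<alpha>\<close> at bounded degree, comparing first-order terms at
  \<open>u t\<close> towards a vertex \<open>k\<close> off the segment identifies \<open>\<sigma>\<^sub>k (u t)\<close> with an affine function of \<open>t\<close>
  of slope proportional to \<open>B\<^sub>k\<^sub>l - B\<^sub>k\<^sub>m\<close>. A sum of squares is nonnegative on the whole line, so the slope
  is 0 and \<open>k\<close> is adjacent to both of \<open>l\<close> and \<open>m\<close> or to neither. The other vertices that carry mass on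
  the segment are adjacent to neither, so \<open>l\<close> and \<open>m\<close> are twins. As the supremum need not be
  attained a priori, the comparison is carried out with errors that tend to 0 (\<open>finite_convergence_imp_equal_weights\<close>).
\<close>

section \<open>Polynomials and their values on the hyperplane of coordinate sum one\<close>

definition peval :: "real ^ 'n \<Rightarrow> ('n::finite) mpoly \<Rightarrow> real" where
  "peval x p = (\<Sum>m\<in>Poly_Mapping.keys p.
     Poly_Mapping.lookup p m * (\<Prod>i\<in>UNIV. x $ i ^ Poly_Mapping.lookup m i))"

lemma peval_eq_sum_superset:
  assumes "finite K" "Poly_Mapping.keys p \<subseteq> K"
  shows "peval x p =
    (\<Sum>m\<in>K. Poly_Mapping.lookup p m * (\<Prod>i\<in>UNIV. x $ i ^ Poly_Mapping.lookup m i))"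
  unfolding peval_def using assms
  by (intro sum.mono_neutral_left) (auto simp: in_keys_iff)

lemma peval_add [simp]: "peval x (p + q) = peval x p + peval x q"
proof -
  let ?K = "Poly_Mapping.keys p \<union> Poly_Mapping.keys q"
  have "Poly_Mapping.keys (p + q) \<subseteq> ?K" by (rule keys_add)
  then show ?thesis
    by (simp add: peval_eq_sum_superset[of ?K] lookup_add sum.distrib distrib_right)
qed

lemma peval_zero [simp]: "peval x 0 = 0"
  by (simp add: peval_def)

lemma peval_sum [simp]: "peval x (sum f A) = (\<Sum>a\<in>A. peval x (f a))"
  by (induction A rule: infinite_finite_induct) auto

lemma peval_single:
  "peval x (Poly_Mapping.single m c) = c * (\<Prod>i\<in>UNIV. x $ i ^ Poly_Mapping.lookup m i)"
  by (simp add: peval_def)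

lemma sum_singles:
  fixes p :: "'a \<Rightarrow>\<^sub>0 'b::comm_monoid_add"
  shows "p = (\<Sum>m\<in>Poly_Mapping.keys p. Poly_Mapping.single m (Poly_Mapping.lookup p m))"
proof (rule poly_mapping_eqI)
  fix k
  show "Poly_Mapping.lookup p k =
    Poly_Mapping.lookup (\<Sum>m\<in>Poly_Mapping.keys p. Poly_Mapping.single m (Poly_Mapping.lookup p m)) k"
    by (simp add: lookup_sum lookup_single when_def sum.delta' in_keys_iff)
qed

lemma peval_mult [simp]: "peval x (p * q) = peval x p * peval x q"
proof -
  have single: "peval x (Poly_Mapping.single m c * Poly_Mapping.single m' c') =
      peval x (Poly_Mapping.single m c) * peval x (Poly_Mapping.single m' c')" for m m' c c'
    by (simp add: mult_single peval_single lookup_add power_add prod.distrib)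
  let ?s = "\<lambda>p m. Poly_Mapping.single m (Poly_Mapping.lookup p m)"
  have "p * q = (\<Sum>m\<in>Poly_Mapping.keys p. ?s p m) * (\<Sum>m\<in>Poly_Mapping.keys q. ?s q m)"
    by (simp only: sum_singles[symmetric])
  also have "peval x \<dots> = (\<Sum>m\<in>Poly_Mapping.keys p. peval x (?s p m)) *
      (\<Sum>m\<in>Poly_Mapping.keys q. peval x (?s q m))"
    unfolding sum_product by (simp add: single)
  also have "\<dots> = peval x p * peval x q"
    unfolding peval_sum[symmetric] sum_singles[symmetric] ..
  finally show ?thesis .
qed

lemma peval_Const [simp]: "peval x (Const c) = c"
  by (simp add: Const_def peval_single)

lemma peval_Var [simp]: "peval x (Var i) = x $ i"
proof -
  have "(\<Prod>j\<in>UNIV. x $ j ^ (1 when i = j)) = (\<Prod>j\<in>UNIV. if j = i then x $ j else 1)"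
    by (rule prod.cong) (auto simp: when_def)
  then show ?thesis
    by (simp add: Var_def peval_single lookup_single)
qed

lemma Const_1: "Const 1 = (1 :: 'n mpoly)"
  by (simp add: Const_def)

lemma peval_1 [simp]: "peval x 1 = 1"
  using peval_Const[of x 1] by (simp add: Const_1)

lemma peval_diff [simp]: "peval x (p - q) = peval x p - peval x q"
  using peval_add[of x "p - q" q] by simp

lemma peval_power [simp]: "peval x (p ^ k) = peval x p ^ k"
  by (induction k) auto

lemma Var_power: "Var i ^ k = Poly_Mapping.single (Poly_Mapping.single i k) 1"
proof (induction k)
  case 0
  then show ?case by simp
next
  case (Suc k)
  then show ?case by (simp add: Var_def mult_single single_add[symmetric])
qed

lemma single_eq_Const_mult_Vars:
  "Poly_Mapping.single m c = Const c * (\<Prod>i\<in>UNIV. Var i ^ Poly_Mapping.lookup m (i::'n::finite))"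
proof -
  have "(\<Prod>i\<in>A. Var i ^ k i) = Poly_Mapping.single (\<Sum>i\<in>A. Poly_Mapping.single i (k i)) 1"
    if "finite A" for A :: "'n set" and k
    using that by (induction A rule: finite_induct) (simp_all add: Var_power mult_single)
  moreover have "(\<Sum>i\<in>UNIV. Poly_Mapping.single i (Poly_Mapping.lookup m i)) = m"
    by (rule poly_mapping_eqI) (simp add: lookup_sum lookup_single when_def)
  ultimately show ?thesis
    by (simp add: Const_def mult_single)
qed

lemma mpoly_induct [case_names Const Var add mult]:
  fixes p :: "('n::finite) mpoly"
  assumes "\<And>c. P (Const c)" "\<And>i. P (Var i)"
    and "\<And>p q. P p \<Longrightarrow> P q \<Longrightarrow> P (p + q)" "\<And>p q. P p \<Longrightarrow> P q \<Longrightarrow> P (p * q)"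
  shows "P p"
proof -
  have P1: "P 1" using assms(1)[of 1] by (simp add: Const_1)
  have P0: "P 0" using assms(1)[of 0] by (simp add: Const_def)
  have pow: "P (Var i ^ k)" for i k
    by (induction k) (use P1 assms in auto)
  have "P (\<Prod>i\<in>A. Var i ^ k i)" for A k
    by (induction A rule: infinite_finite_induct) (use P1 pow assms in auto)
  then have "P (Poly_Mapping.single m c)" for m c
    unfolding single_eq_Const_mult_Vars by (intro assms)
  then have "P (\<Sum>m\<in>A. Poly_Mapping.single m (f m))" for A f
    by (induction A rule: infinite_finite_induct) (use P0 assms in auto)
  then show ?thesis
    using sum_singles[of p] by metis
qed

text \<open>
  Induction on the set \<open>A\<close> of active variables: sorting the monomials by their exponent at one
  variable gives a univariate polynomial in it, all of whose coefficients vanish. Monomials are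
  required to agree off \<open>A\<close> so that each of these coefficients is again an instance of the statement.
\<close>
lemma monomials_linearly_independent:
  fixes K :: "('n \<Rightarrow> nat) set"
  assumes "finite A" "finite K"
    and "\<And>m m' i. m \<in> K \<Longrightarrow> m' \<in> K \<Longrightarrow> i \<notin> A \<Longrightarrow> m i = m' i"
    and "\<And>x::'n \<Rightarrow> real. (\<Sum>m\<in>K. c m * (\<Prod>i\<in>A. x i ^ m i)) = 0"
    and "m \<in> K"
  shows "c m = 0"
  using assms
proof (induction A arbitrary: K m rule: finite_induct)
  case empty
  have "m' = m" if "m' \<in> K" for m'
    using empty.prems(2)[OF that empty.prems(4)] by (intro ext) simp
  then have "K = {m}" using empty.prems(4) by blast
  then show ?case using empty.prems(3) by simp
next
  case (insert a A)
  define N where "N = Max ((\<lambda>m. m a) ` K)"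
  have N: "m a \<le> N" if "m \<in> K" for m
    unfolding N_def using that insert.prems(1) by (intro Max_ge) auto
  have zero: "(\<Sum>m\<in>{m\<in>K. m a = k}. c m * (\<Prod>i\<in>A. x i ^ m i)) = 0" if "k \<le> N" for k x
  proof -
    let ?q = "\<lambda>k. \<Sum>m\<in>{m\<in>K. m a = k}. c m * (\<Prod>i\<in>A. x i ^ m i)"
    have "(\<Sum>k\<le>N. ?q k * t ^ k) = 0" for t
    proof -
      have upd: "(\<Prod>i\<in>A. (x(a := t)) i ^ m i) = (\<Prod>i\<in>A. x i ^ m i)" for m
        using insert.hyps by (intro prod.cong) auto
      have "(\<Sum>k\<le>N. ?q k * t ^ k) =
          (\<Sum>k\<le>N. \<Sum>m\<in>{m\<in>K. m a = k}. c m * (\<Prod>i\<in>A. x i ^ m i) * t ^ m a)"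
        by (simp add: sum_distrib_right)
      also have "\<dots> = (\<Sum>m\<in>K. c m * (\<Prod>i\<in>A. x i ^ m i) * t ^ m a)"
        using N insert.prems(1) by (intro sum.group) auto
      also have "\<dots> = (\<Sum>m\<in>K. c m * (\<Prod>i\<in>insert a A. (x(a := t)) i ^ m i))"
        using insert.hyps by (simp add: upd mult_ac del: fun_upd_apply) (simp add: mult_ac)
      also have "\<dots> = 0" by (rule insert.prems(3))
      finally show ?thesis .
    qed
    then show ?thesis using that polyfun_eq_0[of ?q N] by auto
  qed
  show ?case
  proof (rule insert.IH[of "{m'\<in>K. m' a = m a}"])
    show "m' i = m'' i" if "m' \<in> {m'\<in>K. m' a = m a}" "m'' \<in> {m'\<in>K. m' a = m a}" "i \<notin> A" for m' m'' i
      using that insert.prems(2)[of m' m'' i] by (cases "i = a") auto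
  qed (use insert.prems zero N in auto)
qed

lemma peval_eq_zero_imp:
  fixes p :: "('n::finite) mpoly"
  assumes "\<And>x. peval x p = 0"
  shows "p = 0"
proof -
  let ?L = "Poly_Mapping.lookup :: ('n \<Rightarrow>\<^sub>0 nat) \<Rightarrow> _"
  let ?c = "\<lambda>m. Poly_Mapping.lookup p (Abs_poly_mapping m)"
  have "?c m = 0" if "m \<in> ?L ` Poly_Mapping.keys p" for m
  proof (rule monomials_linearly_independent[of UNIV "?L ` Poly_Mapping.keys p" ?c])
    fix x :: "'n \<Rightarrow> real"
    have "(\<Sum>m\<in>?L ` Poly_Mapping.keys p. ?c m * (\<Prod>i\<in>UNIV. x i ^ m i)) = peval (\<chi> i. x i) p"
      unfolding peval_def by (subst sum.reindex) (auto intro!: inj_onI simp: lookup_inject)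
    then show "(\<Sum>m\<in>?L ` Poly_Mapping.keys p. ?c m * (\<Prod>i\<in>UNIV. x i ^ m i)) = 0"
      using assms by simp
  qed (use that in auto)
  then have "Poly_Mapping.lookup p m = 0" if "m \<in> Poly_Mapping.keys p" for m
    using that by (metis image_eqI lookup_inverse)
  then have "Poly_Mapping.keys p = {}"
    by (meson all_not_in_conv in_keys_iff)
  then show ?thesis by simp
qed

lemma simplex_ideal_closed:
  shows simplex_ideal_add: "p \<in> simplex_ideal \<Longrightarrow> q \<in> simplex_ideal \<Longrightarrow> p + q \<in> simplex_ideal"
    and simplex_ideal_mult: "p \<in> simplex_ideal \<Longrightarrow> r * p \<in> simplex_ideal"
    and zero_in_simplex_ideal: "0 \<in> simplex_ideal"
proof -
  let ?s = "(\<Sum>i\<in>UNIV. Var i) - 1 :: 'n mpoly"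
  show "p + q \<in> simplex_ideal" if pq: "p \<in> simplex_ideal" "q \<in> simplex_ideal"
  proof -
    obtain a b where "p = a * ?s" "q = b * ?s" using pq unfolding simplex_ideal_eq by auto
    then have "p + q = (a + b) * ?s" by (simp add: distrib_right)
    then show ?thesis unfolding simplex_ideal_eq by blast
  qed
  show "r * p \<in> simplex_ideal" if p: "p \<in> simplex_ideal"
  proof -
    obtain a where "p = a * ?s" using p unfolding simplex_ideal_eq by auto
    then have "r * p = (r * a) * ?s" by (simp add: mult.assoc)
    then show ?thesis unfolding simplex_ideal_eq by blast
  qed
  have "0 = 0 * ?s" by simp
  then show "0 \<in> simplex_ideal" unfolding simplex_ideal_eq by blast
qed

text \<open>
  Substituting \<open>1 - \<Sum>j\<noteq>a. x\<^sub>j\<close> for one variable \<open>x\<^sub>a\<close> changes a polynomial only by an element of the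
  ideal, and maps all of space into the hyperplane. The polynomial after substitution is therefore zero.
  This reduces all reasoning modulo the ideal to identities between functions on the hyperplane.
\<close>
lemma vanishing_on_hyperplane_imp_simplex_ideal:
  fixes p :: "('n::finite) mpoly"
  assumes "\<And>x. (\<Sum>i\<in>UNIV. x $ i) = 1 \<Longrightarrow> peval x p = 0"
  shows "p \<in> simplex_ideal"
proof -
  obtain a :: 'n where True by simp
  define \<rho> :: "real ^ 'n \<Rightarrow> real ^ 'n"
    where "\<rho> x = (\<chi> i. if i = a then 1 - (\<Sum>j\<in>-{a}. x $ j) else x $ i)" for x
  have split: "(\<Sum>i\<in>UNIV. f i) = f a + (\<Sum>j\<in>-{a}. f j)" for f :: "'n \<Rightarrow> 'b::comm_monoid_add"
    by (subst sum.remove[of _ a]) (auto simp: Compl_eq_Diff_UNIV)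
  have "\<exists>p'. p - p' \<in> simplex_ideal \<and> (\<forall>x. peval x p' = peval (\<rho> x) p)" for p :: "'n mpoly"
  proof (induction p rule: mpoly_induct)
    case (Const c)
    show ?case by (rule exI[of _ "Const c"]) (simp add: zero_in_simplex_ideal)
  next
    case (Var i)
    show ?case
    proof (cases "i = a")
      case True
      have "Var a - (1 - (\<Sum>j\<in>-{a}. Var j)) = 1 * ((\<Sum>i\<in>UNIV. Var i) - (1 :: 'n mpoly))"
        by (subst split) (simp add: algebra_simps)
      then have "Var a - (1 - (\<Sum>j\<in>-{a}. Var j)) \<in> (simplex_ideal :: 'n mpoly set)"
        unfolding simplex_ideal_eq by blast
      then show ?thesis
        using True by (intro exI[of _ "1 - (\<Sum>j\<in>-{a}. Var j)"]) (simp add: \<rho>_def)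
    next
      case False
      then show ?thesis
        by (intro exI[of _ "Var i"]) (simp add: zero_in_simplex_ideal \<rho>_def)
    qed
  next
    case (add p q)
    then obtain p' q' where *: "p - p' \<in> simplex_ideal" "q - q' \<in> simplex_ideal"
      "\<And>x. peval x p' = peval (\<rho> x) p" "\<And>x. peval x q' = peval (\<rho> x) q" by blast
    have "p + q - (p' + q') = (p - p') + (q - q')" by simp
    then have "p + q - (p' + q') \<in> simplex_ideal"
      using * by (simp only:) (intro simplex_ideal_add)
    then show ?case using * by (intro exI[of _ "p' + q'"]) simp
  next
    case (mult p q)
    then obtain p' q' where *: "p - p' \<in> simplex_ideal" "q - q' \<in> simplex_ideal"
      "\<And>x. peval x p' = peval (\<rho> x) p" "\<And>x. peval x q' = peval (\<rho> x) q" by blast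
    have "p * q - p' * q' = q * (p - p') + p' * (q - q')" by (simp add: algebra_simps)
    then have "p * q - p' * q' \<in> simplex_ideal"
      using * by (simp only:) (intro simplex_ideal_add simplex_ideal_mult)
    then show ?case using * by (intro exI[of _ "p' * q'"]) simp
  qed
  then obtain p' where p': "p - p' \<in> simplex_ideal" "\<And>x. peval x p' = peval (\<rho> x) p" by blast
  have "(\<Sum>i\<in>UNIV. \<rho> x $ i) = 1" for x
    by (subst split) (simp add: \<rho>_def)
  then have "p' = 0" using assms p'(2) by (intro peval_eq_zero_imp) simp
  with p'(1) show ?thesis by simp
qed

lemma peval_simplex_ideal:
  assumes "h \<in> simplex_ideal" "(\<Sum>i\<in>UNIV. x $ i) = 1"
  shows "peval x h = 0"
  using assms unfolding simplex_ideal_eq by auto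

text \<open>
  Induction from coordinates rather than from arbitrary linear functions, to match the generators of
  the polynomial ring.
\<close>
lemma real_polynomial_function_induct_coords
    [consumes 1, case_names const coord add mult]:
  fixes f :: "real ^ 'n \<Rightarrow> real"
  assumes "real_polynomial_function f"
    and const: "\<And>c. P (\<lambda>x. c)" and coord: "\<And>i. P (\<lambda>x. x $ i)"
    and add: "\<And>f g. real_polynomial_function f \<Longrightarrow> real_polynomial_function g \<Longrightarrow> P f \<Longrightarrow> P g
      \<Longrightarrow> P (\<lambda>x. f x + g x)"
    and mult: "\<And>f g. real_polynomial_function f \<Longrightarrow> real_polynomial_function g \<Longrightarrow> P f \<Longrightarrow> P g
      \<Longrightarrow> P (\<lambda>x. f x * g x)"
  shows "P f"
  using assms(1)
proof (induction rule: real_polynomial_function.induct)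
  case (linear f)
  then have lin: "linear f" by (rule bounded_linear.linear)
  have rc: "real_polynomial_function (\<lambda>x::real^'n. x $ i)" for i
    by (intro real_polynomial_function.intros(1) bounded_linear_vec_nth)
  have "P (\<lambda>x. \<Sum>i\<in>A. x $ i * f (axis i 1)) \<and> real_polynomial_function (\<lambda>x. \<Sum>i\<in>A. x $ i * f (axis i 1))" for A
    by (induction A rule: infinite_finite_induct)
      (auto intro!: const add mult coord rc real_polynomial_function.intros(2-4))
  moreover have "f x = (\<Sum>i\<in>UNIV. x $ i * f (axis i 1))" for x
  proof -
    have "f x = f (\<Sum>i\<in>UNIV. x $ i *s axis i 1)" by (simp add: basis_expansion)
    also have "\<dots> = (\<Sum>i\<in>UNIV. x $ i * f (axis i 1))"
      by (simp add: linear_sum[OF lin] linear_scale[OF lin] scalar_mult_eq_scaleR)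
    finally show ?thesis .
  qed
  then have "f = (\<lambda>x. \<Sum>i\<in>UNIV. x $ i * f (axis i 1))" by blast
  ultimately show ?case by metis
qed (use assms in auto)

lemma real_polynomial_function_coord [intro]: "real_polynomial_function (\<lambda>x::real^'n. x $ i)"
  by (intro real_polynomial_function.intros(1) bounded_linear_vec_nth)

lemma real_polynomial_function_imp_peval:
  fixes f :: "real ^ 'n \<Rightarrow> real"
  assumes "real_polynomial_function f"
  shows "\<exists>p. \<forall>x. f x = peval x p"
  using assms
proof (induction rule: real_polynomial_function_induct_coords)
  case (const c)
  show ?case by (rule exI[of _ "Const c"]) simp
next
  case (coord i)
  show ?case by (rule exI[of _ "Var i"]) simp
next
  case (add f g)
  then obtain p q where "\<forall>x. f x = peval x p" "\<forall>x. g x = peval x q" by blast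
  then show ?case by (intro exI[of _ "p + q"]) simp
next
  case (mult f g)
  then obtain p q where "\<forall>x. f x = peval x p" "\<forall>x. g x = peval x q" by blast
  then show ?case by (intro exI[of _ "p * q"]) simp
qed

section \<open>The quadratic module of the simplex\<close>

abbreviation rpf :: "(real ^ 'n \<Rightarrow> real) \<Rightarrow> bool" where
  "rpf \<equiv> real_polynomial_function"

lemmas rpf_intros = real_polynomial_function.intros(2-4) real_polynomial_function_minus
  real_polynomial_function_diff real_polynomial_function_divide real_polynomial_function_sum
  real_polynomial_function_prod real_polynomial_function_power real_polynomial_function_coord

text \<open>
  The functions \<open>\<sigma>\<^sub>0 + \<Sum>i. x\<^sub>i \<sigma>\<^sub>i\<close> with sums of squares \<open>\<sigma>\<^sub>0, \<sigma>\<^sub>i\<close>, without degree bounds. The last rule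
  identifies functions that agree on the hyperplane; the values elsewhere are arbitrary,
  so a member need not be polynomial there.
\<close>
inductive_set quad_module :: "(real ^ 'n::finite \<Rightarrow> real) set" where
  square: "rpf g \<Longrightarrow> (\<lambda>x. (g x)\<^sup>2) \<in> quad_module"
| coord_square: "rpf g \<Longrightarrow> (\<lambda>x. x $ i * (g x)\<^sup>2) \<in> quad_module"
| add: "f \<in> quad_module \<Longrightarrow> g \<in> quad_module \<Longrightarrow> (\<lambda>x. f x + g x) \<in> quad_module"
| cong: "f \<in> quad_module \<Longrightarrow> (\<And>x. (\<Sum>i\<in>UNIV. x $ i) = 1 \<Longrightarrow> g x = f x) \<Longrightarrow> g \<in> quad_module"

definition std_simplex :: "(real ^ 'n::finite) set" where
  "std_simplex = {x. (\<forall>i. 0 \<le> x $ i) \<and> (\<Sum>i\<in>UNIV. x $ i) = 1}"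

definition sqdist :: "real ^ 'n::finite \<Rightarrow> real ^ 'n \<Rightarrow> real" where
  "sqdist z x = (\<Sum>i\<in>UNIV. (x $ i - z $ i)\<^sup>2)"

lemma rpf_sqdist [intro]: "rpf (sqdist z)"
  unfolding sqdist_def[abs_def] by (intro rpf_intros) auto

lemma quad_module_mult_square:
  assumes "f \<in> quad_module" "rpf h"
  shows "(\<lambda>x. (h x)\<^sup>2 * f x) \<in> quad_module"
  using assms(1)
proof induction
  case (square g)
  then have "rpf (\<lambda>x. h x * g x)" using assms(2) by (intro rpf_intros)
  from quad_module.square[OF this] show ?case by (simp add: power_mult_distrib)
next
  case (coord_square g i)
  then have "rpf (\<lambda>x. h x * g x)" using assms(2) by (intro rpf_intros)
  from quad_module.coord_square[OF this, of i] show ?case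
    by (simp add: power_mult_distrib mult_ac)
next
  case (add f g)
  from quad_module.add[OF add.IH] show ?case by (simp add: distrib_left)
next
  case (cong f g)
  show ?case by (rule quad_module.cong[OF cong.IH]) (use cong in auto)
qed

lemma quad_module_const: "0 \<le> c \<Longrightarrow> (\<lambda>x. c) \<in> quad_module"
  using quad_module.square[of "\<lambda>x. sqrt c"] by (simp add: real_polynomial_function.intros)

lemma quad_module_scale: "0 \<le> c \<Longrightarrow> f \<in> quad_module \<Longrightarrow> (\<lambda>x. c * f x) \<in> quad_module"
  using quad_module_mult_square[of f "\<lambda>x. sqrt c"] by (simp add: real_polynomial_function.intros)

lemma quad_module_sum:
  "(\<And>a. a \<in> A \<Longrightarrow> f a \<in> quad_module) \<Longrightarrow> (\<lambda>x. \<Sum>a\<in>A. f a x) \<in> quad_module"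
  by (induction A rule: infinite_finite_induct)
    (auto intro: quad_module.add quad_module_const[of 0, simplified])

lemma quad_module_coord: "(\<lambda>x. x $ i) \<in> quad_module"
  using quad_module.coord_square[of "\<lambda>x. 1" i] by (simp add: real_polynomial_function.intros)

lemma quad_module_one_minus_coord:
  fixes i :: "'n::finite"
  shows "(\<lambda>x. 1 - x $ i) \<in> quad_module"
proof (rule quad_module.cong[OF quad_module_sum[of "-{i}" "\<lambda>j x. x $ j"]])
  fix x :: "real ^ 'n"
  assume "(\<Sum>i\<in>UNIV. x $ i) = 1"
  moreover have "(\<Sum>j\<in>UNIV. x $ j) = x $ i + (\<Sum>j\<in>-{i}. x $ j)"
    by (subst sum.remove[of _ i]) (auto simp: Compl_eq_Diff_UNIV)
  ultimately show "1 - x $ i = (\<Sum>j\<in>-{i}. x $ j)" by simp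
qed (rule quad_module_coord)

lemma quad_module_nonneg:
  assumes "f \<in> quad_module" "x \<in> std_simplex"
  shows "0 \<le> f x"
  using assms by (induction rule: quad_module.induct) (auto simp: std_simplex_def)

text \<open>
  The quadratic module is Archimedean because \<open>1 - x\<^sub>i\<close> is the sum of the other coordinates on the
  hyperplane. Products are reduced to squares by polarization, and a square is bounded by way of
  \<open>D\<^sup>2 - p\<^sup>2 = ((D - p)\<^sup>2 (D + p) + (D + p)\<^sup>2 (D - p)) / (2 D)\<close>.
\<close>
lemma quad_module_archimedean:
  assumes "rpf p"
  shows "\<exists>C\<ge>0. (\<lambda>x. C - p x) \<in> quad_module \<and> (\<lambda>x. C + p x) \<in> quad_module"
  using assms
proof (induction rule: real_polynomial_function_induct_coords)
  case (const c)
  show ?case by (rule exI[of _ "\<bar>c\<bar>"]) (auto intro: quad_module_const)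
next
  case (coord i)
  show ?case
    using quad_module_one_minus_coord quad_module.add[OF quad_module_const[of 1] quad_module_coord]
    by (intro exI[of _ 1]) auto
next
  case (add f g)
  then obtain C D where *: "0 \<le> C" "(\<lambda>x. C - f x) \<in> quad_module" "(\<lambda>x. C + f x) \<in> quad_module"
    "0 \<le> D" "(\<lambda>x. D - g x) \<in> quad_module" "(\<lambda>x. D + g x) \<in> quad_module" by blast
  show ?case
    using quad_module.add[OF *(2,5)] quad_module.add[OF *(3,6)] *(1,4)
    by (intro exI[of _ "C + D"]) (auto simp: algebra_simps)
next
  case (mult f g)
  have sq: "\<exists>C>0. (\<lambda>x. C\<^sup>2 - (p x)\<^sup>2) \<in> quad_module"
    if p: "rpf p" and C: "0 \<le> C" "(\<lambda>x. C - p x) \<in> quad_module" "(\<lambda>x. C + p x) \<in> quad_module" for p C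
  proof -
    \<comment> \<open>The identity divides by the bound, which must therefore be positive.\<close>
    define D where "D = C + 1"
    have "(\<lambda>x. C - p x + 1) \<in> quad_module" "(\<lambda>x. C + p x + 1) \<in> quad_module"
      using C by (auto intro!: quad_module.add quad_module_const)
    then have D: "D > 0" "(\<lambda>x. D - p x) \<in> quad_module" "(\<lambda>x. D + p x) \<in> quad_module"
      using C(1) by (simp_all add: D_def algebra_simps)
    have "(\<lambda>x. (D - p x)\<^sup>2 * (D + p x)) \<in> quad_module" "(\<lambda>x. (D + p x)\<^sup>2 * (D - p x)) \<in> quad_module"
      by (intro quad_module_mult_square D rpf_intros p)+
    from quad_module_scale[OF _ quad_module.add[OF this], of "1 / (2 * D)"]
    have "(\<lambda>x. 1 / (2 * D) * ((D - p x)\<^sup>2 * (D + p x) + (D + p x)\<^sup>2 * (D - p x))) \<in> quad_module"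
      using D(1) by simp
    moreover have "1 / (2 * D) * ((D - p x)\<^sup>2 * (D + p x) + (D + p x)\<^sup>2 * (D - p x)) = D\<^sup>2 - (p x)\<^sup>2" for x
      using D(1) by (simp add: field_simps power2_eq_square)
    ultimately show ?thesis using D(1) by auto
  qed
  obtain C1 where "(\<lambda>x. C1\<^sup>2 - (f x)\<^sup>2) \<in> quad_module"
    using mult.IH(1) sq[OF mult.hyps(1)] by blast
  moreover obtain D1 where "(\<lambda>x. D1\<^sup>2 - (g x)\<^sup>2) \<in> quad_module"
    using mult.IH(2) sq[OF mult.hyps(2)] by blast
  moreover have "(\<lambda>x. (f x + g x)\<^sup>2) \<in> quad_module" "(\<lambda>x. (f x - g x)\<^sup>2) \<in> quad_module"
    using mult by (auto intro!: quad_module.square rpf_intros)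
  ultimately have "(\<lambda>x. 1/2 * ((C1\<^sup>2 - (f x)\<^sup>2) + (D1\<^sup>2 - (g x)\<^sup>2) + (f x - g x)\<^sup>2)) \<in> quad_module"
    "(\<lambda>x. 1/2 * ((C1\<^sup>2 - (f x)\<^sup>2) + (D1\<^sup>2 - (g x)\<^sup>2) + (f x + g x)\<^sup>2)) \<in> quad_module"
    by (intro quad_module_scale quad_module.add; simp)+
  note half = this
  have "(\<lambda>x. (C1\<^sup>2 + D1\<^sup>2) / 2 - f x * g x) \<in> quad_module"
    by (rule quad_module.cong[OF half(1)]) (simp add: field_simps power2_eq_square)
  moreover have "(\<lambda>x. (C1\<^sup>2 + D1\<^sup>2) / 2 + f x * g x) \<in> quad_module"
    by (rule quad_module.cong[OF half(2)]) (simp add: field_simps power2_eq_square)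
  ultimately show ?case
    by (intro exI[of _ "(C1\<^sup>2 + D1\<^sup>2) / 2"]) auto
qed

lemma quad_module_archimedean_square:
  assumes "rpf p"
  shows "\<exists>C\<ge>0. (\<lambda>x. C - (p x)\<^sup>2) \<in> quad_module"
  using quad_module_archimedean[of "\<lambda>x. (p x)\<^sup>2"] assms by (auto intro: rpf_intros)

text \<open>
  The closure of the quadratic module with respect to adding small constants. It contains products such
  as \<open>x\<^sub>i x\<^sub>j\<close>, which need not belong to the quadratic module itself.
\<close>
definition almost_quad_module :: "(real ^ 'n::finite \<Rightarrow> real) set" where
  "almost_quad_module = {f. \<forall>\<epsilon>>0. (\<lambda>x. f x + \<epsilon>) \<in> quad_module}"

lemma almost_quad_module_add:
  assumes "f \<in> almost_quad_module" "g \<in> almost_quad_module"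
  shows "(\<lambda>x. f x + g x) \<in> almost_quad_module"
  unfolding almost_quad_module_def mem_Collect_eq
proof (intro allI impI)
  fix \<epsilon> :: real assume "\<epsilon> > 0"
  then have "(\<lambda>x. (f x + \<epsilon> / 2) + (g x + \<epsilon> / 2)) \<in> quad_module"
    using assms by (intro quad_module.add[of "\<lambda>x. f x + \<epsilon> / 2"]) (auto simp: almost_quad_module_def)
  then show "(\<lambda>x. f x + g x + \<epsilon>) \<in> quad_module" by (simp add: algebra_simps)
qed

lemma quad_module_imp_almost: "f \<in> quad_module \<Longrightarrow> f \<in> almost_quad_module"
  unfolding almost_quad_module_def by (auto intro!: quad_module.add quad_module_const)

lemma almost_quad_module_sum:
  "(\<And>a. a \<in> A \<Longrightarrow> f a \<in> almost_quad_module) \<Longrightarrow> (\<lambda>x. \<Sum>a\<in>A. f a x) \<in> almost_quad_module"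
  by (induction A rule: infinite_finite_induct)
    (auto intro: almost_quad_module_add quad_module_imp_almost quad_module_const[of 0, simplified])

lemma almost_quad_module_cong:
  assumes "f \<in> almost_quad_module" "\<And>x. (\<Sum>i\<in>UNIV. x $ i) = 1 \<Longrightarrow> g x = f x"
  shows "g \<in> almost_quad_module"
  using assms unfolding almost_quad_module_def
  by (auto intro: quad_module.cong[of "\<lambda>x. f x + _"])

lemma almost_quad_module_closed:
  assumes "\<And>\<epsilon>. \<epsilon> > 0 \<Longrightarrow> (\<lambda>x. f x + \<epsilon>) \<in> almost_quad_module"
  shows "f \<in> almost_quad_module"
  unfolding almost_quad_module_def mem_Collect_eq
proof (intro allI impI)
  fix \<epsilon> :: real assume "\<epsilon> > 0"
  then have "\<forall>\<delta>>0. (\<lambda>x. f x + \<epsilon> / 2 + \<delta>) \<in> quad_module"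
    using assms[of "\<epsilon> / 2"] by (simp add: almost_quad_module_def)
  then have "(\<lambda>x. f x + \<epsilon> / 2 + \<epsilon> / 2) \<in> quad_module"
    using half_gt_zero[OF \<open>\<epsilon> > 0\<close>] by blast
  then show "(\<lambda>x. f x + \<epsilon>) \<in> quad_module"
    by (rule quad_module.cong) simp
qed

text \<open>
  Iterating \<open>b \<mapsto> b - b\<^sup>2\<close> writes \<open>b\<close> as a sum of squares plus a remainder that tends to 0
  for \<open>0 \<le> b \<le> 1\<close>; a substitute for a polynomial square root of \<open>b\<close>.
\<close>
primrec logistic :: "nat \<Rightarrow> real \<Rightarrow> real" where
  "logistic 0 b = b"
| "logistic (Suc k) b = logistic k b - (logistic k b)\<^sup>2"

lemma logistic_telescope: "b = (\<Sum>j<k. (logistic j b)\<^sup>2) + logistic k b"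
  by (induction k) auto

text \<open>
  Expanding \<open>x\<^sub>i\<close> as a sum of squares \<open>b\<^sub>j\<^sup>2\<close> plus a remainder \<open>b\<^sub>k\<close> turns \<open>x\<^sub>i m\<close> into a member plus
  \<open>b\<^sub>k m\<close>. Averaging over \<open>k < K\<close> replaces the remainder by a mean \<open>c\<close> whose square is at most \<open>1/K\<close>
  modulo the quadratic module, since \<open>\<Sum>k. b\<^sub>k\<^sup>2 \<le> x\<^sub>i \<le> 1\<close> there. Finally
  \<open>c m \<ge> - \<delta> m\<^sup>2 / 2 - c\<^sup>2 / (2 \<delta>)\<close>, and both squares are bounded.
\<close>
lemma quad_module_coord_mult:
  fixes m :: "real ^ 'n::finite \<Rightarrow> real"
  assumes m: "m \<in> quad_module" "rpf m"
  shows "(\<lambda>x. x $ i * m x) \<in> almost_quad_module"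
  unfolding almost_quad_module_def mem_Collect_eq
proof (intro allI impI)
  fix \<epsilon> :: real assume \<epsilon>: "\<epsilon> > 0"
  let ?b = "\<lambda>k (x :: real ^ 'n). logistic k (x $ i)"
  have rpf_b: "rpf (?b k)" for k
    by (induction k) (auto intro!: rpf_intros)
  have one_minus_b: "(\<lambda>x. 1 - ?b k x) \<in> quad_module" for k
  proof -
    have "(\<lambda>x. (1 - x $ i) + (\<Sum>j<k. (?b j x)\<^sup>2)) \<in> quad_module"
      by (intro quad_module.add quad_module_one_minus_coord quad_module_sum quad_module.square rpf_b)
    moreover have "(1 - x $ i) + (\<Sum>j<k. (?b j x)\<^sup>2) = 1 - ?b k x" for x
      using logistic_telescope[of "x $ i" k] by simp
    ultimately show ?thesis by simp
  qed
  have b: "?b k \<in> quad_module" for k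
  proof (induction k)
    case 0
    then show ?case by (simp add: quad_module_coord)
  next
    case (Suc k)
    have "(\<lambda>x. (1 - ?b k x)\<^sup>2 * ?b k x + (?b k x)\<^sup>2 * (1 - ?b k x)) \<in> quad_module"
      by (intro quad_module.add quad_module_mult_square one_minus_b Suc rpf_intros rpf_b)
    moreover have "(1 - ?b k x)\<^sup>2 * ?b k x + (?b k x)\<^sup>2 * (1 - ?b k x) = ?b (Suc k) x" for x
      by (simp add: power2_eq_square algebra_simps)
    ultimately show ?case by simp
  qed
  obtain C where C: "C \<ge> 0" "(\<lambda>x. C - (m x)\<^sup>2) \<in> quad_module"
    using quad_module_archimedean_square[OF m(2)] by blast
  define \<delta> where "\<delta> = \<epsilon> / (C + 1)"
  have \<delta>: "\<delta> > 0" using \<epsilon> C(1) by (simp add: \<delta>_def)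
  obtain K :: nat where K2: "1 / (\<delta> * \<epsilon>) < real K"
    using reals_Archimedean2 by blast
  moreover have "0 < 1 / (\<delta> * \<epsilon>)" using \<delta> \<epsilon> by simp
  ultimately have K: "K > 0" "1 / (\<delta> * \<epsilon>) \<le> real K" by (auto intro: gr0I)
  define c where "c x = (\<Sum>k<K. ?b k x) / real K" for x :: "real ^ 'n"
  have rpf_c: "rpf c"
    unfolding c_def[abs_def] by (intro rpf_intros rpf_b) auto
  define S where "S x = (\<Sum>k<K. \<Sum>j<k. (?b j x)\<^sup>2 * m x)" for x
  have S: "(\<lambda>x. 1 / real K * S x) \<in> quad_module"
    unfolding S_def by (intro quad_module_scale quad_module_sum quad_module_mult_square m(1) rpf_b) auto
  have split: "x $ i * m x = 1 / real K * S x + c x * m x" for x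
  proof -
    have "x $ i * m x = (\<Sum>j<k. (?b j x)\<^sup>2 * m x) + ?b k x * m x" for k
      using arg_cong[OF logistic_telescope[of "x $ i" k], of "\<lambda>t. t * m x"]
      by (simp add: distrib_right sum_distrib_right)
    then have "(\<Sum>k<K. x $ i * m x) = (\<Sum>k<K. (\<Sum>j<k. (?b j x)\<^sup>2 * m x) + ?b k x * m x)"
      by (rule sum.cong[OF refl])
    then have "real K * (x $ i * m x) = (\<Sum>k<K. (\<Sum>j<k. (?b j x)\<^sup>2 * m x) + ?b k x * m x)"
      by simp
    also have "\<dots> = S x + (\<Sum>k<K. ?b k x) * m x"
      by (simp add: S_def sum.distrib sum_distrib_right)
    finally show ?thesis using K(1) by (simp add: c_def field_simps)
  qed
  have csq: "(\<lambda>x. 1 / real K - (c x)\<^sup>2) \<in> quad_module"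
  proof -
    have "(\<lambda>x. 1 / real K * ((1 - x $ i) + ?b K x) + 1 / real K * (\<Sum>k<K. (?b k x - c x)\<^sup>2)) \<in> quad_module"
      by (intro quad_module.add quad_module_scale quad_module_one_minus_coord b quad_module_sum
          quad_module.square rpf_intros rpf_b rpf_c) auto
    moreover have "1 / real K * ((1 - x $ i) + ?b K x) + 1 / real K * (\<Sum>k<K. (?b k x - c x)\<^sup>2)
        = 1 / real K - (c x)\<^sup>2" for x
    proof -
      have "(\<Sum>k<K. (?b k x - c x)\<^sup>2) = (\<Sum>k<K. (?b k x)\<^sup>2) - 2 * c x * (\<Sum>k<K. ?b k x) + real K * (c x)\<^sup>2"
        by (simp add: power2_diff sum.distrib sum_subtractf sum_distrib_left mult_ac)
      also have "(\<Sum>k<K. ?b k x) = real K * c x" using K(1) by (simp add: c_def)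
      also have "(\<Sum>k<K. (?b k x)\<^sup>2) = x $ i - ?b K x"
        using logistic_telescope[of "x $ i" K] by simp
      finally have dev: "(\<Sum>k<K. (?b k x - c x)\<^sup>2) = x $ i - ?b K x - real K * (c x)\<^sup>2"
        by (simp add: power2_eq_square)
      show ?thesis unfolding dev
        using K(1) by (simp add: diff_divide_distrib add_divide_distrib)
    qed
    ultimately show ?thesis by simp
  qed
  have "(\<lambda>x. 1 / real K * S x + \<delta> / 2 * (C - (m x)\<^sup>2) + 1 / (2 * \<delta>) * (1 / real K - (c x)\<^sup>2)
      + 1 / (2 * \<delta>) * (c x + \<delta> * m x)\<^sup>2 + (\<epsilon> - \<delta> / 2 * C - 1 / (2 * \<delta> * real K))) \<in> quad_module"
  proof (intro quad_module.add quad_module_scale[of "\<delta>/2"] quad_module_scale[of "1/(2*\<delta>)"] S C csq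
      quad_module.square quad_module_const rpf_intros rpf_c m)
    have "\<delta> * C \<le> \<epsilon>" using C(1) \<epsilon> by (simp add: \<delta>_def field_simps)
    moreover have "1 / (\<delta> * real K) \<le> \<epsilon>"
      using K \<delta> \<epsilon> by (simp add: field_simps)
    ultimately show "0 \<le> \<epsilon> - \<delta> / 2 * C - 1 / (2 * \<delta> * real K)" by (simp add: field_simps)
  qed (use \<delta> in auto)
  moreover have "1 / real K * S x + \<delta> / 2 * (C - (m x)\<^sup>2) + 1 / (2 * \<delta>) * (1 / real K - (c x)\<^sup>2)
      + 1 / (2 * \<delta>) * (c x + \<delta> * m x)\<^sup>2 + (\<epsilon> - \<delta> / 2 * C - 1 / (2 * \<delta> * real K))
      = x $ i * m x + \<epsilon>" for x
    unfolding split using \<delta> K(1) by (simp add: field_simps power2_eq_square)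
  ultimately show "(\<lambda>x. x $ i * m x + \<epsilon>) \<in> quad_module" by (simp only:)
qed

lemma almost_quad_module_coord_mult:
  fixes f :: "real ^ 'n::finite \<Rightarrow> real"
  assumes "f \<in> almost_quad_module" "rpf f"
  shows "(\<lambda>x. x $ i * f x) \<in> almost_quad_module"
proof (rule almost_quad_module_closed)
  fix \<epsilon> :: real assume \<epsilon>: "\<epsilon> > 0"
  have "(\<lambda>x. x $ i * (f x + \<epsilon>)) \<in> almost_quad_module"
    using assms \<epsilon> by (intro quad_module_coord_mult) (auto simp: almost_quad_module_def intro!: rpf_intros)
  moreover have "(\<lambda>x. \<epsilon> * (1 - x $ i)) \<in> almost_quad_module"
    using \<epsilon> by (intro quad_module_imp_almost quad_module_scale quad_module_one_minus_coord) auto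
  ultimately have "(\<lambda>x. x $ i * (f x + \<epsilon>) + \<epsilon> * (1 - x $ i)) \<in> almost_quad_module"
    by (rule almost_quad_module_add)
  then show "(\<lambda>x. x $ i * f x + \<epsilon>) \<in> almost_quad_module" by (simp add: algebra_simps)
qed

text \<open>
  The expectation of \<open>g (v + e\<^sub>1 + \<dots> + e\<^sub>N)\<close> for independent random unit vectors \<open>e\<^sub>k\<close> that equal the
  \<open>i\<close>-th one with probability \<open>x\<^sub>i\<close>. For \<open>v = 0\<close> it is the Bernstein operator on the simplex, with the
  grid scaled up by \<open>N\<close>.
\<close>
primrec bernstein_mean :: "nat \<Rightarrow> (real ^ 'n::finite \<Rightarrow> real) \<Rightarrow> real ^ 'n \<Rightarrow> real ^ 'n \<Rightarrow> real" where
  "bernstein_mean 0 g x v = g v"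
| "bernstein_mean (Suc N) g x v = (\<Sum>i\<in>UNIV. x $ i * bernstein_mean N g x (v + axis i 1))"

lemma bernstein_mean_affine:
  assumes "(\<Sum>i\<in>UNIV. x $ i) = 1"
  shows "bernstein_mean N (\<lambda>w. a + b * g w) x v = a + b * bernstein_mean N g x v"
proof (induction N arbitrary: v)
  case (Suc N)
  have "bernstein_mean (Suc N) (\<lambda>w. a + b * g w) x v =
      (\<Sum>i\<in>UNIV. a * x $ i + b * (x $ i * bernstein_mean N g x (v + axis i 1)))"
    by (simp add: Suc algebra_simps)
  also have "\<dots> = a + b * bernstein_mean (Suc N) g x v"
    using assms by (simp add: sum.distrib sum_distrib_left[symmetric])
  finally show ?case .
qed simp

text \<open>
  Variances of independent summands add up: each \<open>e\<^sub>k\<close> has mean \<open>x\<close> and variance \<open>1 - \<bar>x\<bar>\<^sup>2\<close>.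
\<close>
lemma bernstein_mean_sqdist:
  assumes x: "(\<Sum>i\<in>UNIV. x $ i) = 1"
  shows "bernstein_mean N (sqdist u) x v =
    sqdist u (v + real N *s x) + real N * (1 - (\<Sum>i\<in>UNIV. (x $ i)\<^sup>2))"
proof (induction N arbitrary: v)
  case (Suc N)
  let ?s = "\<Sum>i\<in>UNIV. (x $ i)\<^sup>2"
  define a where "a = v + real N *s x - u"
  have step: "sqdist u (v + axis i 1 + real N *s x) = (\<Sum>j\<in>UNIV. (a $ j)\<^sup>2) + 2 * a $ i + 1" for i
  proof -
    have "sqdist u (v + axis i 1 + real N *s x) = (\<Sum>j\<in>UNIV. (a $ j + (if j = i then 1 else 0))\<^sup>2)"
      unfolding sqdist_def a_def by (intro sum.cong) (auto simp: axis_def algebra_simps)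
    also have "\<dots> = (\<Sum>j\<in>UNIV. (a $ j)\<^sup>2 + (if j = i then 2 * a $ j + 1 else 0))"
      by (intro sum.cong) (auto simp: power2_eq_square algebra_simps)
    finally show ?thesis by (simp add: sum.distrib)
  qed
  have "bernstein_mean (Suc N) (sqdist u) x v =
      (\<Sum>i\<in>UNIV. x $ i * ((\<Sum>j\<in>UNIV. (a $ j)\<^sup>2) + 2 * a $ i + 1 + real N * (1 - ?s)))"
    by (simp add: Suc step)
  also have "\<dots> = (\<Sum>i\<in>UNIV. x $ i * ((\<Sum>j\<in>UNIV. (a $ j)\<^sup>2) + 1 + real N * (1 - ?s)) + 2 * (a $ i * x $ i))"
    by (intro sum.cong) (auto simp: algebra_simps)
  also have "\<dots> = (\<Sum>j\<in>UNIV. (a $ j)\<^sup>2) + 1 + real N * (1 - ?s) + 2 * (\<Sum>i\<in>UNIV. a $ i * x $ i)"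
    using x by (simp add: sum.distrib sum_distrib_left[symmetric] sum_distrib_right[symmetric])
  also have "\<dots> = (\<Sum>j\<in>UNIV. (a $ j)\<^sup>2 + 2 * (a $ j * x $ j) + (x $ j)\<^sup>2) + real (Suc N) * (1 - ?s)"
    unfolding sum.distrib sum_distrib_left[symmetric] by (simp add: algebra_simps)
  also have "(\<Sum>j\<in>UNIV. (a $ j)\<^sup>2 + 2 * (a $ j * x $ j) + (x $ j)\<^sup>2) = sqdist u (v + real (Suc N) *s x)"
    unfolding sqdist_def a_def by (intro sum.cong) (auto simp: power2_eq_square algebra_simps)
  finally show ?case .
qed simp

lemma rpf_bernstein_mean:
  assumes "\<And>w. rpf (\<lambda>x. g x w)"
  shows "rpf (\<lambda>x. bernstein_mean N (g x) x v)"
  using assms by (induction N arbitrary: v) (auto intro!: rpf_intros)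

text \<open>
  The weights of the mean are monomials, so membership is inherited from the values of \<open>g\<close> at the grid
  points that can be reached from \<open>v\<close> in \<open>N\<close> steps.
\<close>
lemma bernstein_mean_almost_quad_module:
  assumes "\<And>w. rpf (\<lambda>x. g x w)"
    and "\<And>w. (\<And>i. v $ i \<le> w $ i) \<Longrightarrow> (\<Sum>i\<in>UNIV. w $ i) = (\<Sum>i\<in>UNIV. v $ i) + real N \<Longrightarrow>
      (\<lambda>x. g x w) \<in> almost_quad_module"
  shows "(\<lambda>x. bernstein_mean N (g x) x v) \<in> almost_quad_module"
  using assms(2)
proof (induction N arbitrary: v)
  case (Suc N)
  have ax: "(\<Sum>j\<in>UNIV. (v + axis i 1) $ j) = (\<Sum>j\<in>UNIV. v $ j) + 1" for i
    by (simp add: sum.distrib axis_def)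
  have "(\<lambda>x. bernstein_mean N (g x) x (v + axis i 1)) \<in> almost_quad_module" for i
  proof (rule Suc.IH)
    fix w :: "real ^ 'a"
    assume w: "\<And>j. (v + axis i 1) $ j \<le> w $ j"
      "(\<Sum>j\<in>UNIV. w $ j) = (\<Sum>j\<in>UNIV. (v + axis i 1) $ j) + real N"
    show "(\<lambda>x. g x w) \<in> almost_quad_module"
    proof (rule Suc.prems)
      show "v $ j \<le> w $ j" for j
        using w(1)[of j] by (simp add: axis_def split: if_splits)
      show "(\<Sum>j\<in>UNIV. w $ j) = (\<Sum>j\<in>UNIV. v $ j) + real (Suc N)"
        using w(2) unfolding ax by simp
    qed
  qed
  then show ?case
    by (auto intro!: almost_quad_module_sum almost_quad_module_coord_mult rpf_bernstein_mean assms(1))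
qed simp

lemma compact_std_simplex: "compact (std_simplex :: (real ^ 'n::finite) set)"
proof (rule compact_eq_bounded_closed[THEN iffD2], intro conjI)
  have "norm x \<le> 1" if "x \<in> std_simplex" for x :: "real ^ 'n"
    using norm_le_l1_cart[of x] that by (simp add: std_simplex_def)
  then show "bounded (std_simplex :: (real ^ 'n) set)" by (auto simp: bounded_iff)
  have "std_simplex = (\<Inter>i. {x :: real ^ 'n. 0 \<le> x $ i}) \<inter> {x. (\<Sum>i\<in>UNIV. x $ i) = 1}"
    by (auto simp: std_simplex_def)
  moreover have "closed \<dots>"
    by (intro closed_Int closed_INT ballI closed_Collect_le closed_Collect_eq continuous_intros)
  ultimately show "closed (std_simplex :: (real ^ 'n) set)" by simp
qed

lemma rpf_bounded_on_simplex:
  assumes "rpf (p :: real ^ 'n::finite \<Rightarrow> real)"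
  shows "\<exists>C\<ge>0. \<forall>x\<in>std_simplex. \<bar>p x\<bar> \<le> C"
proof -
  obtain C where C: "C \<ge> 0" "(\<lambda>x. C - p x) \<in> quad_module" "(\<lambda>x. C + p x) \<in> quad_module"
    using quad_module_archimedean[OF assms] by blast
  have "\<bar>p x\<bar> \<le> C" if "x \<in> std_simplex" for x
    using quad_module_nonneg[OF C(2) that] quad_module_nonneg[OF C(3) that] by simp
  with C(1) show ?thesis by blast
qed

text \<open>
  A Lipschitz estimate that is witnessed by the quadratic module. The constant is uniform in the centre
  \<open>z\<close>, which the Bernstein argument needs since its grid changes with \<open>N\<close>.
\<close>
lemma quad_module_lipschitz:
  fixes p :: "real ^ 'n::finite \<Rightarrow> real"
  assumes "rpf p"
  shows "\<exists>C\<ge>0. \<forall>z\<in>std_simplex. (\<lambda>x. C * sqdist z x - (p x - p z)\<^sup>2) \<in> quad_module"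
  using assms
proof (induction rule: real_polynomial_function_induct_coords)
  case (const c)
  show ?case by (rule exI[of _ 0]) (auto intro: quad_module_const)
next
  case (coord i)
  have "(\<lambda>x. \<Sum>j\<in>-{i}. (x $ j - z $ j)\<^sup>2) \<in> quad_module" for z :: "real ^ 'n"
    by (intro quad_module_sum quad_module.square rpf_intros)
  moreover have "sqdist z x = (x $ i - z $ i)\<^sup>2 + (\<Sum>j\<in>-{i}. (x $ j - z $ j)\<^sup>2)" for x z
    unfolding sqdist_def by (subst sum.remove[of _ i]) (auto simp: Compl_eq_Diff_UNIV)
  ultimately show ?case by (intro exI[of _ 1]) auto
next
  case (add f g)
  then obtain C D where *: "0 \<le> C" "0 \<le> D"
    "\<And>z. z \<in> std_simplex \<Longrightarrow> (\<lambda>x. C * sqdist z x - (f x - f z)\<^sup>2) \<in> quad_module"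
    "\<And>z. z \<in> std_simplex \<Longrightarrow> (\<lambda>x. D * sqdist z x - (g x - g z)\<^sup>2) \<in> quad_module" by blast
  have "(\<lambda>x. (2 * C + 2 * D) * sqdist z x - (f x + g x - (f z + g z))\<^sup>2) \<in> quad_module"
    if "z \<in> std_simplex" for z
  proof -
    have "(\<lambda>x. 2 * (C * sqdist z x - (f x - f z)\<^sup>2) + 2 * (D * sqdist z x - (g x - g z)\<^sup>2)
        + ((f x - f z) - (g x - g z))\<^sup>2) \<in> quad_module"
      using add.hyps that
      by (intro quad_module.add quad_module_scale * quad_module.square rpf_intros) auto
    then show ?thesis
      by (rule quad_module.cong) (simp add: power2_eq_square algebra_simps)
  qed
  then show ?case using *(1,2) by (intro exI[of _ "2 * C + 2 * D"]) auto
next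
  case (mult f g)
  then obtain C D where *: "0 \<le> C" "0 \<le> D"
    "\<And>z. z \<in> std_simplex \<Longrightarrow> (\<lambda>x. C * sqdist z x - (f x - f z)\<^sup>2) \<in> quad_module"
    "\<And>z. z \<in> std_simplex \<Longrightarrow> (\<lambda>x. D * sqdist z x - (g x - g z)\<^sup>2) \<in> quad_module" by blast
  obtain G where G: "G \<ge> 0" "(\<lambda>x. G - (g x)\<^sup>2) \<in> quad_module"
    using quad_module_archimedean_square[OF mult.hyps(2)] by blast
  obtain A where A: "A \<ge> 0" "\<And>z. z \<in> std_simplex \<Longrightarrow> \<bar>f z\<bar> \<le> A"
    using rpf_bounded_on_simplex[OF mult.hyps(1)] by blast
  have "(\<lambda>x. (2 * G * C + 2 * A\<^sup>2 * D) * sqdist z x - (f x * g x - f z * g z)\<^sup>2) \<in> quad_module"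
    if z: "z \<in> std_simplex" for z
  proof -
    have fz: "(f z)\<^sup>2 \<le> A\<^sup>2" using A(2)[OF z] A(1) by (metis abs_le_square_iff abs_of_nonneg)
    have "(\<lambda>x. 2 * G * (C * sqdist z x - (f x - f z)\<^sup>2) + 2 * ((f x - f z)\<^sup>2 * (G - (g x)\<^sup>2))
        + 2 * (f z)\<^sup>2 * (D * sqdist z x - (g x - g z)\<^sup>2)
        + 2 * (A\<^sup>2 - (f z)\<^sup>2) * D * (\<Sum>i\<in>UNIV. (x $ i - z $ i)\<^sup>2)
        + ((f x - f z) * g x - f z * (g x - g z))\<^sup>2) \<in> quad_module"
      using mult.hyps z fz G *(1,2)
      by (intro quad_module.add quad_module_scale quad_module_mult_square quad_module_sum *
          quad_module.square rpf_intros) auto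
    then show ?thesis
      by (rule quad_module.cong) (simp add: sqdist_def power2_eq_square algebra_simps)
  qed
  then show ?case using *(1,2) G(1) by (intro exI[of _ "2 * G * C + 2 * A\<^sup>2 * D"]) auto
qed

lemma quad_module_vanishing_bound:
  assumes "rpf p" "z \<in> std_simplex" "p z = 0"
  shows "\<exists>C\<ge>0. (\<lambda>x. C * sqdist z x - (p x)\<^sup>2) \<in> quad_module"
  using quad_module_lipschitz[OF assms(1)] assms(2,3) by fastforce

text \<open>
  For every \<open>z\<close> in the simplex, \<open>p \<ge> p z - \<epsilon>/2 - C \<bar>x - z\<bar>\<^sup>2 / (2 \<epsilon>)\<close> modulo the quadratic module, by the
  Lipschitz estimate, and \<open>p z \<ge> 0\<close>. Taking the Bernstein mean of these inequalities over grid points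
  \<open>z\<close> replaces \<open>\<bar>x - z\<bar>\<^sup>2\<close> by a variance of at most \<open>1/N\<close>.
\<close>
theorem nonneg_imp_almost_quad_module:
  fixes p :: "real ^ 'n::finite \<Rightarrow> real"
  assumes p: "rpf p" and nonneg: "\<And>x. x \<in> std_simplex \<Longrightarrow> 0 \<le> p x"
  shows "p \<in> almost_quad_module"
proof (rule almost_quad_module_closed)
  fix \<epsilon> :: real assume \<epsilon>: "\<epsilon> > 0"
  obtain C where C: "C \<ge> 0"
    "\<And>z. z \<in> std_simplex \<Longrightarrow> (\<lambda>x. C * sqdist z x - (p x - p z)\<^sup>2) \<in> quad_module"
    using quad_module_lipschitz[OF p] by blast
  obtain N :: nat where "max 1 (C / (\<epsilon> * \<epsilon>)) \<le> real N"
    using real_arch_simple by blast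
  then have N: "N > 0" "C / (\<epsilon> * \<epsilon>) \<le> real N" by (auto simp: Suc_le_eq)
  \<comment> \<open>The centre is \<open>z = w / N\<close> for a grid point \<open>w\<close>; moving the factor \<open>N\<close> to \<open>x\<close> fits the scaling of the mean.\<close>
  define \<kappa> where "\<kappa> = C / (2 * \<epsilon>) / (real N)\<^sup>2"
  define g where "g x w = p x + \<epsilon> / 2 + \<kappa> * sqdist (real N *s x) w" for x w :: "real ^ 'n"
  have scaled: "\<kappa> * sqdist (real N *s x) w = C / (2 * \<epsilon>) * sqdist ((1 / real N) *s w) x" for x w
  proof -
    have "sqdist (real N *s x) w = (real N)\<^sup>2 * sqdist ((1 / real N) *s w) x"
      unfolding sqdist_def sum_distrib_left
      using N(1) by (intro sum.cong) (auto simp: power2_eq_square field_simps)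
    then show ?thesis using N(1) by (simp add: \<kappa>_def)
  qed
  have rpf_g: "rpf (\<lambda>x. g x w)" for w
    unfolding g_def scaled by (intro rpf_intros p rpf_sqdist)
  have g: "(\<lambda>x. g x w) \<in> almost_quad_module"
    if w: "\<And>i. 0 $ i \<le> w $ i" "(\<Sum>i\<in>UNIV. w $ i) = (\<Sum>i\<in>UNIV. (0::real^'n) $ i) + real N" for w
  proof -
    let ?z = "(1 / real N) *s w"
    have z: "?z \<in> std_simplex"
      using w N(1) by (auto simp: std_simplex_def sum_divide_distrib[symmetric])
    have "(\<lambda>x. 1 / (2 * \<epsilon>) * (C * sqdist ?z x - (p x - p ?z)\<^sup>2) + 1 / (2 * \<epsilon>) * (p x - p ?z + \<epsilon>)\<^sup>2 + p ?z)
        \<in> quad_module"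
      using \<epsilon> z C p by (intro quad_module.add quad_module_scale quad_module.square quad_module_const
          rpf_intros nonneg) auto
    then have "(\<lambda>x. g x w) \<in> quad_module"
      unfolding g_def scaled
      by (rule quad_module.cong) (use \<epsilon> in \<open>simp add: field_simps power2_eq_square\<close>)
    then show ?thesis by (rule quad_module_imp_almost)
  qed
  have mean: "(\<lambda>x. bernstein_mean N (g x) x 0) \<in> almost_quad_module"
    by (rule bernstein_mean_almost_quad_module[OF rpf_g g])
  have "(\<lambda>x. bernstein_mean N (g x) x 0 + (\<kappa> * real N * (\<Sum>i\<in>UNIV. (x $ i)\<^sup>2) + (\<epsilon> / 2 - \<kappa> * real N)))
      \<in> almost_quad_module"
  proof (intro almost_quad_module_add mean quad_module_imp_almost quad_module.add
      quad_module_scale quad_module_sum quad_module.square quad_module_const rpf_intros)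
    show "0 \<le> \<kappa> * real N" using C(1) \<epsilon> by (simp add: \<kappa>_def)
    have "\<kappa> * real N = C / (2 * \<epsilon>) / real N" by (simp add: \<kappa>_def power2_eq_square)
    also have "\<dots> \<le> \<epsilon> / 2" using N \<epsilon> by (simp add: field_simps)
    finally show "0 \<le> \<epsilon> / 2 - \<kappa> * real N" by simp
  qed
  then show "(\<lambda>x. p x + \<epsilon>) \<in> almost_quad_module"
  proof (rule almost_quad_module_cong)
    fix x :: "real ^ 'n" assume x: "(\<Sum>i\<in>UNIV. x $ i) = 1"
    have "sqdist (real N *s x) (real N *s x) = 0" by (simp add: sqdist_def)
    then have "bernstein_mean N (g x) x 0 =
        p x + \<epsilon> / 2 + \<kappa> * (real N * (1 - (\<Sum>i\<in>UNIV. (x $ i)\<^sup>2)))"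
      unfolding g_def bernstein_mean_affine[OF x] bernstein_mean_sqdist[OF x] by simp
    then show "p x + \<epsilon> =
        bernstein_mean N (g x) x 0 + (\<kappa> * real N * (\<Sum>i\<in>UNIV. (x $ i)\<^sup>2) + (\<epsilon> / 2 - \<kappa> * real N))"
      by (simp add: algebra_simps)
  qed
qed

lemma rpf_continuous_on: "rpf (p :: real ^ 'n \<Rightarrow> real) \<Longrightarrow> continuous_on S p"
  using continuous_on_polymonial_function real_polynomial_function_eq by blast

text \<open>
  Putinar's theorem for the simplex: the minimum of \<open>p\<close> is positive and pays for the small
  constant.
\<close>
theorem positive_imp_quad_module:
  fixes p :: "real ^ 'n::finite \<Rightarrow> real"
  assumes p: "rpf p" and pos: "\<And>x. x \<in> std_simplex \<Longrightarrow> 0 < p x"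
  shows "p \<in> quad_module"
proof -
  have "axis i 1 \<in> (std_simplex :: (real ^ 'n) set)" for i
    by (auto simp: std_simplex_def axis_def)
  then obtain a where a: "a \<in> std_simplex" "\<And>x. x \<in> std_simplex \<Longrightarrow> p a \<le> p x"
    using continuous_attains_inf[OF compact_std_simplex _ rpf_continuous_on[OF p]] by blast
  have "(\<lambda>x. p x - p a) \<in> almost_quad_module"
    using a(2) by (intro nonneg_imp_almost_quad_module rpf_intros p) auto
  then have "(\<lambda>x. p x - p a + p a) \<in> quad_module"
    using pos[OF a(1)] unfolding almost_quad_module_def by blast
  then show ?thesis by simp
qed

section \<open>Weighted graphs and their Motzkin-Straus programs\<close>

lemma card_le_stability_number:
  fixes E :: "('n::finite) set set"
  assumes "stable E S"
  shows "card S \<le> stability_number E"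
  unfolding stability_number_def using assms by (intro Max_ge) auto

lemma ex_maximum_stable:
  fixes E :: "('n::finite) set set"
  shows "\<exists>S. stable E S \<and> card S = stability_number E"
proof -
  have "stable E {}" by (simp add: stable_def)
  then have "card ` {S. stable E S} \<noteq> {}" by blast
  then have "stability_number E \<in> card ` {S. stable E S}"
    unfolding stability_number_def by (intro Max_in) auto
  then show ?thesis by auto
qed

lemma stability_number_pos: "0 < stability_number (E :: ('n::finite) set set)"
proof -
  obtain a :: 'n where True by simp
  have "stable E {a}" by (simp add: stable_def)
  from card_le_stability_number[OF this] show ?thesis by simp
qed

definition maximum_stable_sets :: "('n::finite) set set \<Rightarrow> 'n set set" where
  "maximum_stable_sets E = {S. stable E S \<and> card S = stability_number E}"

lemma stability_number_delete_edge_le: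
  fixes E :: "('n::finite) set set"
  shows "stability_number (E - {{i, j}}) \<le> stability_number E + 1"
proof -
  obtain S where S: "stable (E - {{i, j}}) S" "card S = stability_number (E - {{i, j}})"
    using ex_maximum_stable by blast
  have "stable E (S - {i})"
    using S(1) by (auto simp: stable_def doubleton_eq_iff)
  from card_le_stability_number[OF this] show ?thesis
    using S(2) by (metis Suc_eq_plus1 Suc_le_mono card_Suc_Diff1 diff_card_le_card_Diff
        diff_le_self finite le_SucI Diff_empty Diff_insert0 order_trans)
qed

text \<open>
  Adding \<open>i\<close> to \<open>S\<close> creates the single edge \<open>{i, j}\<close>, so deleting that edge enlarges the stability
  number.
\<close>
lemma critical_edge_of_exchange:
  fixes E :: "('n::finite) set set"
  assumes S: "S \<in> maximum_stable_sets E" and "i \<notin> S" "j \<in> S" and ij: "{i, j} \<in> E"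
    and others: "\<And>k. k \<in> S \<Longrightarrow> k \<noteq> j \<Longrightarrow> {i, k} \<notin> E"
  shows "critical_edge E {i, j}"
proof -
  have "stable (E - {{i, j}}) (insert i S)"
    unfolding stable_def
  proof (intro ballI impI)
    fix a b assume ab: "a \<in> insert i S" "b \<in> insert i S" "a \<noteq> b"
    have SS: "{a, b} \<notin> E" if "a \<in> S" "b \<in> S"
      using S ab(3) that by (auto simp: maximum_stable_sets_def stable_def)
    have iS: "{i, k} \<notin> E - {{i, j}}" if "k \<in> S" for k
      using others[OF that] by (cases "k = j") auto
    show "{a, b} \<notin> E - {{i, j}}"
      using ab SS iS[of a] iS[of b] by (auto simp: insert_commute[of a i])
  qed
  from card_le_stability_number[OF this]
  have "stability_number E + 1 \<le> stability_number (E - {{i, j}})"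
    using S \<open>i \<notin> S\<close> by (simp add: maximum_stable_sets_def)
  then show ?thesis
    using stability_number_delete_edge_le[of E i j] ij by (simp add: critical_edge_def)
qed

definition barycentre :: "'n set \<Rightarrow> real ^ 'n::finite" where
  "barycentre S = (\<chi> i. if i \<in> S then 1 / real (card S) else 0)"

lemma barycentre_in_simplex: "S \<noteq> {} \<Longrightarrow> barycentre S \<in> std_simplex"
  by (auto simp: std_simplex_def barycentre_def sum.If_cases)

locale weighted_graph =
  fixes E :: "('n::finite) set set" and B :: "real ^ 'n ^ 'n"
  assumes simple: "simple_graph E" and B: "B \<in> graph_matrices E"
begin

abbreviation alpha :: real where "alpha \<equiv> real (stability_number E)"

definition form :: "real ^ 'n \<Rightarrow> real" where
  "form x = x \<bullet> (B *v x)"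

lemma alpha_pos: "0 < alpha" by (simp add: stability_number_pos)

lemma edge_neq: "{i, j} \<in> E \<Longrightarrow> i \<noteq> j"
  using simple by (auto simp: simple_graph_def)

lemma B_sym: "B $ i $ j = B $ j $ i"
proof -
  have "transpose B = B" using B by (simp add: graph_matrices_def)
  then have "transpose B $ i $ j = B $ i $ j" by simp
  then show ?thesis by (simp add: transpose_def)
qed

lemma B_diag: "B $ i $ i = 1"
  and B_edge: "{i, j} \<in> E \<Longrightarrow> 1 \<le> B $ i $ j"
  and B_nonedge: "i \<noteq> j \<Longrightarrow> {i, j} \<notin> E \<Longrightarrow> B $ i $ j = 0"
  using B by (auto simp: graph_matrices_def)

lemma B_nonneg: "0 \<le> B $ i $ j"
  by (cases "i = j"; cases "{i, j} \<in> E") (use B_diag[of i] B_edge[of i j] B_nonedge[of i j] in auto)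

lemma B_stable:
  assumes "stable E S" "i \<in> S" "j \<in> S"
  shows "B $ i $ j = (if j = i then 1 else 0)"
  using assms B_diag B_nonedge[of i j] by (auto simp: stable_def)

lemma inner_B_commute: "x \<bullet> (B *v y) = y \<bullet> (B *v x)"
proof -
  have "x \<bullet> (B *v y) = (\<Sum>i\<in>UNIV. \<Sum>j\<in>UNIV. B $ i $ j * x $ i * y $ j)"
    by (simp add: inner_vec_def matrix_vector_mult_def sum_distrib_left mult_ac)
  also have "\<dots> = (\<Sum>j\<in>UNIV. \<Sum>i\<in>UNIV. B $ j $ i * y $ j * x $ i)"
    by (subst sum.swap) (simp add: B_sym mult_ac)
  also have "\<dots> = y \<bullet> (B *v x)"
    by (simp add: inner_vec_def matrix_vector_mult_def sum_distrib_left mult_ac)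
  finally show ?thesis .
qed

lemma form_add: "form (x + y) = form x + 2 * (y \<bullet> (B *v x)) + form y"
  unfolding form_def
  by (simp add: matrix_vector_right_distrib inner_add_left inner_add_right inner_B_commute[of x y])

lemma form_scale: "form (c *s x) = c\<^sup>2 * form x"
  unfolding form_def scalar_mult_eq_scaleR matrix_vector_mult_scaleR by (simp add: power2_eq_square)

lemma form_edge_direction: "form (axis l 1 - axis m 1) = 2 - 2 * B $ l $ m"
  unfolding form_def
  by (simp add: matrix_vector_mult_diff_distrib matrix_vector_mult_basis column_def inner_diff_left
      inner_axis' B_diag B_sym[of m l])

lemma form_stable_support:
  assumes "stable E S" "\<And>i. i \<notin> S \<Longrightarrow> x $ i = 0"
  shows "form x = (\<Sum>i\<in>UNIV. (x $ i)\<^sup>2)"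
proof -
  have "(B *v x) $ i = x $ i" if "i \<in> S" for i
  proof -
    have "B $ i $ j * x $ j = (if j = i then x $ j else 0)" for j
      using assms(2)[of j] B_stable[OF assms(1) that, of j] by (cases "j \<in> S") auto
    then have "(B *v x) $ i = (\<Sum>j\<in>UNIV. if j = i then x $ j else 0)"
      unfolding matrix_vector_mult_def by simp
    then show ?thesis by simp
  qed
  then have "x $ i * (B *v x) $ i = (x $ i)\<^sup>2" for i
    using assms(2)[of i] by (cases "i \<in> S") (auto simp: power2_eq_square)
  then show ?thesis
    unfolding form_def inner_vec_def by simp
qed

lemma form_barycentre:
  assumes "S \<in> maximum_stable_sets E"
  shows "form (barycentre S) = 1 / alpha"
proof -
  have S: "stable E S" "real (card S) = alpha" using assms by (auto simp: maximum_stable_sets_def)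
  have "form (barycentre S) = (\<Sum>i\<in>UNIV. (barycentre S $ i)\<^sup>2)"
    by (rule form_stable_support[OF S(1)]) (simp add: barycentre_def)
  also have "\<dots> = (\<Sum>i\<in>UNIV. if i \<in> S then (1 / alpha)\<^sup>2 else 0)"
    by (intro sum.cong) (auto simp: barycentre_def S(2))
  also have "\<dots> = 1 / alpha"
    using S(2) alpha_pos by (simp add: sum.If_cases power2_eq_square)
  finally show ?thesis .
qed

end

locale strict_weighted_graph = weighted_graph E B
  for E :: "('n::finite) set set" and B +
  assumes strict: "\<And>l m. critical_edge E {l, m} \<Longrightarrow> 1 < B $ l $ m"
begin

text \<open>
  Induction on the size of the support. On a stable support \<open>f\<close> is the sum of squares of the
  coordinates. Otherwise let \<open>{l, m}\<close> be an edge in the support: along \<open>e\<^sub>l - e\<^sub>m\<close> the form has second derivative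
  \<open>4 (1 - B\<^sub>l\<^sub>m) \<le> 0\<close>, so its value at \<open>x\<close> is at least the interpolation of its values at the two end points
  of the segment inside the simplex, where the support is smaller. Equality would give \<open>B\<^sub>l\<^sub>m = 1\<close> and
  two maximum stable sets that differ by exchanging \<open>l\<close> and \<open>m\<close>; such an edge is critical.
\<close>
theorem motzkin_straus:
  assumes "x \<in> std_simplex"
  shows "1 / alpha \<le> form x"
    and "form x = 1 / alpha \<Longrightarrow> \<exists>S\<in>maximum_stable_sets E. x = barycentre S"
proof -
  have "1 / alpha \<le> form x \<and>
    (form x = 1 / alpha \<longrightarrow> (\<exists>S\<in>maximum_stable_sets E. x = barycentre S))"
    using assms
  proof (induction "card {i. x $ i \<noteq> 0}" arbitrary: x rule: less_induct)
    case less
    let ?S = "{i. x $ i \<noteq> 0}"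
    have x: "\<And>i. 0 \<le> x $ i" "(\<Sum>i\<in>UNIV. x $ i) = 1"
      using less.prems by (auto simp: std_simplex_def)
    show ?case
    proof (cases "stable E ?S")
      case True
      define k where "k = card ?S"
      have "?S \<noteq> {}"
      proof
        assume "?S = {}"
        then have "(\<Sum>i\<in>UNIV. x $ i) = 0" by (intro sum.neutral) auto
        with x(2) show False by simp
      qed
      then have k: "0 < k" by (simp add: k_def card_gt_0_iff)
      have kalpha: "k \<le> stability_number E"
        unfolding k_def by (rule card_le_stability_number[OF True])
      have sumS: "(\<Sum>i\<in>?S. x $ i) = 1"
        using x(2) by (subst sum.mono_neutral_left[of UNIV]) auto
      have form: "form x = (\<Sum>i\<in>?S. (x $ i)\<^sup>2)"
        by (subst form_stable_support[OF True], simp, rule sum.mono_neutral_right) auto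
      have dev: "(\<Sum>i\<in>?S. (x $ i - 1 / real k)\<^sup>2) = form x - 1 / real k"
      proof -
        have "(\<Sum>i\<in>?S. (x $ i - 1 / real k)\<^sup>2) =
            (\<Sum>i\<in>?S. (x $ i)\<^sup>2) - 2 / real k * (\<Sum>i\<in>?S. x $ i) + real k * (1 / real k)\<^sup>2"
          by (simp add: power2_diff sum.distrib sum_subtractf sum_distrib_left sum_divide_distrib k_def mult_ac)
        then show ?thesis using k by (simp add: form sumS power2_eq_square)
      qed
      have "0 \<le> (\<Sum>i\<in>?S. (x $ i - 1 / real k)\<^sup>2)" by (intro sum_nonneg) auto
      then have ge: "1 / real k \<le> form x" using dev by simp
      have le: "1 / alpha \<le> 1 / real k" using k kalpha by (simp add: frac_le)
      show ?thesis
      proof (intro conjI impI)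
        show "1 / alpha \<le> form x" using ge le by simp
        assume eq: "form x = 1 / alpha"
        then have "alpha \<le> real k"
          using ge k alpha_pos by (simp add: pos_le_divide_eq pos_divide_le_eq mult.commute)
        then have k_eq: "real k = alpha" using kalpha by simp
        have "(\<Sum>i\<in>?S. (x $ i - 1 / real k)\<^sup>2) = 0"
          using dev eq k_eq by simp
        then have "\<forall>i\<in>?S. (x $ i - 1 / real k)\<^sup>2 = 0"
          by (subst (asm) sum_nonneg_eq_0_iff) auto
        then have "x = barycentre ?S"
          by (auto simp: barycentre_def vec_eq_iff k_def)
        moreover have "?S \<in> maximum_stable_sets E"
          using True k_eq by (simp add: maximum_stable_sets_def k_def)
        ultimately show "\<exists>S\<in>maximum_stable_sets E. x = barycentre S" by blast
      qed
    next
      case False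
      then obtain l m where lm: "x $ l \<noteq> 0" "x $ m \<noteq> 0" "l \<noteq> m" "{l, m} \<in> E"
        by (auto simp: stable_def)
      have pos: "0 < x $ l" "0 < x $ m"
        using lm x(1)[of l] x(1)[of m] by auto
      define d :: "real ^ 'n" where "d = axis l 1 - axis m 1"
      have d: "d $ l = 1" "d $ m = - 1" "\<And>i. i \<noteq> l \<Longrightarrow> i \<noteq> m \<Longrightarrow> d $ i = 0"
        using lm(3) by (auto simp: d_def axis_def)
      have sumd: "(\<Sum>i\<in>UNIV. d $ i) = 0"
        by (simp add: d_def axis_def sum_subtractf)
      \<comment> \<open>The end points of the segment: all mass of \<open>l\<close> and \<open>m\<close> is moved to one of them.\<close>
      define y y' where "y = x + (x $ m) *s d" and "y' = x + (- x $ l) *s d"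
      have y: "y $ m = 0" "y $ l = x $ l + x $ m" "\<And>i. i \<noteq> l \<Longrightarrow> i \<noteq> m \<Longrightarrow> y $ i = x $ i"
        and y': "y' $ l = 0" "y' $ m = x $ l + x $ m" "\<And>i. i \<noteq> l \<Longrightarrow> i \<noteq> m \<Longrightarrow> y' $ i = x $ i"
        by (auto simp: y_def y'_def d)
      have in_simplex: "y \<in> std_simplex" "y' \<in> std_simplex"
      proof -
        have "0 \<le> y $ i" "0 \<le> y' $ i" for i
          using y y' x(1)[of i] pos by (cases "i = l"; cases "i = m"; simp)+
        moreover have "(\<Sum>i\<in>UNIV. y $ i) = 1" "(\<Sum>i\<in>UNIV. y' $ i) = 1"
          unfolding y_def y'_def
          by (simp_all add: sum.distrib sum_subtractf sum_distrib_left[symmetric] sumd x(2))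
        ultimately show "y \<in> std_simplex" "y' \<in> std_simplex"
          by (auto simp: std_simplex_def)
      qed
      have "card {i. y $ i \<noteq> 0} < card ?S" "card {i. y' $ i \<noteq> 0} < card ?S"
      proof -
        have "i \<in> ?S - {m}" if "y $ i \<noteq> 0" for i
          using that y lm by (cases "i = l"; cases "i = m"; auto)
        moreover have "i \<in> ?S - {l}" if "y' $ i \<noteq> 0" for i
          using that y' lm by (cases "i = l"; cases "i = m"; auto)
        ultimately have "{i. y $ i \<noteq> 0} \<subset> ?S" "{i. y' $ i \<noteq> 0} \<subset> ?S"
          using lm y y' by blast+
        then show "card {i. y $ i \<noteq> 0} < card ?S" "card {i. y' $ i \<noteq> 0} < card ?S"
          by (auto intro!: psubset_card_mono)
      qed
      note IH = less.hyps[OF this(1) in_simplex(1)] less.hyps[OF this(2) in_simplex(2)]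
      have fy: "form y = form x + 2 * (x $ m) * (d \<bullet> (B *v x)) + (x $ m)\<^sup>2 * (2 - 2 * B $ l $ m)"
        "form y' = form x - 2 * (x $ l) * (d \<bullet> (B *v x)) + (x $ l)\<^sup>2 * (2 - 2 * B $ l $ m)"
        unfolding y_def y'_def form_add form_scale
        by (simp_all add: d_def form_edge_direction[symmetric] scalar_mult_eq_scaleR)
      have conv: "(x $ l + x $ m) * form x =
          x $ l * form y + x $ m * form y' + (2 * B $ l $ m - 2) * (x $ l * x $ m) * (x $ l + x $ m)"
        unfolding fy by (simp add: algebra_simps power2_eq_square)
      have B1: "1 \<le> B $ l $ m" using B_edge lm(4) by blast
      have parts: "x $ l * (1 / alpha) \<le> x $ l * form y" "x $ m * (1 / alpha) \<le> x $ m * form y'"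
        "0 \<le> (2 * B $ l $ m - 2) * (x $ l * x $ m) * (x $ l + x $ m)"
      proof -
        show "x $ l * (1 / alpha) \<le> x $ l * form y" "x $ m * (1 / alpha) \<le> x $ m * form y'"
          using IH pos by (simp_all only: mult_left_mono less_imp_le)
        show "0 \<le> (2 * B $ l $ m - 2) * (x $ l * x $ m) * (x $ l + x $ m)"
          using pos B1 by (intro mult_nonneg_nonneg) auto
      qed
      have "(x $ l + x $ m) * (1 / alpha) \<le> (x $ l + x $ m) * form x"
        unfolding conv using parts unfolding distrib_right by linarith
      then have bound: "1 / alpha \<le> form x" using pos by (simp only: mult_le_cancel_left_pos add_pos_pos)
      have "False" if eq: "form x = 1 / alpha"
      proof -
        have "x $ l * (1 / alpha) + x $ m * (1 / alpha) = x $ l * form y + x $ m * form y'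
          + (2 * B $ l $ m - 2) * (x $ l * x $ m) * (x $ l + x $ m)"
          using conv unfolding eq by (simp only: distrib_right)
        then have eqs: "x $ l * form y = x $ l * (1 / alpha)" "x $ m * form y' = x $ m * (1 / alpha)"
          "(2 * B $ l $ m - 2) * (x $ l * x $ m) * (x $ l + x $ m) = 0"
          using parts by linarith+
        have B_eq: "B $ l $ m = 1" using eqs(3) pos by auto
        have "form y = 1 / alpha" "form y' = 1 / alpha"
          using mult_left_cancel[THEN iffD1, OF _ eqs(1)] mult_left_cancel[THEN iffD1, OF _ eqs(2)] pos
          by simp_all
        then obtain S S' where S: "S \<in> maximum_stable_sets E" "y = barycentre S"
          and S': "S' \<in> maximum_stable_sets E" "y' = barycentre S'"
          using IH by blast
        have mem: "i \<in> S \<longleftrightarrow> y $ i \<noteq> 0" "i \<in> S' \<longleftrightarrow> y' $ i \<noteq> 0" for i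
          using S S' stability_number_pos[of E]
          by (auto simp: barycentre_def maximum_stable_sets_def)
        have "critical_edge E {m, l}"
        proof (rule critical_edge_of_exchange[OF S(1)])
          show "m \<notin> S" "l \<in> S" using mem y pos by auto
          show "{m, l} \<in> E" using lm(4) by (simp add: insert_commute)
          fix k assume k: "k \<in> S" "k \<noteq> l"
          then have "k \<noteq> m" using mem y by auto
          with k have "k \<in> S'" "m \<in> S'" using mem y y' pos by auto
          then show "{m, k} \<notin> E"
            using S'(1) \<open>k \<noteq> m\<close> by (auto simp: maximum_stable_sets_def stable_def)
        qed
        from strict[OF this] B_eq B_sym[of l m] show False by simp
      qed
      with bound show ?thesis by blast
    qed
  qed
  then show "1 / alpha \<le> form x"
    and "form x = 1 / alpha \<Longrightarrow> \<exists>S\<in>maximum_stable_sets E. x = barycentre S" by auto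
qed

text \<open>
  Strict complementarity at the minimizers: this sum exceeding 1 is the positivity of the derivative of
  \<open>f\<close> at the barycentre of \<open>S\<close> towards the vertex \<open>i\<close>.
\<close>
lemma neighbour_weight_gt_1:
  assumes S: "S \<in> maximum_stable_sets E" and i: "i \<notin> S"
  shows "1 < (\<Sum>j\<in>S. B $ i $ j)"
proof -
  have "\<exists>j\<in>S. {i, j} \<in> E"
  proof (rule ccontr)
    assume "\<not> (\<exists>j\<in>S. {i, j} \<in> E)"
    then have "stable E (insert i S)"
      using S by (auto simp: stable_def maximum_stable_sets_def insert_commute)
    from card_le_stability_number[OF this] show False
      using S i by (simp add: maximum_stable_sets_def)
  qed
  then obtain j where j: "j \<in> S" "{i, j} \<in> E" by blast
  have split: "(\<Sum>k\<in>S. B $ i $ k) = B $ i $ j + (\<Sum>k\<in>S - {j}. B $ i $ k)"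
    using j(1) by (intro sum.remove) auto
  show ?thesis
  proof (cases "\<exists>k\<in>S - {j}. {i, k} \<in> E")
    case True
    then obtain k where k: "k \<in> S - {j}" "{i, k} \<in> E" by blast
    have "B $ i $ k \<le> (\<Sum>k\<in>S - {j}. B $ i $ k)"
      using k(1) B_nonneg by (intro member_le_sum) auto
    then show ?thesis using split B_edge[OF j(2)] B_edge[OF k(2)] by simp
  next
    case False
    then have "critical_edge E {i, j}"
      by (intro critical_edge_of_exchange[OF S i j]) auto
    from strict[OF this] have "1 < B $ i $ j" .
    moreover have "0 \<le> (\<Sum>k\<in>S - {j}. B $ i $ k)" by (intro sum_nonneg B_nonneg)
    ultimately show ?thesis using split by simp
  qed
qed

text \<open>
  Taylor expansion at a minimizer, arranged so that \<open>\<bar>x - z\<^sub>S\<bar>\<^sup>2\<close> appears as a whole and everything else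
  carries a factor \<open>x\<^sub>i\<close> with \<open>i \<notin> S\<close>. The gradient at \<open>z\<^sub>S\<close> is constant on \<open>S\<close>, and the coordinates of \<open>d\<close>
  sum to 0, so only the excess over that constant remains in the linear part.
\<close>
lemma form_expansion:
  assumes S: "S \<in> maximum_stable_sets E" and x: "(\<Sum>i\<in>UNIV. x $ i) = 1"
  fixes d defines "d \<equiv> x - barycentre S"
  shows "form x - 1 / alpha = sqdist (barycentre S) x
    + (\<Sum>i\<in>-S. x $ i * (2 * ((\<Sum>j\<in>S. B $ i $ j) - 1) / alpha
        + (\<Sum>j\<in>UNIV. (B $ i $ j + (if j \<in> S then B $ i $ j else 0) - (if j = i then 1 else 0)) * d $ j)))"
proof -
  have S': "stable E S" "real (card S) = alpha"
    using S by (auto simp: maximum_stable_sets_def)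
  have S_ne: "S \<noteq> {}" using S'(2) alpha_pos by auto
  let ?z = "barycentre S"
  have d: "d $ i = x $ i" if "i \<notin> S" for i using that by (simp add: d_def barycentre_def)
  have sumd: "(\<Sum>i\<in>UNIV. d $ i) = 0"
    using x barycentre_in_simplex[OF S_ne] by (simp add: d_def sum_subtractf std_simplex_def)
  have split: "(\<Sum>i\<in>UNIV. f i) = (\<Sum>i\<in>S. f i) + (\<Sum>i\<in>-S. f i)" for f :: "'n \<Rightarrow> real"
    using sum.union_disjoint[of S "-S" f] by simp
  have fz: "form ?z = 1 / alpha" by (rule form_barycentre[OF S])
  have Bz: "(B *v ?z) $ i = (\<Sum>j\<in>S. B $ i $ j) / alpha" for i
    unfolding matrix_vector_mult_def using S'(2)
    by (simp add: split barycentre_def sum_divide_distrib)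
  have BzS: "(\<Sum>j\<in>S. B $ i $ j) = 1" if "i \<in> S" for i
    using that B_stable[OF S'(1) that] by simp
  have lin: "d \<bullet> (B *v ?z) = (\<Sum>i\<in>-S. x $ i * (((\<Sum>j\<in>S. B $ i $ j) - 1) / alpha))"
  proof -
    have "d \<bullet> (B *v ?z) = (\<Sum>i\<in>UNIV. d $ i * ((\<Sum>j\<in>S. B $ i $ j) / alpha))"
      by (simp add: inner_vec_def Bz)
    also have "\<dots> = (\<Sum>i\<in>UNIV. d $ i * (((\<Sum>j\<in>S. B $ i $ j) - 1) / alpha)) + (\<Sum>i\<in>UNIV. d $ i) / alpha"
      by (simp add: sum_divide_distrib sum.distrib[symmetric] diff_divide_distrib algebra_simps)
    also have "\<dots> = (\<Sum>i\<in>UNIV. d $ i * (((\<Sum>j\<in>S. B $ i $ j) - 1) / alpha))"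
      by (simp add: sumd)
    also have "\<dots> = (\<Sum>i\<in>-S. x $ i * (((\<Sum>j\<in>S. B $ i $ j) - 1) / alpha))"
      by (simp add: split BzS d)
    finally show ?thesis .
  qed
  have quad: "form d = (\<Sum>i\<in>S. (d $ i)\<^sup>2) + (\<Sum>i\<in>-S. x $ i * ((B *v d) $ i + (\<Sum>j\<in>S. B $ i $ j * d $ j)))"
  proof -
    have Bd: "(B *v d) $ i = d $ i + (\<Sum>j\<in>-S. B $ i $ j * x $ j)" if "i \<in> S" for i
    proof -
      have "(\<Sum>j\<in>S. B $ i $ j * d $ j) = (\<Sum>j\<in>S. if j = i then d $ j else 0)"
        using B_stable[OF S'(1) that] by (intro sum.cong) auto
      then show ?thesis
        using that by (simp add: matrix_vector_mult_def split d)
    qed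
    have "form d = (\<Sum>i\<in>S. d $ i * (B *v d) $ i) + (\<Sum>i\<in>-S. x $ i * (B *v d) $ i)"
      unfolding form_def inner_vec_def by (simp add: split d)
    also have "(\<Sum>i\<in>S. d $ i * (B *v d) $ i) =
        (\<Sum>i\<in>S. (d $ i)\<^sup>2) + (\<Sum>i\<in>S. \<Sum>j\<in>-S. x $ j * (B $ j $ i * d $ i))"
      by (simp add: Bd distrib_left sum.distrib sum_distrib_left power2_eq_square mult_ac B_sym)
    also have "(\<Sum>i\<in>S. \<Sum>j\<in>-S. x $ j * (B $ j $ i * d $ i)) =
        (\<Sum>j\<in>-S. x $ j * (\<Sum>i\<in>S. B $ j $ i * d $ i))"
      by (subst sum.swap) (simp add: sum_distrib_left)
    finally show ?thesis by (simp add: sum.distrib distrib_left)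
  qed
  have row: "(\<Sum>j\<in>UNIV. (B $ i $ j + (if j \<in> S then B $ i $ j else 0) - (if j = i then 1 else 0)) * d $ j)
      = (B *v d) $ i + (\<Sum>j\<in>S. B $ i $ j * d $ j) - d $ i" for i
  proof -
    have "(\<Sum>j\<in>UNIV. (B $ i $ j + (if j \<in> S then B $ i $ j else 0) - (if j = i then 1 else 0)) * d $ j)
      = (\<Sum>j\<in>UNIV. B $ i $ j * d $ j + (if j \<in> S then B $ i $ j * d $ j else 0) - (if j = i then d $ j else 0))"
      by (intro sum.cong) (auto simp: algebra_simps)
    then show ?thesis
      by (simp add: sum.distrib sum_subtractf matrix_vector_mult_def sum.If_cases)
  qed
  have dist: "sqdist ?z x = (\<Sum>i\<in>S. (d $ i)\<^sup>2) + (\<Sum>i\<in>-S. x $ i * x $ i)"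
    by (simp add: sqdist_def split d_def barycentre_def power2_eq_square)
  have "form x = form ?z + 2 * (d \<bullet> (B *v ?z)) + form d"
    using form_add[of ?z d] by (simp add: d_def)
  then show ?thesis
    unfolding fz lin quad row dist
    by (simp add: d distrib_left sum.distrib sum_subtractf right_diff_distrib sum_distrib_left mult_ac)
qed

end

section \<open>An exact certificate when critical edges have weight above one\<close>

text \<open>
  Bounds up to a constant factor modulo the quadratic module, for functions that vanish at common
  zeros.
\<close>
definition dominated :: "(real ^ 'n::finite \<Rightarrow> real) \<Rightarrow> (real ^ 'n \<Rightarrow> real) \<Rightarrow> bool" where
  "dominated f g \<longleftrightarrow> (\<exists>C\<ge>0. (\<lambda>x. C * g x - f x) \<in> quad_module)"

lemma dominated_add:
  assumes "dominated f h" "dominated g h"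
  shows "dominated (\<lambda>x. f x + g x) h"
proof -
  obtain C D where "0 \<le> C" "0 \<le> D" and C: "(\<lambda>x. C * h x - f x) \<in> quad_module"
    and D: "(\<lambda>x. D * h x - g x) \<in> quad_module"
    using assms unfolding dominated_def by blast
  moreover have "(\<lambda>x. (C + D) * h x - (f x + g x)) \<in> quad_module"
    by (rule quad_module.cong[OF quad_module.add[OF C D]]) (simp add: algebra_simps)
  ultimately show ?thesis unfolding dominated_def by (meson add_nonneg_nonneg)
qed

lemma dominated_zero: "dominated (\<lambda>x. 0) h"
  unfolding dominated_def by (auto intro!: exI[of _ 0] quad_module_const[of 0, simplified])

lemma dominated_sum:
  "(\<And>a. a \<in> A \<Longrightarrow> dominated (f a) h) \<Longrightarrow> dominated (\<lambda>x. \<Sum>a\<in>A. f a x) h"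
  by (induction A rule: infinite_finite_induct) (auto intro: dominated_zero dominated_add)

lemma dominated_trans:
  assumes "dominated f g" "dominated g h"
  shows "dominated f h"
proof -
  obtain C D where "0 \<le> C" "0 \<le> D" and C: "(\<lambda>x. C * g x - f x) \<in> quad_module"
    and D: "(\<lambda>x. D * h x - g x) \<in> quad_module"
    using assms unfolding dominated_def by blast
  moreover have "(\<lambda>x. (C * D) * h x - f x) \<in> quad_module"
    by (rule quad_module.cong[OF quad_module.add[OF C quad_module_scale[OF \<open>0 \<le> C\<close> D]]])
      (simp add: algebra_simps)
  ultimately show ?thesis unfolding dominated_def by (meson mult_nonneg_nonneg)
qed

lemma dominated_mult_square:
  assumes "dominated f g" "rpf h"
  shows "dominated (\<lambda>x. (h x)\<^sup>2 * f x) (\<lambda>x. (h x)\<^sup>2 * g x)"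
proof -
  obtain C where "0 \<le> C" and C: "(\<lambda>x. C * g x - f x) \<in> quad_module"
    using assms unfolding dominated_def by blast
  moreover have "(\<lambda>x. C * ((h x)\<^sup>2 * g x) - (h x)\<^sup>2 * f x) \<in> quad_module"
    by (rule quad_module.cong[OF quad_module_mult_square[OF C assms(2)]]) (simp add: algebra_simps)
  ultimately show ?thesis unfolding dominated_def by blast
qed

lemma dominated_square_add:
  assumes "dominated (\<lambda>x. (f x)\<^sup>2) h" "dominated (\<lambda>x. (g x)\<^sup>2) h" "rpf f" "rpf g"
  shows "dominated (\<lambda>x. (f x + g x)\<^sup>2) h"
proof -
  have "(\<lambda>x. (f x - g x)\<^sup>2) \<in> quad_module"
    using assms by (intro quad_module.square rpf_intros)
  then have "(\<lambda>x. 2 * ((f x)\<^sup>2 + (g x)\<^sup>2) - (f x + g x)\<^sup>2) \<in> quad_module"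
    by (rule quad_module.cong) (simp add: power2_eq_square algebra_simps)
  then have "dominated (\<lambda>x. (f x + g x)\<^sup>2) (\<lambda>x. (f x)\<^sup>2 + (g x)\<^sup>2)"
    unfolding dominated_def by (auto intro!: exI[of _ 2])
  then show ?thesis
    by (rule dominated_trans) (intro dominated_add assms)
qed

lemma dominated_square_sum:
  assumes "\<And>a. a \<in> A \<Longrightarrow> dominated (\<lambda>x. (f a x)\<^sup>2) h" "\<And>a. a \<in> A \<Longrightarrow> rpf (f a)"
  shows "dominated (\<lambda>x. (\<Sum>a\<in>A. f a x)\<^sup>2) h"
  using assms
proof (induction A rule: infinite_finite_induct)
  case (insert a A)
  have "dominated (\<lambda>x. (f a x + (\<Sum>a\<in>A. f a x))\<^sup>2) h"
    using insert by (intro dominated_square_add real_polynomial_function_sum) auto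
  then show ?case using insert.hyps by simp
qed (auto intro: dominated_zero)

lemma dominated_vanishing_square:
  assumes "rpf p" "z \<in> std_simplex" "p z = 0"
  shows "dominated (\<lambda>x. (p x)\<^sup>2) (sqdist z)"
  using quad_module_vanishing_bound[OF assms] by (simp add: dominated_def)

lemma dominated_eventually:
  assumes "dominated f g" "g \<in> quad_module"
  shows "eventually (\<lambda>C. (\<lambda>x. C * g x - f x) \<in> quad_module) at_top"
proof -
  obtain C where C: "(\<lambda>x. C * g x - f x) \<in> quad_module"
    using assms unfolding dominated_def by blast
  have "(\<lambda>x. D * g x - f x) \<in> quad_module" if "C \<le> D" for D
    by (rule quad_module.cong[OF quad_module.add[OF C quad_module_scale[of "D - C", OF _ assms(2)]]])
      (use that in \<open>auto simp: algebra_simps\<close>)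
  then show ?thesis by (auto simp: eventually_at_top_linorder)
qed

lemma sqdist_in_quad_module: "sqdist z \<in> quad_module"
  unfolding sqdist_def[abs_def] by (intro quad_module_sum quad_module.square rpf_intros)

lemma quad_module_sqdist_mult:
  assumes f: "f \<in> quad_module" and h: "rpf h"
  shows "(\<lambda>x. (h x)\<^sup>2 * sqdist z x * f x) \<in> quad_module"
proof -
  have "(\<lambda>x. \<Sum>i\<in>UNIV. (h x * (x $ i - z $ i))\<^sup>2 * f x) \<in> quad_module"
    by (intro quad_module_sum quad_module_mult_square f rpf_intros h)
  then show ?thesis
    by (rule quad_module.cong)
      (simp add: sqdist_def power_mult_distrib sum_distrib_left sum_distrib_right mult_ac)
qed

text \<open>
  High powers of \<open>p\<close> are concentrated where \<open>p = 1\<close>; on the compact set where \<open>g \<le> 0\<close>, \<open>p\<close> stays below a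
  constant less than 1.
\<close>
lemma eventually_power_mult_positive:
  fixes p g :: "real ^ 'n::finite \<Rightarrow> real"
  assumes p: "rpf p" and g: "rpf g" and bounds: "\<And>x. x \<in> std_simplex \<Longrightarrow> 0 \<le> p x \<and> p x \<le> 1"
    and peak: "\<And>x. x \<in> std_simplex \<Longrightarrow> p x = 1 \<Longrightarrow> 0 < g x" and \<eta>: "0 < \<eta>"
  shows "eventually (\<lambda>k::nat. \<forall>x\<in>std_simplex. 0 < p x ^ k * g x + \<eta>) sequentially"
proof -
  let ?T = "std_simplex \<inter> {x. g x \<le> 0}"
  obtain G where G: "0 \<le> G" "\<And>x. x \<in> std_simplex \<Longrightarrow> \<bar>g x\<bar> \<le> G"
    using rpf_bounded_on_simplex[OF g] by blast
  have "\<exists>\<rho>. 0 \<le> \<rho> \<and> \<rho> < 1 \<and> (\<forall>x\<in>?T. p x \<le> \<rho>)"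
  proof (cases "?T = {}")
    case True
    then show ?thesis by (intro exI[of _ 0]) auto
  next
    case False
    have "compact ?T"
      by (intro compact_Int_closed compact_std_simplex closed_Collect_le rpf_continuous_on g
          continuous_intros)
    then obtain a where a: "a \<in> ?T" "\<And>x. x \<in> ?T \<Longrightarrow> p x \<le> p a"
      using continuous_attains_sup[OF _ False rpf_continuous_on[OF p]] by blast
    have "p a \<noteq> 1" using a(1) peak[of a] by auto
    then show ?thesis using a bounds[of a] by (intro exI[of _ "p a"]) auto
  qed
  then obtain \<rho> where \<rho>: "0 \<le> \<rho>" "\<rho> < 1" "\<And>x. x \<in> ?T \<Longrightarrow> p x \<le> \<rho>" by blast
  obtain n where n: "\<rho> ^ n < \<eta> / (G + 1)"
    using real_arch_pow_inv[OF _ \<rho>(2), of "\<eta> / (G + 1)"] \<eta> G(1) by auto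
  have "0 < p x ^ k * g x + \<eta>" if k: "n \<le> k" and x: "x \<in> std_simplex" for k x
  proof (cases "g x \<le> 0")
    case True
    have "p x ^ k \<le> \<rho> ^ k" using bounds[OF x] \<rho>(3) x True by (intro power_mono) auto
    also have "\<dots> \<le> \<rho> ^ n" using \<rho> k by (intro power_decreasing) auto
    finally have "p x ^ k < \<eta> / (G + 1)" using n by simp
    then have "p x ^ k * (G + 1) < \<eta>" using G(1) by (simp add: pos_less_divide_eq)
    moreover have "p x ^ k * - g x \<le> p x ^ k * (G + 1)"
      using G(2)[OF x] bounds[OF x] by (intro mult_left_mono) auto
    ultimately show ?thesis by simp
  next
    case False
    then have "0 \<le> p x ^ k * g x" using bounds[OF x] by auto
    then show ?thesis using \<eta> by simp
  qed
  then show ?thesis unfolding eventually_sequentially by blast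
qed

lemma lagrange_identity:
  fixes a d :: "'i \<Rightarrow> real"
  shows "(\<Sum>j\<in>I. \<Sum>k\<in>I. (a j * d k - a k * d j)\<^sup>2) =
    2 * ((\<Sum>j\<in>I. (a j)\<^sup>2) * (\<Sum>j\<in>I. (d j)\<^sup>2) - (\<Sum>j\<in>I. a j * d j)\<^sup>2)"
proof -
  have "(\<Sum>j\<in>I. \<Sum>k\<in>I. (a j * d k - a k * d j)\<^sup>2) =
      (\<Sum>j\<in>I. \<Sum>k\<in>I. (a j)\<^sup>2 * (d k)\<^sup>2) + (\<Sum>j\<in>I. \<Sum>k\<in>I. (d j)\<^sup>2 * (a k)\<^sup>2)
      - 2 * (\<Sum>j\<in>I. \<Sum>k\<in>I. (a j * d j) * (a k * d k))"
    by (simp add: power2_eq_square algebra_simps sum.distrib sum_subtractf sum_distrib_left)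
  then show ?thesis
    by (simp only: sum_product[symmetric] power2_eq_square) (simp add: algebra_simps)
qed

context weighted_graph
begin

lemma rpf_form: "rpf form"
proof -
  have "form = (\<lambda>x. \<Sum>i\<in>UNIV. x $ i * (\<Sum>j\<in>UNIV. B $ i $ j * x $ j))"
    by (auto simp: form_def inner_vec_def matrix_vector_mult_def)
  moreover have "rpf \<dots>" by (intro rpf_intros) auto
  ultimately show ?thesis by simp
qed

definition outside :: "'n set \<Rightarrow> real ^ 'n \<Rightarrow> real" where
  "outside S x = (\<Sum>i\<in>-S. x $ i)"

lemma rpf_outside: "rpf (outside S)"
  unfolding outside_def[abs_def] by (intro rpf_intros) auto

text \<open>
  By the inequality of arithmetic and geometric means this product is at most 1 on the simplex.
\<close>
definition bump :: "'n set \<Rightarrow> real ^ 'n \<Rightarrow> real" where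
  "bump S x = (\<Prod>i\<in>S. alpha * x $ i)"

lemma rpf_bump: "rpf (bump S)"
  unfolding bump_def[abs_def] by (intro rpf_intros) auto

lemma maximum_stable_setD:
  assumes "S \<in> maximum_stable_sets E"
  shows "stable E S" "real (card S) = alpha" "S \<noteq> {}" "barycentre S \<in> std_simplex"
proof -
  show "stable E S" and c: "real (card S) = alpha" using assms by (auto simp: maximum_stable_sets_def)
  show "S \<noteq> {}" using c alpha_pos by auto
  then show "barycentre S \<in> std_simplex" by (rule barycentre_in_simplex)
qed

text \<open>
  The upper bound and its equality case come from \<open>t \<le> exp (t - 1)\<close> for the factors \<open>t = \<alpha> x\<^sub>i\<close>, whose sum over \<open>S\<close> is at most
  \<open>\<alpha>\<close>, the number of factors; equality holds only for \<open>t = 1\<close>.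
\<close>
lemma bump_bounds:
  assumes S: "S \<in> maximum_stable_sets E" and x: "x \<in> std_simplex"
  shows "0 \<le> bump S x" "bump S x \<le> 1" "bump S x = 1 \<Longrightarrow> x = barycentre S"
proof -
  have nonneg: "0 \<le> alpha * x $ i" for i using x by (simp add: std_simplex_def)
  have split: "(\<Sum>i\<in>S. x $ i) + (\<Sum>i\<in>-S. x $ i) = 1"
    using x sum.union_disjoint[of S "-S" "($) x"] by (simp add: std_simplex_def)
  have out: "0 \<le> (\<Sum>i\<in>-S. x $ i)" using x by (intro sum_nonneg) (simp add: std_simplex_def)
  have excess: "(\<Sum>i\<in>S. alpha * x $ i - 1) \<le> 0"
  proof -
    have "alpha * (\<Sum>i\<in>S. x $ i) \<le> alpha * 1"
      using split out alpha_pos by (intro mult_left_mono) auto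
    then show ?thesis
      using maximum_stable_setD(2)[OF S] by (simp add: sum_subtractf sum_distrib_left)
  qed
  show "0 \<le> bump S x" unfolding bump_def using nonneg by (intro prod_nonneg) auto
  have "bump S x \<le> (\<Prod>i\<in>S. exp (alpha * x $ i - 1))"
    unfolding bump_def
  proof (intro prod_mono conjI nonneg)
    show "alpha * x $ i \<le> exp (alpha * x $ i - 1)" for i
      using exp_ge_add_one_self[of "alpha * x $ i - 1"] by simp
  qed
  also have "\<dots> = exp (\<Sum>i\<in>S. alpha * x $ i - 1)" by (simp add: exp_sum)
  also have "\<dots> \<le> 1" using excess by simp
  finally show "bump S x \<le> 1" .
  assume one: "bump S x = 1"
  have pos: "0 < alpha * x $ i" if "i \<in> S" for i
  proof -
    have "alpha * x $ i \<noteq> 0"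
    proof
      assume "alpha * x $ i = 0"
      then have "bump S x = 0"
        unfolding bump_def using that by (intro prod_zero) auto
      with one show False by simp
    qed
    then show ?thesis using nonneg[of i] by linarith
  qed
  have "(\<Sum>i\<in>S. ln (alpha * x $ i)) = ln (bump S x)"
    unfolding bump_def by (intro ln_prod[symmetric] finite) (use pos in \<open>metis less_irrefl\<close>)
  then have "(\<Sum>i\<in>S. alpha * x $ i - 1 - ln (alpha * x $ i)) \<le> 0"
    using excess one by (simp add: sum_subtractf)
  moreover have "0 \<le> alpha * x $ i - 1 - ln (alpha * x $ i)" if "i \<in> S" for i
    using ln_le_minus_one[OF pos[OF that]] by simp
  ultimately have "\<forall>i\<in>S. alpha * x $ i - 1 - ln (alpha * x $ i) = 0"
    by (metis (no_types, lifting) finite order_antisym sum_nonneg sum_nonneg_eq_0_iff)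
  then have in_S: "x $ i = 1 / real (card S)" if "i \<in> S" for i
    using ln_eq_minus_one[OF pos[OF that]] that alpha_pos maximum_stable_setD(2)[OF S]
    by (auto simp: field_simps)
  then have "(\<Sum>i\<in>S. x $ i) = 1"
    using maximum_stable_setD(3)[OF S] by (simp add: card_gt_0_iff)
  then have "(\<Sum>i\<in>-S. x $ i) = 0" using split by simp
  then have "\<forall>i\<in>-S. x $ i = 0"
    by (subst (asm) sum_nonneg_eq_0_iff) (use x in \<open>auto simp: std_simplex_def\<close>)
  then show "x = barycentre S" using in_S by (auto simp: barycentre_def vec_eq_iff)
qed

lemma bump_barycentre:
  assumes S: "S \<in> maximum_stable_sets E" and T: "T \<in> maximum_stable_sets E"
  shows "bump T (barycentre S) = (if T = S then 1 else 0)"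
proof (cases "T = S")
  case True
  then show ?thesis
    using maximum_stable_setD(2)[OF S] alpha_pos by (simp add: bump_def barycentre_def)
next
  case False
  have "\<not> T \<subseteq> S"
    using False card_subset_eq[of S T] S T by (auto simp: maximum_stable_sets_def)
  then obtain i where "i \<in> T" "i \<notin> S" by blast
  then have "bump T (barycentre S) = 0"
    unfolding bump_def by (intro prod_zero) (auto simp: barycentre_def intro!: bexI[of _ i])
  then show ?thesis using False by simp
qed

text \<open>
  A sum of squares of polynomials that vanish at all minimizers. It serves as the unit in which the errors of
  the gluing are measured, so both its terms are chosen to match errors that occur there.
\<close>
definition slack :: "real ^ 'n \<Rightarrow> real" where
  "slack x = (\<Sum>S\<in>maximum_stable_sets E. (bump S x)\<^sup>2 * sqdist (barycentre S) x)
    + (1 - (\<Sum>S\<in>maximum_stable_sets E. (bump S x)\<^sup>2))\<^sup>2"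

lemma rpf_slack: "rpf slack"
  unfolding slack_def[abs_def] by (intro rpf_intros rpf_bump rpf_sqdist) auto

lemma slack_in_quad_module: "slack \<in> quad_module"
  unfolding slack_def[abs_def]
  by (intro quad_module.add quad_module_sum quad_module_mult_square sqdist_in_quad_module
      quad_module.square rpf_intros rpf_bump) auto

lemma slack_dominated:
  assumes S: "S \<in> maximum_stable_sets E"
  shows "dominated slack (sqdist (barycentre S))"
  unfolding slack_def[abs_def]
proof (intro dominated_add dominated_sum)
  note z = maximum_stable_setD(4)[OF S]
  show "dominated (\<lambda>x. (1 - (\<Sum>T\<in>maximum_stable_sets E. (bump T x)\<^sup>2))\<^sup>2) (sqdist (barycentre S))"
  proof (rule dominated_vanishing_square[OF _ z])
    have "(\<Sum>T\<in>maximum_stable_sets E. (bump T (barycentre S))\<^sup>2) =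
        (\<Sum>T\<in>maximum_stable_sets E. if T = S then 1 else 0)"
      by (intro sum.cong) (auto simp: bump_barycentre[OF S])
    then show "1 - (\<Sum>T\<in>maximum_stable_sets E. (bump T (barycentre S))\<^sup>2) = 0"
      using S by simp
  qed (intro rpf_intros rpf_bump, simp)
  fix T assume T: "T \<in> maximum_stable_sets E"
  have "dominated (\<lambda>x. \<Sum>i\<in>UNIV. (bump T x * (x $ i - barycentre T $ i))\<^sup>2) (sqdist (barycentre S))"
    by (intro dominated_sum dominated_vanishing_square[OF _ z] rpf_intros rpf_bump)
      (auto simp: bump_barycentre[OF S T])
  then show "dominated (\<lambda>x. (bump T x)\<^sup>2 * sqdist (barycentre T) x) (sqdist (barycentre S))"
    by (simp add: sqdist_def power_mult_distrib sum_distrib_left)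
qed

text \<open>
  Raising the exponents changes \<open>1 - \<Sum>S. p\<^sub>S\<^sup>2\<close> by multiples of \<open>p\<^sub>S\<close> whose cofactors vanish at
  \<open>z\<^sub>S\<close>; the first term of \<open>slack\<close> controls their squares.
\<close>
lemma one_minus_bumps_dominated:
  "dominated (\<lambda>x. (1 - (\<Sum>S\<in>maximum_stable_sets E. (bump S x) ^ (2 * k + 2)))\<^sup>2) slack"
proof -
  let ?M = "maximum_stable_sets E"
  have part: "dominated (\<lambda>x. (1 - (\<Sum>S\<in>?M. (bump S x)\<^sup>2))\<^sup>2) slack"
    unfolding dominated_def
  proof (intro exI[of _ 1] conjI)
    have "(\<lambda>x. \<Sum>S\<in>?M. (bump S x)\<^sup>2 * sqdist (barycentre S) x) \<in> quad_module"
      by (intro quad_module_sum quad_module_mult_square sqdist_in_quad_module rpf_bump)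
    then show "(\<lambda>x. 1 * slack x - (1 - (\<Sum>S\<in>?M. (bump S x)\<^sup>2))\<^sup>2) \<in> quad_module"
      by (simp add: slack_def)
  qed simp
  have dist: "dominated (\<lambda>x. (bump S x)\<^sup>2 * sqdist (barycentre S) x) slack" if S: "S \<in> ?M" for S
    unfolding dominated_def
  proof (intro exI[of _ 1] conjI)
    have "(\<lambda>x. (\<Sum>T\<in>?M - {S}. (bump T x)\<^sup>2 * sqdist (barycentre T) x)
        + (1 - (\<Sum>S\<in>?M. (bump S x)\<^sup>2))\<^sup>2) \<in> quad_module"
      by (intro quad_module.add quad_module_sum quad_module_mult_square sqdist_in_quad_module
          quad_module.square rpf_intros rpf_bump) auto
    then show "(\<lambda>x. 1 * slack x - (bump S x)\<^sup>2 * sqdist (barycentre S) x) \<in> quad_module"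
      by (simp add: slack_def sum.remove[of ?M S, OF _ S])
  qed simp
  let ?r = "\<lambda>S x. bump S x * (bump S x * (1 - bump S x ^ (2 * k)))"
  have "dominated (\<lambda>x. (?r S x)\<^sup>2) slack" if S: "S \<in> ?M" for S
  proof -
    have "dominated (\<lambda>x. (bump S x * (1 - bump S x ^ (2 * k)))\<^sup>2) (sqdist (barycentre S))"
      by (intro dominated_vanishing_square maximum_stable_setD(4)[OF S] rpf_intros rpf_bump)
        (simp add: bump_barycentre[OF S S])
    from dominated_mult_square[OF this rpf_bump[of S]]
    have "dominated (\<lambda>x. (?r S x)\<^sup>2) (\<lambda>x. (bump S x)\<^sup>2 * sqdist (barycentre S) x)"
      by (simp add: power_mult_distrib)
    from dominated_trans[OF this dist[OF S]] show ?thesis .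
  qed
  then have "dominated (\<lambda>x. (\<Sum>S\<in>?M. ?r S x)\<^sup>2) slack"
    by (intro dominated_square_sum rpf_intros rpf_bump)
  then have "dominated (\<lambda>x. (1 - (\<Sum>S\<in>?M. (bump S x)\<^sup>2) + (\<Sum>S\<in>?M. ?r S x))\<^sup>2) slack"
    by (intro dominated_square_add part rpf_intros rpf_bump) auto
  moreover have "1 - (\<Sum>S\<in>?M. (bump S x)\<^sup>2) + (\<Sum>S\<in>?M. ?r S x) =
      1 - (\<Sum>S\<in>?M. (bump S x) ^ (2 * k + 2))" for x
    by (simp add: sum_subtractf algebra_simps power_add power2_eq_square)
  ultimately show ?thesis by simp
qed

text \<open>
  The product of two different bumps stays below a constant less than 1, so for large \<open>k\<close> the square of
  the sum exceeds the sum of the squares by at most 1; with \<open>p\<^sub>S \<le> 1\<close> this gives \<open>u\<^sup>2 \<le> u + 1\<close>.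
\<close>
lemma eventually_bump_sum_less_4:
  "eventually (\<lambda>k. \<forall>x\<in>std_simplex. (\<Sum>S\<in>maximum_stable_sets E. bump S x ^ k) < 4) sequentially"
proof -
  let ?M = "maximum_stable_sets E"
  let ?m = "real (card ?M)"
  have m: "0 < ?m"
    using ex_maximum_stable[of E] by (auto simp: card_gt_0_iff maximum_stable_sets_def)
  have pair: "eventually (\<lambda>k. \<forall>x\<in>std_simplex. S \<noteq> T \<longrightarrow> (bump S x * bump T x) ^ k < 1 / ?m\<^sup>2) sequentially"
    if S: "S \<in> ?M" and T: "T \<in> ?M" for S T
  proof (cases "S = T")
    case False
    have "eventually (\<lambda>k. \<forall>x\<in>std_simplex. 0 < (bump S x * bump T x) ^ k * (- 1) + 1 / ?m\<^sup>2) sequentially"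
    proof (rule eventually_power_mult_positive)
      show "0 \<le> bump S x * bump T x \<and> bump S x * bump T x \<le> 1" if "x \<in> std_simplex" for x
        using bump_bounds[OF S that] bump_bounds[OF T that] by (simp add: mult_le_one)
      show "0 < (- 1 :: real)" if x: "x \<in> std_simplex" and eq: "bump S x * bump T x = 1" for x
      proof -
        have "bump S x = 1" "bump T x = 1"
          using eq bump_bounds(1,2)[OF S x] bump_bounds(1,2)[OF T x]
          by (metis mult.commute mult_left_le mult_1 order_antisym)+
        then have "barycentre S = barycentre T"
          using bump_bounds(3)[OF S x] bump_bounds(3)[OF T x] by simp
        then show ?thesis
          using bump_barycentre[OF S S] bump_barycentre[OF T S] False by simp
      qed
    qed (use m in \<open>auto intro!: rpf_intros rpf_bump\<close>)
    then show ?thesis by (rule eventually_mono) auto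
  qed auto
  then have "eventually (\<lambda>k. \<forall>S\<in>?M. \<forall>T\<in>?M. \<forall>x\<in>std_simplex. S \<noteq> T \<longrightarrow> (bump S x * bump T x) ^ k < 1 / ?m\<^sup>2)
      sequentially"
    by (intro eventually_ball_finite[OF finite[of ?M]] ballI pair)
  then show ?thesis
  proof (rule eventually_mono, intro ballI)
    fix k and x :: "real ^ 'n"
    assume small: "\<forall>S\<in>?M. \<forall>T\<in>?M. \<forall>x\<in>std_simplex. S \<noteq> T \<longrightarrow> (bump S x * bump T x) ^ k < 1 / ?m\<^sup>2"
      and x: "x \<in> std_simplex"
    let ?u = "\<Sum>S\<in>?M. bump S x ^ k"
    have b: "0 \<le> bump S x ^ k" "bump S x ^ k \<le> 1" if "S \<in> ?M" for S
      using bump_bounds[OF that x] by (auto intro: power_le_one)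
    have "?u * ?u = (\<Sum>S\<in>?M. \<Sum>T\<in>?M. (bump S x * bump T x) ^ k)"
      by (simp add: sum_product power_mult_distrib)
    also have "\<dots> \<le> (\<Sum>S\<in>?M. \<Sum>T\<in>?M. (if T = S then bump S x ^ k else 0) + 1 / ?m\<^sup>2)"
    proof (intro sum_mono)
      fix S T assume ST: "S \<in> ?M" "T \<in> ?M"
      show "(bump S x * bump T x) ^ k \<le> (if T = S then bump S x ^ k else 0) + 1 / ?m\<^sup>2"
      proof (cases "T = S")
        case True
        have "(bump S x * bump S x) ^ k \<le> bump S x ^ k"
          using b[OF ST(1)] by (simp add: power_mult_distrib mult_left_le)
        moreover have "0 \<le> 1 / ?m\<^sup>2" by simp
        ultimately show ?thesis using True by (simp only: if_True simp_thms)
      next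
        case False
        then show ?thesis using small ST x by (simp add: less_imp_le)
      qed
    qed
    also have "\<dots> = ?u + 1" using m by (auto simp: sum.distrib power2_eq_square)
    finally have "?u * ?u \<le> ?u + 1" .
    show "?u < 4"
    proof (rule ccontr)
      assume "\<not> ?u < 4"
      then have "4 * ?u \<le> ?u * ?u" by (intro mult_right_mono) auto
      with \<open>?u * ?u \<le> ?u + 1\<close> \<open>\<not> ?u < 4\<close> show False by linarith
    qed
  qed
qed

end

context strict_weighted_graph
begin

text \<open>
  In the expansion at \<open>z\<^sub>S\<close>, the factor of \<open>x\<^sub>i\<close> is \<open>c\<^sub>i + \<mu>\<^sub>i\<close> with a constant \<open>c\<^sub>i > 0\<close> and a linear form \<open>\<mu>\<^sub>i\<close>
  in \<open>x - z\<^sub>S\<close>. Completing the square, \<open>c + \<mu> = (c + \<mu>/2)\<^sup>2 / c - \<mu>\<^sup>2 / (4 c)\<close>. The first term is a square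
  times \<open>x\<^sub>i\<close>. The second is bounded by a multiple of \<open>\<bar>x - z\<^sub>S\<bar>\<^sup>2\<close>; Lagrange's identity provides this
  Cauchy-Schwarz bound as a sum of squares, which may be multiplied by \<open>x\<^sub>i\<close> as well.
\<close>
lemma local_certificate:
  assumes S: "S \<in> maximum_stable_sets E"
  shows "eventually (\<lambda>C. (\<lambda>x. form x - 1 / alpha - sqdist (barycentre S) x * (1 - C * outside S x))
    \<in> quad_module) at_top"
proof -
  let ?z = "barycentre S"
  define c where "c i = 2 * ((\<Sum>j\<in>S. B $ i $ j) - 1) / alpha" for i
  define a where "a i j = B $ i $ j + (if j \<in> S then B $ i $ j else 0) - (if j = i then 1 else 0)" for i j
  have c: "0 < c i" if "i \<in> -S" for i
    using neighbour_weight_gt_1[OF S, of i] that alpha_pos by (simp add: c_def)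
  define \<mu> where "\<mu> i x = (\<Sum>j\<in>UNIV. a i j * (x $ j - ?z $ j))" for i x
  define A where "A i = (\<Sum>j\<in>UNIV. (a i j)\<^sup>2)" for i
  define C0 where "C0 = (\<Sum>i\<in>-S. A i / (4 * c i))"
  have "(\<lambda>x. form x - 1 / alpha - sqdist ?z x * (1 - C * outside S x)) \<in> quad_module"
    if "C0 \<le> C" for C
  proof -
    have C: "A i / (4 * c i) \<le> C" if "i \<in> -S" for i
    proof -
      have "A i / (4 * c i) \<le> C0" unfolding C0_def
        using that c by (intro member_le_sum) (auto simp: A_def sum_nonneg less_imp_le)
      then show ?thesis using \<open>C0 \<le> C\<close> by simp
    qed
    define m where "m i x = 1 / c i * (x $ i * (c i + \<mu> i x / 2)\<^sup>2)
      + (C - A i / (4 * c i)) * (\<Sum>j\<in>UNIV. x $ i * (x $ j - ?z $ j)\<^sup>2)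
      + 1 / (8 * c i) * (\<Sum>j\<in>UNIV. \<Sum>k\<in>UNIV.
          x $ i * (a i j * (x $ k - ?z $ k) - a i k * (x $ j - ?z $ j))\<^sup>2)" for i x
    have m_in: "(\<lambda>x. \<Sum>i\<in>-S. m i x) \<in> quad_module"
    proof (rule quad_module_sum)
      fix i assume i: "i \<in> -S"
      have "rpf (\<mu> i)" unfolding \<mu>_def[abs_def] by (intro rpf_intros) auto
      then show "m i \<in> quad_module"
        unfolding m_def[abs_def] using c[OF i] C[OF i]
        by (intro quad_module.add quad_module_scale quad_module_sum quad_module.coord_square rpf_intros)
          auto
    qed
    show ?thesis
    proof (rule quad_module.cong[OF m_in])
      fix x :: "real ^ 'n" assume x: "(\<Sum>i\<in>UNIV. x $ i) = 1"
      have m: "m i x = x $ i * (c i + \<mu> i x) + C * x $ i * sqdist ?z x" if i: "i \<in> -S" for i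
      proof -
        have 1: "(\<Sum>j\<in>UNIV. x $ i * (x $ j - ?z $ j)\<^sup>2) = x $ i * sqdist ?z x"
          by (simp add: sqdist_def sum_distrib_left)
        have 2: "(\<Sum>j\<in>UNIV. \<Sum>k\<in>UNIV.
            x $ i * (a i j * (x $ k - ?z $ k) - a i k * (x $ j - ?z $ j))\<^sup>2)
            = x $ i * (2 * (A i * sqdist ?z x - (\<mu> i x)\<^sup>2))"
          unfolding sum_distrib_left[symmetric] lagrange_identity A_def \<mu>_def sqdist_def ..
        show ?thesis
          unfolding m_def 1 2 using c[OF i] by (simp add: field_simps power2_eq_square)
      qed
      have "form x - 1 / alpha = sqdist ?z x + (\<Sum>i\<in>-S. x $ i * (c i + \<mu> i x))"
        using form_expansion[OF S x] by (simp add: c_def \<mu>_def a_def)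
      moreover have "(\<Sum>i\<in>-S. m i x) = (\<Sum>i\<in>-S. x $ i * (c i + \<mu> i x)) + C * outside S x * sqdist ?z x"
        by (simp add: m sum.distrib outside_def sum_distrib_left sum_distrib_right)
      ultimately show "form x - 1 / alpha - sqdist ?z x * (1 - C * outside S x) = (\<Sum>i\<in>-S. m i x)"
        by (simp add: algebra_simps)
    qed
  qed
  then show ?thesis by (auto simp: eventually_at_top_linorder)
qed

text \<open>
  The gluing argument. Constants are fixed in the order \<open>C\<close>, \<open>C1\<close>, \<open>\<epsilon>\<close>, \<open>\<eta>\<close>, \<open>k\<close>, \<open>C2\<close>, \<open>\<eta>\<^sub>2\<close>: the exponent
  \<open>k\<close> depends on the error \<open>\<eta>\<close> allowed near the minimizers, and the bound \<open>C2\<close> of \<open>(1 - u)\<^sup>2\<close> by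
  \<open>slack\<close> depends on \<open>k\<close>, but the error \<open>\<eta>\<^sub>2\<close> that it multiplies may be chosen afterwards.
\<close>
theorem form_in_quad_module: "(\<lambda>x. form x - 1 / alpha) \<in> quad_module"
proof -
  let ?M = "maximum_stable_sets E"
  let ?D = "\<lambda>S. sqdist (barycentre S)"
  define F where "F x = form x - 1 / alpha" for x
  have rpf_F: "rpf F" unfolding F_def[abs_def] by (intro rpf_intros rpf_form)
  have F_nonneg: "0 \<le> F x" if "x \<in> std_simplex" for x
    using motzkin_straus(1)[OF that] by (simp add: F_def)
  obtain C where C: "\<And>S. S \<in> ?M \<Longrightarrow> (\<lambda>x. F x - ?D S x * (1 - C * outside S x)) \<in> quad_module"
  proof -
    have "eventually (\<lambda>C. \<forall>S\<in>?M. (\<lambda>x. F x - ?D S x * (1 - C * outside S x)) \<in> quad_module) at_top"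
      unfolding F_def using local_certificate by (intro eventually_ball_finite) auto
    then show thesis using that unfolding eventually_at_top_linorder by blast
  qed
  obtain C1 where C1: "0 < C1" "\<And>S. S \<in> ?M \<Longrightarrow> (\<lambda>x. C1 * ?D S x - slack x) \<in> quad_module"
  proof -
    have "eventually (\<lambda>C. \<forall>S\<in>?M. (\<lambda>x. C * ?D S x - slack x) \<in> quad_module) at_top"
      using dominated_eventually[OF slack_dominated sqdist_in_quad_module]
      by (intro eventually_ball_finite) auto
    then have "eventually (\<lambda>C. 0 < C \<and> (\<forall>S\<in>?M. (\<lambda>x. C * ?D S x - slack x) \<in> quad_module)) at_top"
      by (intro eventually_conj eventually_gt_at_top)
    then show thesis using that unfolding eventually_at_top_linorder by blast
  qed
  have dist_nonneg: "0 \<le> ?D S x" for S x by (simp add: sqdist_def sum_nonneg)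
  \<comment> \<open>Where no local certificate is useful, \<open>f\<close> exceeds its minimum by a fixed amount.\<close>
  obtain \<delta> where \<delta>: "0 < \<delta>"
    "\<And>x. x \<in> std_simplex \<Longrightarrow> (\<And>S. S \<in> ?M \<Longrightarrow> 1 / 2 \<le> C * outside S x) \<Longrightarrow> \<delta> \<le> F x"
  proof -
    let ?K = "std_simplex \<inter> (\<Inter>S\<in>?M. {x. 1 / 2 \<le> C * outside S x})"
    have "compact ?K"
      by (intro compact_Int_closed compact_std_simplex closed_INT ballI closed_Collect_le
          continuous_intros rpf_continuous_on rpf_outside)
    have "\<exists>\<delta>>0. \<forall>x\<in>?K. \<delta> \<le> F x"
    proof (cases "?K = {}")
      case True
      then show ?thesis by (intro exI[of _ 1]) (simp del: Int_iff)
    next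
      case False
      then obtain a where a: "a \<in> ?K" "\<And>x. x \<in> ?K \<Longrightarrow> F a \<le> F x"
        using continuous_attains_inf[OF \<open>compact ?K\<close> _ rpf_continuous_on[OF rpf_F]] by blast
      have "F a \<noteq> 0"
      proof
        assume "F a = 0"
        then obtain S where S: "S \<in> ?M" "a = barycentre S"
          using motzkin_straus(2)[of a] a(1) by (auto simp: F_def)
        then have "outside S a = 0" by (simp add: outside_def barycentre_def)
        moreover have "1 / 2 \<le> C * outside S a" using a(1) S(1) by blast
        ultimately show False by simp
      qed
      then have "0 < F a" using F_nonneg[of a] a(1) by auto
      then show ?thesis using a(2) by blast
    qed
    then obtain \<delta> where "0 < \<delta>" "\<forall>x\<in>?K. \<delta> \<le> F x" by blast
    then show thesis by (intro that[of \<delta>]) auto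
  qed
  obtain G where G: "0 \<le> G" "\<And>x. x \<in> std_simplex \<Longrightarrow> \<bar>slack x\<bar> \<le> G"
    using rpf_bounded_on_simplex[OF rpf_slack] by blast
  define \<epsilon> where "\<epsilon> = min (\<delta> / (G + 1)) (1 / (2 * C1))"
  have \<epsilon>: "0 < \<epsilon>" "\<epsilon> * G \<le> \<delta>" "\<epsilon> * C1 \<le> 1 / 2"
  proof -
    show "0 < \<epsilon>" using \<delta>(1) G(1) C1(1) by (simp add: \<epsilon>_def)
    then have "\<epsilon> * G \<le> \<epsilon> * (G + 1)" by simp
    also have "\<dots> \<le> \<delta> / (G + 1) * (G + 1)"
      using G(1) by (intro mult_right_mono) (auto simp: \<epsilon>_def)
    finally show "\<epsilon> * G \<le> \<delta>" using G(1) by simp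
    have "\<epsilon> * C1 \<le> 1 / (2 * C1) * C1"
      using C1(1) by (intro mult_right_mono) (auto simp: \<epsilon>_def)
    then show "\<epsilon> * C1 \<le> 1 / 2" using C1(1) by simp
  qed
  \<comment> \<open>Half of the local bound pays for the slack, so \<open>F\<^sub>\<epsilon>\<close> is still nonnegative on the simplex and has
    local certificates with \<open>1/2\<close> in place of \<open>1\<close>.\<close>
  define F\<^sub>\<epsilon> where "F\<^sub>\<epsilon> x = F x - \<epsilon> * slack x" for x
  have rpf_F\<epsilon>: "rpf F\<^sub>\<epsilon>" unfolding F\<^sub>\<epsilon>_def[abs_def] by (intro rpf_intros rpf_F rpf_slack)
  have local: "(\<lambda>x. F\<^sub>\<epsilon> x - ?D S x * (1 / 2 - C * outside S x)) \<in> quad_module" if S: "S \<in> ?M" for S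
  proof -
    have "(\<lambda>x. (F x - ?D S x * (1 - C * outside S x)) + (\<epsilon> * (C1 * ?D S x - slack x)
        + (1 / 2 - \<epsilon> * C1) * ?D S x)) \<in> quad_module"
      using \<epsilon> by (intro quad_module.add C C1 S quad_module_scale sqdist_in_quad_module) auto
    then show ?thesis by (rule quad_module.cong) (simp add: F\<^sub>\<epsilon>_def algebra_simps)
  qed
  have F\<epsilon>_nonneg: "0 \<le> F\<^sub>\<epsilon> x" if x: "x \<in> std_simplex" for x
  proof (cases "\<forall>S\<in>?M. 1 / 2 \<le> C * outside S x")
    case True
    then have "\<delta> \<le> F x" using \<delta>(2)[OF x] by blast
    moreover have "\<epsilon> * slack x \<le> \<epsilon> * G" using G(2)[OF x] \<epsilon>(1) by (intro mult_left_mono) auto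
    ultimately show ?thesis using \<epsilon>(2) by (simp add: F\<^sub>\<epsilon>_def)
  next
    case False
    then obtain S where S: "S \<in> ?M" "C * outside S x < 1 / 2" by auto
    then have "0 \<le> ?D S x * (1 / 2 - C * outside S x)"
      using dist_nonneg by (intro mult_nonneg_nonneg) auto
    with quad_module_nonneg[OF local[OF S(1)] x] show ?thesis by simp
  qed
  \<comment> \<open>The near part costs \<open>3 \<eta>\<close> times the slack, that is, half of \<open>\<epsilon>\<close>.\<close>
  define \<eta> where "\<eta> = \<epsilon> / 6"
  have \<eta>: "0 < \<eta>" using \<epsilon>(1) by (simp add: \<eta>_def)
  obtain k where k: "\<And>S x. S \<in> ?M \<Longrightarrow> x \<in> std_simplex \<Longrightarrow>
      0 < ((bump S x)\<^sup>2) ^ k * (1 / 2 - C * outside S x) + \<eta>"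
    and u4: "\<And>x. x \<in> std_simplex \<Longrightarrow> (\<Sum>S\<in>?M. bump S x ^ (2 * k + 2)) < 4"
  proof -
    have "eventually (\<lambda>k. \<forall>S\<in>?M. \<forall>x\<in>std_simplex.
        0 < ((bump S x)\<^sup>2) ^ k * (1 / 2 - C * outside S x) + \<eta>) sequentially"
    proof (intro eventually_ball_finite[OF finite[of ?M]] ballI eventually_power_mult_positive \<eta>)
      fix S and x :: "real ^ 'n"
      assume S: "S \<in> ?M" and x: "x \<in> std_simplex"
      show "0 \<le> (bump S x)\<^sup>2 \<and> (bump S x)\<^sup>2 \<le> 1"
        using bump_bounds[OF S x] by (simp add: power_le_one)
      assume "(bump S x)\<^sup>2 = 1"
      then have "x = barycentre S"
        using bump_bounds[OF S x] by (auto simp: power2_eq_1_iff)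
      then show "0 < 1 / 2 - C * outside S x" by (simp add: outside_def barycentre_def)
    qed (auto intro!: rpf_intros rpf_bump rpf_outside)
    moreover have "eventually (\<lambda>k. \<forall>x\<in>std_simplex. (\<Sum>S\<in>?M. bump S x ^ (2 * k + 2)) < 4) sequentially"
    proof -
      have "filterlim (\<lambda>k::nat. 2 * k + 2) sequentially sequentially"
        by (rule filterlim_subseq) (auto simp: strict_mono_def)
      from eventually_compose_filterlim[OF eventually_bump_sum_less_4 this] show ?thesis .
    qed
    ultimately have "eventually (\<lambda>k. (\<forall>S\<in>?M. \<forall>x\<in>std_simplex.
        0 < ((bump S x)\<^sup>2) ^ k * (1 / 2 - C * outside S x) + \<eta>) \<and>
        (\<forall>x\<in>std_simplex. (\<Sum>S\<in>?M. bump S x ^ (2 * k + 2)) < 4)) sequentially"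
      by (rule eventually_conj)
    then show thesis using that unfolding eventually_sequentially by blast
  qed
  define u where "u x = (\<Sum>S\<in>?M. bump S x ^ (2 * k + 2))" for x
  define a where "a x = (3 - u x) / 2" for x
  have rpf_u: "rpf u" unfolding u_def[abs_def] by (intro rpf_intros rpf_bump) auto
  have rpf_a: "rpf a" unfolding a_def[abs_def] by (intro rpf_intros rpf_u)
  have u: "0 \<le> u x" "u x < 4" if "x \<in> std_simplex" for x
    using u4[OF that] bump_bounds(1)[OF _ that] by (auto simp: u_def intro!: sum_nonneg)
  have a3: "0 < 3 - (a x)\<^sup>2" if "x \<in> std_simplex" for x
  proof -
    have "\<bar>a x\<bar> \<le> 3 / 2" using u[OF that] by (auto simp: a_def)
    then have "(a x)\<^sup>2 \<le> (3 / 2)\<^sup>2" by (metis abs_ge_zero power2_abs power_mono)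
    then show ?thesis by (simp add: power2_eq_square)
  qed
  have near: "(\<lambda>x. (a x)\<^sup>2 * bump S x ^ (2 * k + 2) * F\<^sub>\<epsilon> x + 3 * \<eta> * ((bump S x)\<^sup>2 * ?D S x)) \<in> quad_module"
    if S: "S \<in> ?M" for S
  proof -
    have "(\<lambda>x. ((bump S x)\<^sup>2) ^ k * (1 / 2 - C * outside S x) + \<eta>) \<in> quad_module"
      using k[OF S] by (intro positive_imp_quad_module rpf_intros rpf_bump rpf_outside) auto
    then have 1: "(\<lambda>x. (a x * bump S x)\<^sup>2 * ?D S x *
        (((bump S x)\<^sup>2) ^ k * (1 / 2 - C * outside S x) + \<eta>)) \<in> quad_module"
      by (rule quad_module_sqdist_mult) (intro rpf_intros rpf_a rpf_bump)
    have "(\<lambda>x. 3 - (a x)\<^sup>2) \<in> quad_module"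
      using a3 by (intro positive_imp_quad_module rpf_intros rpf_a)
    then have 2: "(\<lambda>x. \<eta> * ((bump S x)\<^sup>2 * ?D S x * (3 - (a x)\<^sup>2))) \<in> quad_module"
      using \<eta> by (intro quad_module_scale quad_module_sqdist_mult rpf_bump) auto
    have 3: "(\<lambda>x. (a x * (bump S x * bump S x ^ k))\<^sup>2 *
        (F\<^sub>\<epsilon> x - ?D S x * (1 / 2 - C * outside S x))) \<in> quad_module"
      by (intro quad_module_mult_square local S rpf_intros rpf_a rpf_bump)
    from quad_module.add[OF 3 quad_module.add[OF 1 2]]
    show ?thesis
    proof (rule quad_module.cong)
      fix x :: "real ^ 'n"
      have regroup: "A * X * f + 3 * h * (b * D) = A * X * (f - D * m) + (A * b * D * (q * m + h)
          + h * (b * D * (3 - A)))" if "q * b = X" for A X f h b D m q :: real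
        unfolding that[symmetric] by (simp add: algebra_simps)
      have "bump S x ^ (2 * k + 2) = (bump S x * bump S x ^ k)\<^sup>2"
        "((bump S x)\<^sup>2) ^ k * (bump S x)\<^sup>2 = (bump S x * bump S x ^ k)\<^sup>2"
        by (simp_all add: power_mult_distrib power_add power_even_eq power2_eq_square)
      then show "(a x)\<^sup>2 * bump S x ^ (2 * k + 2) * F\<^sub>\<epsilon> x + 3 * \<eta> * ((bump S x)\<^sup>2 * ?D S x) =
        (a x * (bump S x * bump S x ^ k))\<^sup>2 * (F\<^sub>\<epsilon> x - ?D S x * (1 / 2 - C * outside S x))
        + ((a x * bump S x)\<^sup>2 * ?D S x * (((bump S x)\<^sup>2) ^ k * (1 / 2 - C * outside S x) + \<eta>)
        + \<eta> * ((bump S x)\<^sup>2 * ?D S x * (3 - (a x)\<^sup>2)))"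
        unfolding power_mult_distrib[of "a x"] by (simp only: regroup)
    qed
  qed
  obtain C2 where C2: "0 \<le> C2" "(\<lambda>x. C2 * slack x - (1 - u x)\<^sup>2) \<in> quad_module"
    using one_minus_bumps_dominated[of k] unfolding dominated_def u_def by blast
  define \<eta>\<^sub>2 where "\<eta>\<^sub>2 = \<epsilon> / (2 * (C2 + 1))"
  have \<eta>2: "0 < \<eta>\<^sub>2" "\<eta>\<^sub>2 * C2 \<le> \<epsilon> / 2"
  proof -
    show "0 < \<eta>\<^sub>2" using \<epsilon>(1) C2(1) by (simp add: \<eta>\<^sub>2_def)
    then have "\<eta>\<^sub>2 * C2 \<le> \<eta>\<^sub>2 * (C2 + 1)" by simp
    also have "\<dots> = \<epsilon> / 2" using C2(1) by (simp add: \<eta>\<^sub>2_def field_simps)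
    finally show "\<eta>\<^sub>2 * C2 \<le> \<epsilon> / 2" .
  qed
  have far: "(\<lambda>x. (4 - u x) / 4 * F\<^sub>\<epsilon> x + \<eta>\<^sub>2) \<in> quad_module"
  proof (rule positive_imp_quad_module)
    show "0 < (4 - u x) / 4 * F\<^sub>\<epsilon> x + \<eta>\<^sub>2" if "x \<in> std_simplex" for x
      using u[OF that] F\<epsilon>_nonneg[OF that] \<eta>2(1) by (intro add_nonneg_pos mult_nonneg_nonneg) auto
  qed (intro rpf_intros rpf_u rpf_F\<epsilon>)
  have "(\<lambda>x. (\<Sum>S\<in>?M. (a x)\<^sup>2 * bump S x ^ (2 * k + 2) * F\<^sub>\<epsilon> x + 3 * \<eta> * ((bump S x)\<^sup>2 * ?D S x))
      + (3 * \<eta> * (1 - (\<Sum>S\<in>?M. (bump S x)\<^sup>2))\<^sup>2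
      + ((1 - u x)\<^sup>2 * ((4 - u x) / 4 * F\<^sub>\<epsilon> x + \<eta>\<^sub>2)
      + (\<eta>\<^sub>2 * (C2 * slack x - (1 - u x)\<^sup>2) + (\<epsilon> - 3 * \<eta> - \<eta>\<^sub>2 * C2) * slack x)))) \<in> quad_module"
    using \<eta> \<eta>2 C2 by (intro quad_module.add quad_module_sum near quad_module_scale quad_module_mult_square
        far slack_in_quad_module quad_module.square rpf_intros rpf_u rpf_bump) (auto simp: \<eta>_def)
  then show ?thesis
  proof (rule quad_module.cong)
    fix x :: "real ^ 'n"
    have sum: "(\<Sum>S\<in>?M. (a x)\<^sup>2 * bump S x ^ (2 * k + 2) * F\<^sub>\<epsilon> x + 3 * \<eta> * ((bump S x)\<^sup>2 * ?D S x))
      = (a x)\<^sup>2 * u x * F\<^sub>\<epsilon> x + 3 * \<eta> * (\<Sum>S\<in>?M. (bump S x)\<^sup>2 * ?D S x)"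
      by (simp add: sum.distrib u_def sum_distrib_left sum_distrib_right)
    have slack: "(\<Sum>S\<in>?M. (bump S x)\<^sup>2 * ?D S x) = slack x - (1 - (\<Sum>S\<in>?M. (bump S x)\<^sup>2))\<^sup>2"
      by (simp add: slack_def)
    \<comment> \<open>The double zero of the second term at \<open>u = 1\<close> determines the multiplier \<open>a\<close>: it is the linear
      Taylor polynomial of \<open>1 / sqrt u\<close> at 1.\<close>
    have one: "(a x)\<^sup>2 * u x + (1 - u x)\<^sup>2 * ((4 - u x) / 4) = 1"
      by (simp add: a_def field_simps power2_eq_square)
    have "F\<^sub>\<epsilon> x = ((a x)\<^sup>2 * u x + (1 - u x)\<^sup>2 * ((4 - u x) / 4)) * F\<^sub>\<epsilon> x"
      unfolding one by simp
    then have F\<epsilon>: "(a x)\<^sup>2 * u x * F\<^sub>\<epsilon> x + (1 - u x)\<^sup>2 * ((4 - u x) / 4 * F\<^sub>\<epsilon> x) = F\<^sub>\<epsilon> x"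
      by (simp add: distrib_right mult.assoc)
    show "form x - 1 / alpha =
      (\<Sum>S\<in>?M. (a x)\<^sup>2 * bump S x ^ (2 * k + 2) * F\<^sub>\<epsilon> x + 3 * \<eta> * ((bump S x)\<^sup>2 * ?D S x))
      + (3 * \<eta> * (1 - (\<Sum>S\<in>?M. (bump S x)\<^sup>2))\<^sup>2
      + ((1 - u x)\<^sup>2 * ((4 - u x) / 4 * F\<^sub>\<epsilon> x + \<eta>\<^sub>2)
      + (\<eta>\<^sub>2 * (C2 * slack x - (1 - u x)\<^sup>2) + (\<epsilon> - 3 * \<eta> - \<eta>\<^sub>2 * C2) * slack x)))"
      unfolding sum slack using F\<epsilon> by (simp add: F\<^sub>\<epsilon>_def F_def algebra_simps)
  qed
qed

end

section \<open>Certificates of bounded degree\<close>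

text \<open>
  Quantitative Lagrange interpolation. The coefficients of polynomials of bounded degree are controlled by
  finitely many values, which replaces a compactness argument for certificates of a fixed order.
\<close>
lemma poly_coeff_bound_by_values:
  assumes "finite P" "card P = Suc d"
  shows "\<exists>C\<ge>0. \<forall>p :: real poly. degree p \<le> d \<longrightarrow> (\<forall>i. \<bar>coeff p i\<bar> \<le> C * (\<Sum>x\<in>P. \<bar>poly p x\<bar>))"
  using assms
proof (induction d arbitrary: P)
  case 0
  then obtain a where P: "P = {a}" using card_1_singletonE by auto
  have "\<bar>coeff p i\<bar> \<le> 1 * (\<Sum>x\<in>P. \<bar>poly p x\<bar>)" if "degree p \<le> 0" for p :: "real poly" and i
  proof -
    have "degree p = 0" using that by simp
    then obtain c where "p = [:c:]" by (rule degree_eq_zeroE)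
    then show ?thesis by (cases i) (auto simp: P)
  qed
  then show ?case by (intro exI[of _ 1]) auto
next
  case (Suc d)
  then obtain a where a: "a \<in> P" by fastforce
  let ?P = "P - {a}"
  have "card ?P = Suc d" using Suc.prems a by simp
  with Suc.IH[of ?P] Suc.prems obtain C where C: "0 \<le> C"
    "\<And>q i. degree q \<le> d \<Longrightarrow> \<bar>coeff q i\<bar> \<le> C * (\<Sum>x\<in>?P. \<bar>poly q x\<bar>)" by auto
  define m where "m = (\<Sum>x\<in>?P. 1 / \<bar>x - a\<bar>)"
  have m: "0 \<le> m" by (simp add: m_def sum_nonneg)
  have "\<bar>coeff p i\<bar> \<le> (1 + C * m * (1 + \<bar>a\<bar>)) * (\<Sum>x\<in>P. \<bar>poly p x\<bar>)"
    if p: "degree p \<le> Suc d" for p :: "real poly" and i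
  proof -
    define T where "T = (\<Sum>x\<in>P. \<bar>poly p x\<bar>)"
    have T: "T = \<bar>poly p a\<bar> + (\<Sum>x\<in>?P. \<bar>poly p x\<bar>)"
      unfolding T_def using Suc.prems a by (simp add: sum.remove)
    have "poly (p - [:poly p a:]) a = 0" by simp
    then obtain q where q: "p - [:poly p a:] = [:- a, 1:] * q"
      unfolding poly_eq_0_iff_dvd by (auto elim: dvdE)
    then have p_eq: "p = [:poly p a:] + [:- a, 1:] * q" by (simp add: algebra_simps)
    have "degree q \<le> d"
    proof (cases "q = 0")
      case False
      then have "degree ([:- a, 1:] * q) = Suc (degree q)" by (simp add: degree_mult_eq del: mult_pCons_left)
      moreover have "degree (p - [:poly p a:]) \<le> Suc d"
        using p by (intro degree_diff_le) auto
      ultimately show ?thesis using q by simp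
    qed simp
    moreover have "(\<Sum>x\<in>?P. \<bar>poly q x\<bar>) \<le> m * T"
      unfolding m_def sum_distrib_right
    proof (rule sum_mono)
      fix x assume x: "x \<in> ?P"
      have "poly p x - poly p a = (x - a) * poly q x"
        using arg_cong[OF q, of "\<lambda>r. poly r x"] by (simp add: algebra_simps)
      then have "\<bar>x - a\<bar> * \<bar>poly q x\<bar> \<le> \<bar>poly p x\<bar> + \<bar>poly p a\<bar>"
        unfolding abs_mult[symmetric] by linarith
      also have "\<dots> \<le> T"
        unfolding T using Suc.prems x member_le_sum[of x ?P "\<lambda>x. \<bar>poly p x\<bar>"] by auto
      finally show "\<bar>poly q x\<bar> \<le> 1 / \<bar>x - a\<bar> * T"
        using x by (simp add: pos_le_divide_eq mult.commute)
    qed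
    ultimately have bq: "\<bar>coeff q i\<bar> \<le> C * (m * T)" for i
      using C by (meson mult_left_mono order_trans)
    have T0: "\<bar>poly p a\<bar> \<le> T" "0 \<le> T" unfolding T by (auto intro: sum_nonneg)
    have aq: "\<bar>a * coeff q j\<bar> \<le> \<bar>a\<bar> * (C * (m * T))" for j
      unfolding abs_mult using bq by (intro mult_left_mono) auto
    have "\<bar>coeff p i\<bar> \<le> T + C * (m * T) + \<bar>a\<bar> * (C * (m * T))"
    proof (cases i)
      case 0
      have "coeff p 0 = poly p a - a * coeff q 0"
        using arg_cong[OF p_eq, of "\<lambda>r. coeff r 0"] by simp
      moreover have "0 \<le> C * (m * T)" using C m T0 by simp
      ultimately show ?thesis using T0 aq[of 0] unfolding 0 by linarith
    next
      case (Suc j)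
      have "coeff p (Suc j) = coeff q j - a * coeff q (Suc j)"
        using arg_cong[OF p_eq, of "\<lambda>r. coeff r (Suc j)"] by simp
      then show ?thesis using T0 aq[of "Suc j"] bq[of j] unfolding Suc by linarith
    qed
    then show ?thesis unfolding T_def[symmetric] by (simp add: algebra_simps)
  qed
  then show ?case using C(1) m by (intro exI[of _ "1 + C * m * (1 + \<bar>a\<bar>)"]) auto
qed

lemma poly_eq_sum_upto:
  fixes p :: "'a::comm_semiring_1 poly"
  assumes "degree p \<le> n"
  shows "poly p x = (\<Sum>i\<le>n. coeff p i * x ^ i)"
  unfolding poly_altdef using assms by (intro sum.mono_neutral_left) (auto simp: coeff_eq_0)

lemma total_degree_ge:
  "m \<in> Poly_Mapping.keys p \<Longrightarrow> (\<Sum>i\<in>UNIV. Poly_Mapping.lookup m i) \<le> total_degree p"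
  unfolding total_degree_def by (intro Max_ge) auto

text \<open>
  The truncation bounds the degree of \<open>x\<^sub>i \<sigma>\<^sub>i\<close>; the interpolation argument needs a bound for \<open>\<sigma>\<^sub>i\<close> itself.
\<close>
lemma total_degree_le_Var_mult: "total_degree p \<le> total_degree (Var i * p)"
proof -
  let ?e = "Poly_Mapping.single i (1 :: nat)"
  have lookup: "Poly_Mapping.lookup (Var i * p) (?e + m) = Poly_Mapping.lookup p m" for m
  proof -
    have "Var i * p = (\<Sum>k\<in>Poly_Mapping.keys p. Poly_Mapping.single (?e + k) (Poly_Mapping.lookup p k))"
      by (subst sum_singles[of p]) (simp add: sum_distrib_left Var_def mult_single)
    then show ?thesis
      by (simp add: lookup_sum lookup_single when_def sum.delta in_keys_iff)
  qed
  have "(\<Sum>j\<in>UNIV. Poly_Mapping.lookup m j) \<le> total_degree (Var i * p)"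
    if m: "m \<in> Poly_Mapping.keys p" for m
  proof -
    have "(\<Sum>j\<in>UNIV. Poly_Mapping.lookup m j) \<le> (\<Sum>j\<in>UNIV. Poly_Mapping.lookup (?e + m) j)"
      by (intro sum_mono) (simp add: lookup_add)
    also have "\<dots> \<le> total_degree (Var i * p)"
      using m lookup[of m] by (intro total_degree_ge) (simp add: in_keys_iff)
    finally show ?thesis .
  qed
  then show ?thesis
    unfolding total_degree_def[of p] by auto
qed

lemma peval_on_line:
  fixes p :: "('n::finite) mpoly"
  shows "\<exists>q. degree q \<le> total_degree p \<and> (\<forall>s. poly q s = peval (a + s *s d) p)"
proof -
  define q where "q = (\<Sum>m\<in>Poly_Mapping.keys p. smult (Poly_Mapping.lookup p m)
    (\<Prod>i\<in>UNIV. [:a $ i, d $ i:] ^ Poly_Mapping.lookup m i))"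
  have "degree q \<le> total_degree p"
    unfolding q_def
  proof (rule degree_sum_le)
    fix m assume m: "m \<in> Poly_Mapping.keys p"
    have "degree (\<Prod>i\<in>UNIV. [:a $ i, d $ i:] ^ Poly_Mapping.lookup m i)
        \<le> (\<Sum>i\<in>UNIV. degree ([:a $ i, d $ i:] ^ Poly_Mapping.lookup m i))"
      using degree_prod_sum_le[of UNIV "\<lambda>i. [:a $ i, d $ i:] ^ Poly_Mapping.lookup m i"] by (simp add: o_def)
    also have "\<dots> \<le> (\<Sum>i\<in>UNIV. Poly_Mapping.lookup m i)"
    proof (rule sum_mono)
      fix i
      have "degree ([:a $ i, d $ i:] ^ Poly_Mapping.lookup m i)
          \<le> degree [:a $ i, d $ i:] * Poly_Mapping.lookup m i" by (rule degree_power_le)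
      also have "\<dots> \<le> 1 * Poly_Mapping.lookup m i" by (intro mult_right_mono) auto
      finally show "degree ([:a $ i, d $ i:] ^ Poly_Mapping.lookup m i) \<le> Poly_Mapping.lookup m i" by simp
    qed
    also have "\<dots> \<le> total_degree p" by (rule total_degree_ge[OF m])
    finally show "degree (smult (Poly_Mapping.lookup p m)
        (\<Prod>i\<in>UNIV. [:a $ i, d $ i:] ^ Poly_Mapping.lookup m i)) \<le> total_degree p"
      using degree_smult_le order_trans by blast
  qed simp
  moreover have "poly q s = peval (a + s *s d) p" for s
    by (simp add: q_def peval_def poly_sum poly_prod mult.commute)
  ultimately show ?thesis by blast
qed

lemma sos_nonneg: "p \<in> sos \<Longrightarrow> 0 \<le> peval x p"
proof -
  assume "p \<in> sos"
  then obtain N :: nat and q where "p = (\<Sum>k<N. (q k)\<^sup>2)" unfolding sos_def by blast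
  then show ?thesis by (simp add: sum_nonneg)
qed

lemma sos_add_square: "p \<in> sos \<Longrightarrow> p + r\<^sup>2 \<in> sos"
proof -
  assume "p \<in> sos"
  then obtain N :: nat and q where "p = (\<Sum>k<N. (q k)\<^sup>2)" unfolding sos_def by blast
  then have "p + r\<^sup>2 = (\<Sum>k<Suc N. ((q(N := r)) k)\<^sup>2)" by simp
  then show ?thesis unfolding sos_def by blast
qed

lemma sos_zero: "0 \<in> sos"
  unfolding sos_def mem_Collect_eq by (intro exI[of _ 0] exI[of _ "\<lambda>_. 0"]) simp

lemma sos_add: "p \<in> sos \<Longrightarrow> p' \<in> sos \<Longrightarrow> p + p' \<in> sos"
proof -
  assume p: "p \<in> sos" and "p' \<in> sos"
  then obtain N :: nat and q where p': "p' = (\<Sum>k<N. (q k)\<^sup>2)" unfolding sos_def by blast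
  have "p + (\<Sum>k<N. (q k)\<^sup>2) \<in> sos" for N :: nat
  proof (induction N)
    case (Suc N)
    from sos_add_square[OF Suc.IH, of "q N"] show ?case by (simp add: add.assoc)
  qed (simp add: p)
  then show ?thesis unfolding p' .
qed

text \<open>
  The passage from functions back to polynomials: a polynomial that agrees with such a sum on the
  hyperplane differs from it by an element of the ideal.
\<close>
lemma quad_module_imp_sos:
  fixes f :: "real ^ 'n::finite \<Rightarrow> real"
  assumes "f \<in> quad_module"
  shows "\<exists>\<sigma>\<^sub>0 \<sigma>. \<sigma>\<^sub>0 \<in> sos \<and> (\<forall>i. \<sigma> i \<in> sos) \<and>
    (\<forall>x. (\<Sum>i\<in>UNIV. x $ i) = 1 \<longrightarrow> f x = peval x (\<sigma>\<^sub>0 + (\<Sum>i\<in>UNIV. Var i * \<sigma> i)))"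
  using assms
proof induction
  case (square g)
  then obtain p where p: "\<And>x. g x = peval x p" using real_polynomial_function_imp_peval by blast
  have "p\<^sup>2 \<in> sos" using sos_add_square[OF sos_zero, of p] by simp
  then show ?case by (intro exI[of _ "p\<^sup>2"] exI[of _ "\<lambda>i. 0"]) (auto simp: p sos_zero)
next
  case (coord_square g i)
  then obtain p where p: "\<And>x. g x = peval x p" using real_polynomial_function_imp_peval by blast
  have "p\<^sup>2 \<in> sos" using sos_add_square[OF sos_zero, of p] by simp
  moreover have "(\<Sum>j\<in>UNIV. x $ j * peval x (if j = i then p\<^sup>2 else 0)) = x $ i * (peval x p)\<^sup>2" for x
  proof -
    have "(\<Sum>j\<in>UNIV. x $ j * peval x (if j = i then p\<^sup>2 else 0)) =
        (\<Sum>j\<in>UNIV. if j = i then x $ j * (peval x p)\<^sup>2 else 0)"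
      by (intro sum.cong) auto
    then show ?thesis by simp
  qed
  ultimately show ?case
    by (intro exI[of _ 0] exI[of _ "\<lambda>j. if j = i then p\<^sup>2 else 0"]) (auto simp: p sos_zero)
next
  case (add f g)
  obtain \<sigma>\<^sub>0 \<sigma> where \<sigma>: "\<sigma>\<^sub>0 \<in> sos" "\<forall>i. \<sigma> i \<in> sos"
    "\<forall>x. (\<Sum>i\<in>UNIV. x $ i) = 1 \<longrightarrow> f x = peval x (\<sigma>\<^sub>0 + (\<Sum>i\<in>UNIV. Var i * \<sigma> i))"
    using add.IH(1) by blast
  obtain \<tau>\<^sub>0 \<tau> where \<tau>: "\<tau>\<^sub>0 \<in> sos" "\<forall>i. \<tau> i \<in> sos"
    "\<forall>x. (\<Sum>i\<in>UNIV. x $ i) = 1 \<longrightarrow> g x = peval x (\<tau>\<^sub>0 + (\<Sum>i\<in>UNIV. Var i * \<tau> i))"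
    using add.IH(2) by blast
  show ?case
    using \<sigma> \<tau> by (intro exI[of _ "\<sigma>\<^sub>0 + \<tau>\<^sub>0"] exI[of _ "\<lambda>i. \<sigma> i + \<tau> i"])
      (simp add: sos_add distrib_left sum.distrib)
next
  case (cong f g)
  then show ?case by simp
qed

context weighted_graph
begin

lemma peval_quadratic_form: "peval x (quadratic_form B) = form x"
  by (simp add: quadratic_form_def form_def inner_vec_def matrix_vector_mult_def sum_distrib_left mult_ac)

text \<open>
  The multiplier of the ideal generator, whose degree is not bounded, disappears on the hyperplane. Only the
  degrees of the \<open>\<sigma> i\<close> are kept, since the obstruction concerns one of them.
\<close>
definition certificate :: "nat \<Rightarrow> real \<Rightarrow> 'n mpoly \<Rightarrow> ('n \<Rightarrow> 'n mpoly) \<Rightarrow> bool" where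
  "certificate r c \<sigma>\<^sub>0 \<sigma> \<longleftrightarrow> \<sigma>\<^sub>0 \<in> sos \<and> (\<forall>i. \<sigma> i \<in> sos) \<and> (\<forall>i. total_degree (\<sigma> i) \<le> r) \<and>
    (\<forall>x. (\<Sum>i\<in>UNIV. x $ i) = 1 \<longrightarrow> form x - c = peval x \<sigma>\<^sub>0 + (\<Sum>i\<in>UNIV. x $ i * peval x (\<sigma> i)))"

lemma lasserre_certificate:
  assumes "p \<in> truncated_quadratic_module r" "h \<in> simplex_ideal" "quadratic_form B - Const c = p + h"
  shows "\<exists>\<sigma>\<^sub>0 \<sigma>. certificate r c \<sigma>\<^sub>0 \<sigma>"
proof -
  obtain \<sigma>\<^sub>0 \<sigma> where p: "p = \<sigma>\<^sub>0 + (\<Sum>i\<in>UNIV. Var i * \<sigma> i)" "\<sigma>\<^sub>0 \<in> sos" "\<And>i. \<sigma> i \<in> sos"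
    "\<And>i. total_degree (Var i * \<sigma> i) \<le> r"
    using assms(1) unfolding truncated_quadratic_module_def by auto
  have "form x - c = peval x \<sigma>\<^sub>0 + (\<Sum>i\<in>UNIV. x $ i * peval x (\<sigma> i))" if "(\<Sum>i\<in>UNIV. x $ i) = 1" for x
    using arg_cong[OF assms(3), of "peval x"] peval_simplex_ideal[OF assms(2) that]
    by (simp add: p(1) peval_quadratic_form)
  moreover have "total_degree (\<sigma> i) \<le> r" for i
    using total_degree_le_Var_mult[of "\<sigma> i" i] p(4)[of i] by simp
  ultimately have "certificate r c \<sigma>\<^sub>0 \<sigma>" using p by (simp add: certificate_def)
  then show ?thesis by blast
qed

section \<open>Segments of minimizers obstruct finite convergence\<close>

text \<open>
  A set that becomes stable by deleting the edge, and is larger than all stable sets of the graph,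
  contains both ends of the edge; dropping either end leaves a maximum stable set.
\<close>
lemma critical_edge_exchange:
  assumes "critical_edge E {l, m}"
  shows "\<exists>T. l \<notin> T \<and> m \<notin> T \<and> insert l T \<in> maximum_stable_sets E \<and> insert m T \<in> maximum_stable_sets E"
proof -
  have lm: "{l, m} \<in> E" "l \<noteq> m" using assms edge_neq by (auto simp: critical_edge_def)
  obtain S where S: "stable (E - {{l, m}}) S" "card S = stability_number E + 1"
    using ex_maximum_stable[of "E - {{l, m}}"] assms by (auto simp: critical_edge_def)
  have both: "l \<in> S \<and> m \<in> S"
  proof (rule ccontr)
    assume "\<not> (l \<in> S \<and> m \<in> S)"
    then have "stable E S"
      using S(1) by (auto simp: stable_def doubleton_eq_iff)
    from card_le_stability_number[OF this] S(2) show False by simp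
  qed
  have "stable E (S - {m})" "stable E (S - {l})"
    using S(1) by (auto simp: stable_def doubleton_eq_iff)
  moreover have "S - {m} = insert l (S - {l, m})" "S - {l} = insert m (S - {l, m})"
    using both lm by auto
  moreover have "card (S - {m}) = stability_number E" "card (S - {l}) = stability_number E"
    using both S(2) by auto
  ultimately show ?thesis
    by (intro exI[of _ "S - {l, m}"]) (auto simp: maximum_stable_sets_def)
qed

text \<open>
  Walk from the minimizer \<open>u\<close> towards the vertex \<open>k\<close>, through the points \<open>(1 - s) u + s e\<^sub>k\<close>.
  All terms of the certificate other than \<open>x\<^sub>k \<sigma>\<^sub>k\<close> are nonnegative for \<open>s \<le> 1\<close>, also for negative \<open>s\<close>,
  since only the coordinate \<open>k\<close> changes its sign there. Hence \<open>s \<sigma>\<^sub>k \<le> e + s A + s\<^sup>2 b\<close> with the gap \<open>e < \<epsilon>\<close>,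
  which bounds \<open>\<sigma>\<^sub>k\<close> above for \<open>s > 0\<close> and below for \<open>s < 0\<close>. The values on \<open>[1/2, 1]\<close> bound its
  coefficients and with them its variation between \<open>-s\<close> and \<open>s\<close>. A small \<open>s\<close>, and then a much smaller
  \<open>\<epsilon>\<close>, gives the estimate at \<open>s = 0\<close>.
\<close>
lemma sigma_near_minimizer:
  assumes u: "u \<in> std_simplex" "form u = 1 / alpha" "u $ k = 0" and \<zeta>: "0 < \<zeta>"
  shows "eventually (\<lambda>\<epsilon>. \<forall>c \<sigma>\<^sub>0 \<sigma>. 1 / alpha - \<epsilon> < c \<longrightarrow> certificate r c \<sigma>\<^sub>0 \<sigma> \<longrightarrow>
    \<bar>peval u (\<sigma> k) - 2 * ((B *v u) $ k - 1 / alpha)\<bar> \<le> \<zeta>) (at_right 0)"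
proof -
  define w where "w = (B *v u) $ k"
  define A where "A = 2 * (w - 1 / alpha)"
  define b where "b = 1 / alpha - 2 * w + 1"
  have "infinite {1/2..1::real}" by simp
  then obtain P where P: "finite P" "card P = Suc r" "P \<subseteq> {1/2..1::real}"
    by (meson infinite_arbitrarily_large)
  obtain C where C: "0 \<le> C" "\<And>p i. degree p \<le> r \<Longrightarrow> \<bar>coeff p i\<bar> \<le> C * (\<Sum>x\<in>P. \<bar>poly p x\<bar>)"
    using poly_coeff_bound_by_values[OF P(1,2)] by blast
  define K where "K = \<bar>A\<bar> + \<bar>b\<bar> + 2"
  define L where "L = real (Suc r) * (C * (real (Suc r) * K))"
  have L: "0 \<le> L" using C(1) by (simp add: L_def K_def)
  define s where "s = min 1 (\<zeta> / (2 * (\<bar>b\<bar> + L + 1)))"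
  have s: "0 < s" "s \<le> 1" "s * (\<bar>b\<bar> + L) \<le> \<zeta> / 2"
  proof -
    show "0 < s" using \<zeta> L by (simp add: s_def)
    show "s \<le> 1" by (simp add: s_def)
    have "s * (\<bar>b\<bar> + L) \<le> s * (\<bar>b\<bar> + L + 1)" using \<open>0 < s\<close> by simp
    also have "\<dots> \<le> \<zeta> / (2 * (\<bar>b\<bar> + L + 1)) * (\<bar>b\<bar> + L + 1)"
      using L by (intro mult_right_mono) (auto simp: s_def)
    also have "\<dots> = \<zeta> / 2" using L by (simp add: field_simps)
    finally show "s * (\<bar>b\<bar> + L) \<le> \<zeta> / 2" .
  qed
  define \<epsilon>\<^sub>0 where "\<epsilon>\<^sub>0 = min 1 (s * \<zeta> / 2)"
  have \<epsilon>0: "0 < \<epsilon>\<^sub>0" using s \<zeta> by (simp add: \<epsilon>\<^sub>0_def)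
  have main: "\<bar>peval u (\<sigma> k) - A\<bar> \<le> \<zeta>"
    if \<epsilon>: "0 < \<epsilon>" "\<epsilon> < \<epsilon>\<^sub>0" and c: "1 / alpha - \<epsilon> < c" and cert: "certificate r c \<sigma>\<^sub>0 \<sigma>" for \<epsilon> c \<sigma>\<^sub>0 \<sigma>
  proof -
    define e where "e = 1 / alpha - c"
    have e: "e < \<epsilon>" using c by (simp add: e_def)
    have sos: "\<And>x. 0 \<le> peval x \<sigma>\<^sub>0" "\<And>i x. 0 \<le> peval x (\<sigma> i)"
      using cert by (auto simp: certificate_def intro: sos_nonneg)
    obtain v where v: "degree v \<le> r" "\<And>s. poly v s = peval (u + s *s (axis k 1 - u)) (\<sigma> k)"
    proof -
      have "total_degree (\<sigma> k) \<le> r" using cert by (simp add: certificate_def)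
      then show thesis using peval_on_line[of "\<sigma> k" u "axis k 1 - u"] that order_trans by blast
    qed
    have v_nonneg: "0 \<le> poly v s" for s unfolding v(2) by (rule sos)
    have key: "s * poly v s \<le> e + s * A + s\<^sup>2 * b" if "s \<le> 1" for s
    proof -
      let ?x = "u + s *s (axis k 1 - u)"
      have x: "?x = (1 - s) *s u + s *s axis k 1"
        by (simp add: vec_eq_iff algebra_simps)
      have sum: "(\<Sum>i\<in>UNIV. ?x $ i) = 1"
        unfolding x using u(1)
        by (simp add: sum.distrib sum_distrib_left[symmetric] std_simplex_def axis_def left_diff_distrib sum_subtractf)
      have "s * u $ i \<le> u $ i" for i
        using mult_right_mono[OF that, of "u $ i"] u(1) by (simp add: std_simplex_def)
      then have coords: "?x $ k = s" "\<And>i. i \<noteq> k \<Longrightarrow> 0 \<le> ?x $ i"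
        using u that by (auto simp: x axis_def left_diff_distrib)
      have "form ?x = (1 - s)\<^sup>2 * (1 / alpha) + 2 * (s * (1 - s) * w) + s\<^sup>2"
      proof -
        have "form (axis k 1) = 1"
          by (simp add: form_def inner_axis' matrix_vector_mult_basis column_def B_diag)
        moreover have "(s *s axis k 1) \<bullet> (B *v ((1 - s) *s u)) = s * (1 - s) * w"
          by (simp add: scalar_mult_eq_scaleR matrix_vector_mult_scaleR inner_axis' w_def)
        ultimately show ?thesis
          unfolding x form_add form_scale u(2) by simp
      qed
      then have "form ?x - c = e + s * A + s\<^sup>2 * b"
        by (simp add: e_def A_def b_def power2_eq_square algebra_simps add_divide_distrib)
      moreover have "form ?x - c = peval ?x \<sigma>\<^sub>0 + (\<Sum>i\<in>UNIV. ?x $ i * peval ?x (\<sigma> i))"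
        using cert sum by (simp add: certificate_def)
      moreover have "(\<Sum>i\<in>UNIV. ?x $ i * peval ?x (\<sigma> i)) = s * poly v s + (\<Sum>i\<in>-{k}. ?x $ i * peval ?x (\<sigma> i))"
        unfolding v(2) using sum.remove[OF finite UNIV_I, of "\<lambda>i. ?x $ i * peval ?x (\<sigma> i)" k]
        by (simp only: coords(1) Compl_eq_Diff_UNIV)
      moreover have "0 \<le> (\<Sum>i\<in>-{k}. ?x $ i * peval ?x (\<sigma> i))"
        using coords(2) sos(2) by (intro sum_nonneg mult_nonneg_nonneg) auto
      ultimately show ?thesis using sos(1)[of ?x] by linarith
    qed
    have "(\<Sum>x\<in>P. \<bar>poly v x\<bar>) \<le> (\<Sum>x\<in>P. K)"
    proof (rule sum_mono)
      fix x assume "x \<in> P"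
      then have x: "1 / 2 \<le> x" "x \<le> 1" using P(3) by auto
      have "x * poly v x \<le> e + x * A + x\<^sup>2 * b" by (rule key[OF x(2)])
      also have "\<dots> \<le> x * 2 + x * \<bar>A\<bar> + x * \<bar>b\<bar>"
      proof (intro add_mono)
        have "e \<le> 1" using e \<epsilon> by (simp add: \<epsilon>\<^sub>0_def)
        then show "e \<le> x * 2" using x by simp
        show "x * A \<le> x * \<bar>A\<bar>" using x by (intro mult_left_mono) auto
        have "x\<^sup>2 * b \<le> x\<^sup>2 * \<bar>b\<bar>" by (intro mult_left_mono) auto
        also have "\<dots> \<le> x * \<bar>b\<bar>" using x by (intro mult_right_mono) (auto simp: power2_eq_square mult_left_le)
        finally show "x\<^sup>2 * b \<le> x * \<bar>b\<bar>" .
      qed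
      also have "\<dots> = x * K" by (simp add: K_def algebra_simps)
      finally show "\<bar>poly v x\<bar> \<le> K" using x v_nonneg[of x] by simp
    qed
    then have "(\<Sum>x\<in>P. \<bar>poly v x\<bar>) \<le> real (Suc r) * K" using P(2) by simp
    then have coeff: "\<bar>coeff v i\<bar> \<le> C * (real (Suc r) * K)" for i
      using C(2)[OF v(1), of i] C(1) by (meson mult_left_mono order_trans)
    have lip: "\<bar>poly v s - poly v 0\<bar> \<le> L * \<bar>s\<bar>" if "\<bar>s\<bar> \<le> 1" for s
    proof -
      have "poly v s - poly v 0 = (\<Sum>i\<le>r. coeff v i * (s ^ i - 0 ^ i))"
        by (simp add: poly_eq_sum_upto[OF v(1)] right_diff_distrib sum_subtractf)
      also have "\<bar>\<dots>\<bar> \<le> (\<Sum>i\<le>r. C * (real (Suc r) * K) * \<bar>s\<bar>)"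
      proof (intro order_trans[OF sum_abs] sum_mono)
        fix i
        have "\<bar>s ^ i - 0 ^ i\<bar> \<le> \<bar>s\<bar>"
        proof (cases i)
          case (Suc j)
          have "\<bar>s\<bar> ^ j \<le> 1" using that by (intro power_le_one) auto
          then show ?thesis using Suc by (simp add: abs_mult power_abs mult_left_le)
        qed simp
        then show "\<bar>coeff v i * (s ^ i - 0 ^ i)\<bar> \<le> C * (real (Suc r) * K) * \<bar>s\<bar>"
          unfolding abs_mult using coeff[of i] by (intro mult_mono) auto
      qed
      also have "\<dots> = L * \<bar>s\<bar>" by (simp add: L_def)
      finally show ?thesis .
    qed
    have es: "e \<le> s * (\<zeta> / 2)" using e \<epsilon>(2) by (simp add: \<epsilon>\<^sub>0_def)
    have bs: "s * b \<le> s * \<bar>b\<bar>" "- (s * b) \<le> s * \<bar>b\<bar>"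
      using abs_ge_self[of "s * b"] abs_ge_minus_self[of "s * b"] s(1) by (simp_all only: abs_mult abs_of_pos)
    have "s * poly v s \<le> s * (\<zeta> / 2 + A + s * b)"
      using key[OF s(2)] es by (simp add: power2_eq_square algebra_simps)
    then have up: "poly v s \<le> \<zeta> / 2 + A + s * b" using s(1) by simp
    have "s * (A - s * b - \<zeta> / 2) \<le> s * poly v (- s)"
      using key[of "- s"] es s by (simp add: power2_eq_square algebra_simps)
    then have lo: "A - s * b - \<zeta> / 2 \<le> poly v (- s)" using s(1) by simp
    have near: "poly v 0 \<le> poly v s + L * s" "poly v (- s) \<le> poly v 0 + L * s"
      using lip[of s] lip[of "- s"] s by (auto simp: abs_le_iff)
    have "s * \<bar>b\<bar> + L * s \<le> \<zeta> / 2" using s(3) by (simp add: algebra_simps)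
    then have "\<bar>poly v 0 - A\<bar> \<le> \<zeta>"
      using near up lo bs by (intro abs_leI) linarith+
    moreover have "poly v 0 = peval u (\<sigma> k)" unfolding v(2) by simp
    ultimately show ?thesis by simp
  qed
  show ?thesis
    unfolding eventually_at_right_field
    using \<epsilon>0 main by (intro exI[of _ "\<epsilon>\<^sub>0"]) (auto simp: A_def w_def)
qed

text \<open>
  Along the line \<open>u t\<close> of points with value \<open>1/\<alpha>\<close>, the limit \<open>A t\<close> of \<open>\<sigma>\<^sub>k (u t)\<close> is affine in \<open>t\<close>. The estimate
  holds only for \<open>t\<close> in \<open>[0, 1]\<close>, where \<open>u t\<close> lies in the simplex; interpolation at \<open>r + 2\<close> points
  carries it to all real \<open>t\<close>, and there \<open>\<sigma>\<^sub>k \<ge> 0\<close>. An affine function that is nonnegative on the whole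
  line is constant.
\<close>
theorem finite_convergence_imp_equal_weights:
  assumes conv: "lasserre B r = ereal (1 / alpha)"
    and crit: "critical_edge E {l, m}" and one: "B $ l $ m = 1"
    and T: "l \<notin> T" "m \<notin> T" "insert l T \<in> maximum_stable_sets E" "insert m T \<in> maximum_stable_sets E"
    and k: "k \<notin> T" "k \<noteq> l" "k \<noteq> m"
  shows "B $ k $ l = B $ k $ m"
proof -
  have lm: "l \<noteq> m" using crit edge_neq by (auto simp: critical_edge_def)
  define a where "a = barycentre (insert m T)"
  define d :: "real ^ 'n" where "d = (1 / alpha) *s (axis l 1 - axis m 1)"
  define u where "u t = a + t *s d" for t
  have card: "real (card (insert m T)) = alpha" "stable E (insert m T)" "stable E (insert l T)"
    using T by (auto simp: maximum_stable_sets_def)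
  have a: "a $ i = (if i \<in> insert m T then 1 / alpha else 0)" for i
    by (simp add: a_def barycentre_def card(1) del: card_insert_disjoint)
  have u_coord: "u t $ i = (if i \<in> T then 1 / alpha else if i = l then t / alpha
      else if i = m then (1 - t) / alpha else 0)" for t i
    using T lm by (auto simp: u_def d_def a axis_def diff_divide_distrib)
  have a_sum: "(\<Sum>i\<in>UNIV. a $ i) = 1"
    using barycentre_in_simplex[of "insert m T"] by (simp add: a_def std_simplex_def)
  have u_simplex: "u t \<in> std_simplex" if "0 \<le> t" "t \<le> 1" for t
  proof -
    have "(\<Sum>i\<in>UNIV. d $ i) = 0"
      by (simp add: d_def axis_def sum_divide_distrib[symmetric] sum_subtractf)
    then have "(\<Sum>i\<in>UNIV. u t $ i) = 1"
      using a_sum by (simp add: u_def sum.distrib sum_distrib_left[symmetric])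
    then show ?thesis using that alpha_pos by (auto simp: std_simplex_def u_coord)
  qed
  have Ba: "(B *v a) $ i = (\<Sum>j\<in>insert m T. B $ i $ j) / alpha" for i
  proof -
    have "(B *v a) $ i = (\<Sum>j\<in>UNIV. if j \<in> insert m T then B $ i $ j / alpha else 0)"
      unfolding matrix_vector_mult_def by (simp add: a if_distrib cong: if_cong)
    then show ?thesis by (simp add: sum.If_cases sum_divide_distrib del: insert_iff sum.insert)
  qed
  have form_u: "form (u t) = 1 / alpha" for t
  proof -
    have "(\<Sum>j\<in>insert m T. B $ m $ j) = 1"
      using B_stable[OF card(2), of m] by (subst sum.remove[of _ m]) auto
    moreover have "(\<Sum>j\<in>insert m T. B $ l $ j) = 1"
    proof -
      have "B $ l $ j = 0" if "j \<in> T" for j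
        using B_stable[OF card(3), of l j] that T by auto
      then show ?thesis using T one by (simp add: sum.insert)
    qed
    ultimately have "(axis l 1 - axis m 1) \<bullet> (B *v a) = 0"
      by (simp add: inner_diff_left inner_axis' Ba)
    moreover have "form a = 1 / alpha" unfolding a_def by (rule form_barycentre[OF T(4)])
    moreover have "form d = 0" unfolding d_def form_scale form_edge_direction one by simp
    ultimately show ?thesis
      unfolding u_def form_add form_scale by (simp add: d_def scalar_mult_eq_scaleR)
  qed
  define A where "A t = 2 * ((B *v u t) $ k - 1 / alpha)" for t
  define A\<^sub>0 where "A\<^sub>0 = 2 * ((B *v a) $ k - 1 / alpha)"
  define A\<^sub>1 where "A\<^sub>1 = 2 * (B $ k $ l - B $ k $ m) / alpha"
  have A: "A t = A\<^sub>0 + t * A\<^sub>1" for t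
  proof -
    have "(B *v u t) $ k = (B *v a) $ k + t * ((B $ k $ l - B $ k $ m) / alpha)"
      by (simp add: u_def d_def matrix_vector_right_distrib scalar_mult_eq_scaleR
          matrix_vector_mult_scaleR matrix_vector_mult_diff_distrib matrix_vector_mult_basis column_def)
    then show ?thesis by (simp add: A_def A\<^sub>0_def A\<^sub>1_def algebra_simps)
  qed
  have "infinite {0..1::real}" by simp
  then obtain P where P: "finite P" "card P = Suc (Suc r)" "P \<subseteq> {0..1::real}"
    by (meson infinite_arbitrarily_large)
  obtain C where C: "0 \<le> C" "\<And>p i. degree p \<le> Suc r \<Longrightarrow> \<bar>coeff p i\<bar> \<le> C * (\<Sum>x\<in>P. \<bar>poly p x\<bar>)"
    using poly_coeff_bound_by_values[OF P(1,2)] by blast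
  have A_nonneg: "0 \<le> A \<tau>" for \<tau>
  proof (rule ccontr)
    assume "\<not> 0 \<le> A \<tau>"
    define W where "W = (\<Sum>i\<le>Suc r. C * real (Suc (Suc r)) * \<bar>\<tau>\<bar> ^ i)"
    have W: "0 \<le> W" using C(1) by (simp add: W_def sum_nonneg)
    define \<zeta> where "\<zeta> = - A \<tau> / (W + 1)"
    have \<zeta>: "0 < \<zeta>" unfolding \<zeta>_def using \<open>\<not> 0 \<le> A \<tau>\<close> W by (intro divide_pos_pos) auto
    have "eventually (\<lambda>\<epsilon>. \<forall>t\<in>P. \<forall>c \<sigma>\<^sub>0 \<sigma>. 1 / alpha - \<epsilon> < c \<longrightarrow> certificate r c \<sigma>\<^sub>0 \<sigma> \<longrightarrow>
        \<bar>peval (u t) (\<sigma> k) - A t\<bar> \<le> \<zeta>) (at_right 0)"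
      unfolding A_def
    proof (intro eventually_ball_finite[OF P(1)] ballI sigma_near_minimizer form_u \<zeta>)
      fix t assume "t \<in> P"
      then show "u t \<in> std_simplex" using P(3) by (intro u_simplex) auto
      show "u t $ k = 0" using k by (simp add: u_coord)
    qed
    then obtain \<epsilon> where \<epsilon>: "0 < \<epsilon>" "\<And>t c \<sigma>\<^sub>0 \<sigma>. t \<in> P \<Longrightarrow> 1 / alpha - \<epsilon> < c \<Longrightarrow> certificate r c \<sigma>\<^sub>0 \<sigma> \<Longrightarrow>
        \<bar>peval (u t) (\<sigma> k) - A t\<bar> \<le> \<zeta>"
      unfolding eventually_at_right_field by (metis field_lbound_gt_zero half_gt_zero_iff field_less_half_sum less_half_sum add_0)
    have "ereal (1 / alpha - \<epsilon>) < lasserre B r" using conv \<epsilon>(1) by simp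
    then obtain c p h where c: "1 / alpha - \<epsilon> < c" "p \<in> truncated_quadratic_module r" "h \<in> simplex_ideal"
        "quadratic_form B - Const c = p + h"
      unfolding lasserre_def less_Sup_iff by auto
    obtain \<sigma>\<^sub>0 \<sigma> where cert: "certificate r c \<sigma>\<^sub>0 \<sigma>"
      using lasserre_certificate[OF c(2-4)] by blast
    obtain q where q: "degree q \<le> r" "\<And>t. poly q t = peval (u t) (\<sigma> k)"
    proof -
      have "total_degree (\<sigma> k) \<le> r" using cert by (simp add: certificate_def)
      then show thesis
        using peval_on_line[of "\<sigma> k" a d] that order_trans unfolding u_def by blast
    qed
    define g where "g = q - [:A\<^sub>0, A\<^sub>1:]"
    have g: "poly g t = peval (u t) (\<sigma> k) - A t" for t by (simp add: g_def q A)
    have deg: "degree g \<le> Suc r" unfolding g_def using q(1) by (intro degree_diff_le) auto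
    have "(\<Sum>x\<in>P. \<bar>poly g x\<bar>) \<le> (\<Sum>x\<in>P. \<zeta>)"
      unfolding g using \<epsilon>(2)[OF _ c(1) cert] by (intro sum_mono)
    then have "\<bar>coeff g i\<bar> \<le> C * (real (Suc (Suc r)) * \<zeta>)" for i
      using C(2)[OF deg, of i] C(1) P(2) by (metis mult_left_mono order_trans sum_constant)
    then have "\<bar>poly g \<tau>\<bar> \<le> (\<Sum>i\<le>Suc r. C * (real (Suc (Suc r)) * \<zeta>) * \<bar>\<tau>\<bar> ^ i)"
      unfolding poly_eq_sum_upto[OF deg]
      by (intro order_trans[OF sum_abs] sum_mono) (auto simp: abs_mult power_abs intro!: mult_right_mono)
    also have "\<dots> = \<zeta> * W" unfolding W_def sum_distrib_left by (intro sum.cong) (auto simp: mult_ac)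
    finally have "- (\<zeta> * W) \<le> A \<tau>"
    proof -
      assume *: "\<bar>poly g \<tau>\<bar> \<le> \<zeta> * W"
      have "0 \<le> peval (u \<tau>) (\<sigma> k)" using cert by (auto simp: certificate_def intro: sos_nonneg)
      with * show ?thesis unfolding g by linarith
    qed
    moreover have "A \<tau> = - (\<zeta> * (W + 1))" using W by (simp add: \<zeta>_def)
    ultimately show False using \<zeta> by (simp add: algebra_simps)
  qed
  have "A\<^sub>1 = 0"
  proof (rule ccontr)
    assume "A\<^sub>1 \<noteq> 0"
    then have "A ((- A\<^sub>0 - 1) / A\<^sub>1) = - 1" by (simp add: A)
    with A_nonneg[of "(- A\<^sub>0 - 1) / A\<^sub>1"] show False by simp
  qed
  then show ?thesis using alpha_pos by (simp add: A\<^sub>1_def)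
qed

lemma finite_convergence_imp_strict:
  assumes twins: "\<nexists>i j. twin_pair E i j"
    and conv: "lasserre B r = ereal (1 / alpha)" and crit: "critical_edge E {l, m}"
  shows "1 < B $ l $ m"
proof (rule ccontr)
  assume "\<not> 1 < B $ l $ m"
  have edge: "{l, m} \<in> E" using crit by (simp add: critical_edge_def)
  then have one: "B $ l $ m = 1" using B_edge[of l m] \<open>\<not> 1 < B $ l $ m\<close> by simp
  obtain T where T: "l \<notin> T" "m \<notin> T" "insert l T \<in> maximum_stable_sets E" "insert m T \<in> maximum_stable_sets E"
    using critical_edge_exchange[OF crit] by blast
  have "neighbours E l - {m} \<noteq> neighbours E m - {l}"
    using twins edge by (auto simp: twin_pair_def)
  then obtain k where k: "k \<in> neighbours E l - {m} \<and> k \<notin> neighbours E m - {l} \<or>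
      k \<in> neighbours E m - {l} \<and> k \<notin> neighbours E l - {m}" by blast
  then have k': "k \<noteq> l" "k \<noteq> m" "{l, k} \<in> E \<and> {m, k} \<notin> E \<or> {m, k} \<in> E \<and> {l, k} \<notin> E"
    using edge_neq[of l k] edge_neq[of m k] by (auto simp: neighbours_def)
  have "k \<notin> T"
    using T k' by (auto simp: maximum_stable_sets_def stable_def)
  from finite_convergence_imp_equal_weights[OF conv crit one T this k'(1,2)]
  have "B $ l $ k = B $ m $ k" using B_sym by metis
  then show False
    using k' B_edge[of l k] B_edge[of m k] B_nonedge[of l k] B_nonedge[of m k] by auto
qed

end

section \<open>The equivalence\<close>

text \<open>
  The exact certificate shows that the value \<open>1/\<alpha>\<close> is reached at the order of its degrees; evaluation at a
  barycentre shows that no order exceeds it.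
\<close>
lemma (in strict_weighted_graph) finite_convergence:
  "\<exists>r\<ge>1. lasserre B r = ereal (1 / alpha)"
proof -
  obtain \<sigma>\<^sub>0 \<sigma> where \<sigma>: "\<sigma>\<^sub>0 \<in> sos" "\<And>i. \<sigma> i \<in> sos" and rep: "\<And>x. (\<Sum>i\<in>UNIV. x $ i) = 1 \<Longrightarrow>
      form x - 1 / alpha = peval x (\<sigma>\<^sub>0 + (\<Sum>i\<in>UNIV. Var i * \<sigma> i))"
    using quad_module_imp_sos[OF form_in_quad_module] by blast
  let ?p = "\<sigma>\<^sub>0 + (\<Sum>i\<in>UNIV. Var i * \<sigma> i)"
  define h where "h = quadratic_form B - Const (1 / alpha) - ?p"
  have h: "h \<in> simplex_ideal"
    by (rule vanishing_on_hyperplane_imp_simplex_ideal)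
      (use rep in \<open>simp add: h_def peval_quadratic_form\<close>)
  define r where "r = total_degree \<sigma>\<^sub>0 + (\<Sum>i\<in>UNIV. total_degree (Var i * \<sigma> i)) + 1"
  have "total_degree (Var i * \<sigma> i) \<le> r" for i
    using member_le_sum[of i UNIV "\<lambda>i. total_degree (Var i * \<sigma> i)"] by (simp add: r_def)
  then have p: "?p \<in> truncated_quadratic_module r"
    unfolding truncated_quadratic_module_def mem_Collect_eq using \<sigma>
    by (intro exI[of _ \<sigma>\<^sub>0] exI[of _ \<sigma>]) (simp add: r_def)
  have "lasserre B r = ereal (1 / alpha)"
  proof (rule antisym)
    show "ereal (1 / alpha) \<le> lasserre B r"
      unfolding lasserre_def
    proof (rule Sup_upper, rule CollectI, intro exI conjI bexI)
      show "quadratic_form B - Const (1 / alpha) = ?p + h" by (simp add: h_def)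
    qed (use p h in auto)
    show "lasserre B r \<le> ereal (1 / alpha)"
      unfolding lasserre_def
    proof (rule Sup_least, clarify)
      fix c p h
      assume "p \<in> truncated_quadratic_module r" "h \<in> simplex_ideal" "quadratic_form B - Const c = p + h"
      then obtain \<tau>\<^sub>0 \<tau> where cert: "certificate r c \<tau>\<^sub>0 \<tau>" using lasserre_certificate by blast
      obtain S where S: "S \<in> maximum_stable_sets E"
        using ex_maximum_stable[of E] by (auto simp: maximum_stable_sets_def)
      let ?z = "barycentre S"
      have z: "?z \<in> std_simplex" by (rule maximum_stable_setD(4)[OF S])
      have "form ?z - c = peval ?z \<tau>\<^sub>0 + (\<Sum>i\<in>UNIV. ?z $ i * peval ?z (\<tau> i))"
        using cert z by (simp add: certificate_def std_simplex_def)
      moreover have "0 \<le> peval ?z \<tau>\<^sub>0 + (\<Sum>i\<in>UNIV. ?z $ i * peval ?z (\<tau> i))"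
        using cert z by (intro add_nonneg_nonneg sum_nonneg mult_nonneg_nonneg)
          (auto simp: certificate_def std_simplex_def intro: sos_nonneg)
      ultimately show "ereal c \<le> ereal (1 / alpha)" using form_barycentre[OF S] by simp
    qed
  qed
  then show ?thesis by (intro exI[of _ r]) (simp add: r_def)
qed

theorem theorem8:
  fixes E :: "('n::finite) set set" and B :: "real ^ 'n ^ 'n"
  assumes "simple_graph E"
    and "\<nexists>i j. twin_pair E i j"
    and "B \<in> graph_matrices E"
  shows "(\<exists>r\<ge>1. lasserre B r = ereal (1 / real (stability_number E))) \<longleftrightarrow>
         (\<forall>l m. critical_edge E {l, m} \<longrightarrow> B $ l $ m > 1)"
proof -
  interpret weighted_graph E B using assms by unfold_locales
  show ?thesis
  proof
    assume "\<exists>r\<ge>1. lasserre B r = ereal (1 / real (stability_number E))"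
    then show "\<forall>l m. critical_edge E {l, m} \<longrightarrow> B $ l $ m > 1"
      using finite_convergence_imp_strict[OF assms(2)] by blast
  next
    assume "\<forall>l m. critical_edge E {l, m} \<longrightarrow> B $ l $ m > 1"
    then interpret strict_weighted_graph E B by unfold_locales blast
    show "\<exists>r\<ge>1. lasserre B r = ereal (1 / real (stability_number E))"
      by (rule finite_convergence)
  qed
qed

end
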